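(* For each $s$ such that $1\le s\le r$: 1. The $A/\mathfrak{a}_{s+1}$-module $\mathrm{der}_K(A)_s$ does not depend on the choice of generators for the ideal $I$: two finite generating sets of $I$ give the same $A/\mathfrak{a}_{s+1}$-submodule of $\mathrm{Der}_K(A,A/\mathfrak{a}_{s+1})$. 2. The $A/\mathfrak{a}_{s+1}$-module $\mathrm{der}_K(A)_s$ does not depend on the presentation of the algebra $A$ as the factor algebra $P_n/I$, in the following sense: let $\sigma:A=P_n/I\to A'=P_{n'}/I'$ be a $K$-algebra isomorphism, let $r'$ and $\mathfrak{a}'_k$ be the rank and the Jacobian ideals for the presentation $P_{n'}/I'$, put $s'=s+r'-r$, and suppose $1\le s'\le r'$. Then $\sigma$ induces an isomorphism $\overline{\sigma}:A/\mathfrak{a}_{s+1}\to A'/\mathfrak{a}'_{s'+1}$, and $\overline{\sigma}\,\mathrm{der}_K(A)_s\,\sigma^{-1}=\mathrm{der}_K(A')_{s'}$.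
   Context: $K$ is a field of characteristic zero, $P_n=K[x_1,\ldots,x_n]$, $I=\sum_{i=1}^m P_nf_i$ is a prime but not maximal ideal of $P_n$ with generators $f_1,\ldots,f_m$, and $A=P_n/I$, a domain with field of fractions $Q$. $\overline{J}=\left(\overline{\partial f_i/\partial x_j}\right)\in M_{m,n}(A)$ is the Jacobi matrix and $r$ is its rank over $Q$. For $1\le k\le r$, the Jacobian ideal $\mathfrak{a}_k$ is the ideal of $A$ generated by all $k\times k$ minors of $\overline{J}$ (it does not depend on the choice of generators of $I$), and $\mathfrak{a}_{r+1}:=0$. The analogous notation is used for $P_{n'}=K[x'_1,\ldots,x'_{n'}]$, $I'$. For $1\le s\le r$, $1\le i_1<\cdots<i_s\le m$ and $1\le j_1<\cdots<j_{s+1}\le n$, let $\partial_{\mathbf{i},\mathbf{j}}=\partial_{i_1,\ldots,i_s;j_1,\ldots,j_{s+1}}\in\mathrm{Der}_K(A,A/\mathfrak{a}_{s+1})$ be the $K$-derivation from $A$ to $A/\mathfrak{a}_{s+1}$ given by the formal determinant with first $s$ rows $\left(\overline{\partial f_{i_\nu}/\partial x_{j_1}},\ldots,\overline{\partial f_{i_\nu}/\partial x_{j_{s+1}}}\right)$, $\nu=1,\ldots,s$, and last row $(\partial_{j_1},\ldots,\partial_{j_{s+1}})$, $\partial_j=\partial/\partial x_j$, expanded along the last row, with coefficients taken modulo $\mathfrak{a}_{s+1}$. That is, $x_{j_k}\mapsto(-1)^{s+1+k}\Delta_k+\mathfrak{a}_{s+1}$, where $\Delta_k$ is the $s\times s$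 minor of $\overline{J}$ with rows $i_1,\ldots,i_s$ and columns $j_1,\ldots,j_{s+1}$ with $j_k$ omitted, and $x_l\mapsto0$ for $l\notin\{j_1,\ldots,j_{s+1}\}$ (this is well defined). For the given presentation and generators, $\mathrm{der}_K(A)_s$ is the left $A/\mathfrak{a}_{s+1}$-submodule of $\mathrm{Der}_K(A,A/\mathfrak{a}_{s+1})$ generated by all these derivations $\partial_{\mathbf{i},\mathbf{j}}$. *)

theory Defs
  imports
    "HOL-Library.Poly_Mapping"
    "HOL-Combinatorics.Permutations"
    "HOL-Algebra.QuotRing"
    "HOL-Algebra.Module"
begin

section \<open>Polynomial rings in finitely many variables\<close>

text \<open>The variables are indexed by natural numbers; the ring in \<open>n\<close> variables
  consists of the polynomials that only involve the variables with indices \<open>1,\<dots>,n\<close>,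
  so that \<open>n\<close> is a term rather than a type.\<close>

type_synonym 'k mpoly = "(nat \<Rightarrow>\<^sub>0 nat) \<Rightarrow>\<^sub>0 'k"

definition mp_const :: "'k::comm_ring_1 \<Rightarrow> 'k mpoly" where
  "mp_const c = Poly_Mapping.single 0 c"

definition mp_pderiv :: "nat \<Rightarrow> 'k::comm_ring_1 mpoly \<Rightarrow> 'k mpoly" where
  "mp_pderiv j p =
     (\<Sum>e\<in>Poly_Mapping.keys p.
        Poly_Mapping.single (e - Poly_Mapping.single j 1)
          (of_nat (Poly_Mapping.lookup e j) * Poly_Mapping.lookup p e))"

definition mpoly_ring :: "nat \<Rightarrow> 'k::comm_ring_1 mpoly ring" where
  "mpoly_ring n =
     \<lparr>carrier = {p. \<forall>e\<in>Poly_Mapping.keys p. Poly_Mapping.keys e \<subseteq> {1..n}},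
      mult = (*), one = 1, zero = 0, add = (+)\<rparr>"

lemma cring_mpoly_ring: "cring (mpoly_ring n :: 'k::comm_ring_1 mpoly ring)"
proof (rule cringI)
  show "abelian_group (mpoly_ring n :: 'k mpoly ring)"
  proof (rule abelian_groupI)
    fix p q :: "'k mpoly"
    assume "p \<in> carrier (mpoly_ring n)" "q \<in> carrier (mpoly_ring n)"
    then show "p \<oplus>\<^bsub>mpoly_ring n\<^esub> q \<in> carrier (mpoly_ring n)"
      using Poly_Mapping.keys_add[of p q] by (auto simp: mpoly_ring_def)
  next
    fix p :: "'k mpoly"
    assume "p \<in> carrier (mpoly_ring n)"
    then show "\<exists>q\<in>carrier (mpoly_ring n). q \<oplus>\<^bsub>mpoly_ring n\<^esub> p = \<zero>\<^bsub>mpoly_ring n\<^esub>"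
      by (intro bexI[of _ "- p"]) (auto simp: mpoly_ring_def in_keys_iff)
  qed (auto simp: mpoly_ring_def add_ac)
  show "comm_monoid (mpoly_ring n :: 'k mpoly ring)"
  proof (rule comm_monoidI)
    fix p q :: "'k mpoly"
    assume pq: "p \<in> carrier (mpoly_ring n)" "q \<in> carrier (mpoly_ring n)"
    show "p \<otimes>\<^bsub>mpoly_ring n\<^esub> q \<in> carrier (mpoly_ring n)"
    proof -
      have "Poly_Mapping.keys e \<subseteq> {1..n}" if e: "e \<in> Poly_Mapping.keys (p * q)" for e
      proof -
        obtain a b where "a \<in> Poly_Mapping.keys p" "b \<in> Poly_Mapping.keys q" "e = a + b"
          using e keys_mult[of p q] by blast
        then show ?thesis
          using pq Poly_Mapping.keys_add[of a b] by (fastforce simp: mpoly_ring_def)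
      qed
      then show ?thesis by (simp add: mpoly_ring_def)
    qed
  qed (auto simp: mpoly_ring_def mult_ac)
qed (auto simp: mpoly_ring_def algebra_simps)


section \<open>The field of fractions of a domain\<close>

definition frac_rel :: "('a, 'b) ring_scheme \<Rightarrow> (('a \<times> 'a) \<times> ('a \<times> 'a)) set" where
  "frac_rel R =
     {((a, b), (c, d)).
        a \<in> carrier R \<and> b \<in> carrier R - {\<zero>\<^bsub>R\<^esub>} \<and> c \<in> carrier R \<and> d \<in> carrier R - {\<zero>\<^bsub>R\<^esub>} \<and>
        a \<otimes>\<^bsub>R\<^esub> d = c \<otimes>\<^bsub>R\<^esub> b}"

definition fraction :: "('a, 'b) ring_scheme \<Rightarrow> 'a \<Rightarrow> 'a \<Rightarrow> ('a \<times> 'a) set" where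
  "fraction R a b = frac_rel R `` {(a, b)}"

definition frac_field :: "('a, 'b) ring_scheme \<Rightarrow> ('a \<times> 'a) set ring" where
  "frac_field R =
     \<lparr>carrier = {fraction R a b | a b. a \<in> carrier R \<and> b \<in> carrier R - {\<zero>\<^bsub>R\<^esub>}},
      mult = (\<lambda>U V. \<Union>(a, b)\<in>U. \<Union>(c, d)\<in>V. fraction R (a \<otimes>\<^bsub>R\<^esub> c) (b \<otimes>\<^bsub>R\<^esub> d)),
      one = fraction R \<one>\<^bsub>R\<^esub> \<one>\<^bsub>R\<^esub>,
      zero = fraction R \<zero>\<^bsub>R\<^esub> \<one>\<^bsub>R\<^esub>,
      add = (\<lambda>U V. \<Union>(a, b)\<in>U. \<Union>(c, d)\<in>V.
               fraction R (a \<otimes>\<^bsub>R\<^esub> d \<oplus>\<^bsub>R\<^esub> c \<otimes>\<^bsub>R\<^esub> b) (b \<otimes>\<^bsub>R\<^esub> d))\<rparr>"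

lemma UN_UN_const:
  assumes "p \<in> U" "q \<in> V" "\<And>a b c d. (a, b) \<in> U \<Longrightarrow> (c, d) \<in> V \<Longrightarrow> G a b c d = F"
  shows "(\<Union>(a, b)\<in>U. \<Union>(c, d)\<in>V. G a b c d) = F"
proof -
  have "(\<Union>(a, b)\<in>U. \<Union>(c, d)\<in>V. G a b c d) = (\<Union>x\<in>U. \<Union>y\<in>V. F)"
    using assms(3) by (intro SUP_cong refl) (auto split: prod.splits)
  also have "\<dots> = F" using assms(1,2) by auto
  finally show ?thesis .
qed

context domain
begin

lemma frac_cross:
  assumes "a \<in> carrier R" "b \<in> carrier R" "c \<in> carrier R" "d \<in> carrier R"
    "e \<in> carrier R" "f \<in> carrier R" "d \<noteq> \<zero>" "a \<otimes> d = c \<otimes> b" "c \<otimes> f = e \<otimes> d"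
  shows "a \<otimes> f = e \<otimes> b"
proof -
  have "d \<otimes> (a \<otimes> f) = (a \<otimes> d) \<otimes> f" using assms(1-6) by algebra
  also have "\<dots> = (c \<otimes> f) \<otimes> b" using assms by (simp add: m_ac)
  also have "\<dots> = d \<otimes> (e \<otimes> b)" using assms by (simp add: m_ac)
  finally show ?thesis using assms by (simp add: m_lcancel)
qed

lemma equiv_frac_rel: "equiv (carrier R \<times> (carrier R - {\<zero>})) (frac_rel R)"
proof (rule equivI)
  show "frac_rel R \<subseteq> (carrier R \<times> (carrier R - {\<zero>})) \<times> (carrier R \<times> (carrier R - {\<zero>}))"
    by (auto simp: frac_rel_def)
  show "refl_on (carrier R \<times> (carrier R - {\<zero>})) (frac_rel R)"
    by (auto simp: refl_on_def frac_rel_def)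
  show "sym (frac_rel R)" by (auto simp: sym_def frac_rel_def)
  show "trans (frac_rel R)"
    by (auto simp: trans_def frac_rel_def intro: frac_cross)
qed

lemma frac_eq_iff:
  assumes "a \<in> carrier R" "b \<in> carrier R" "b \<noteq> \<zero>" "c \<in> carrier R" "d \<in> carrier R" "d \<noteq> \<zero>"
  shows "fraction R a b = fraction R c d \<longleftrightarrow> a \<otimes> d = c \<otimes> b"
proof -
  have "fraction R a b = fraction R c d \<longleftrightarrow> ((a, b), (c, d)) \<in> frac_rel R"
    unfolding fraction_def using assms by (intro eq_equiv_class_iff[OF equiv_frac_rel]) auto
  then show ?thesis using assms by (simp add: frac_rel_def)
qed

lemma frac_memD:
  assumes "(c, d) \<in> fraction R a b"
  shows "a \<in> carrier R" "b \<in> carrier R" "b \<noteq> \<zero>" "c \<in> carrier R" "d \<in> carrier R" "d \<noteq> \<zero>"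
    "a \<otimes> d = c \<otimes> b"
  using assms by (auto simp: fraction_def frac_rel_def)

lemma frac_self_mem:
  assumes "a \<in> carrier R" "b \<in> carrier R" "b \<noteq> \<zero>"
  shows "(a, b) \<in> fraction R a b"
  using assms by (auto simp: fraction_def frac_rel_def)

lemma frac_mult:
  assumes "a \<in> carrier R" "b \<in> carrier R" "b \<noteq> \<zero>" "c \<in> carrier R" "d \<in> carrier R" "d \<noteq> \<zero>"
  shows "fraction R a b \<otimes>\<^bsub>frac_field R\<^esub> fraction R c d = fraction R (a \<otimes> c) (b \<otimes> d)"
proof -
  have "fraction R (a' \<otimes> c') (b' \<otimes> d') = fraction R (a \<otimes> c) (b \<otimes> d)"
    if "(a', b') \<in> fraction R a b" "(c', d') \<in> fraction R c d" for a' b' c' d'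
  proof -
    note A = frac_memD[OF that(1)] and C = frac_memD[OF that(2)]
    have "(a' \<otimes> c') \<otimes> (b \<otimes> d) = (a' \<otimes> b) \<otimes> (c' \<otimes> d)" using A C by algebra
    also have "\<dots> = (a \<otimes> b') \<otimes> (c \<otimes> d')" using A(7) C(7) by simp
    also have "\<dots> = (a \<otimes> c) \<otimes> (b' \<otimes> d')" using A(1-6) C(1-6) by algebra
    finally show ?thesis using A(1-6) C(1-6) by (subst frac_eq_iff) (auto simp: integral_iff)
  qed
  then show ?thesis
    by (simp add: frac_field_def
          UN_UN_const[OF frac_self_mem[OF assms(1-3)] frac_self_mem[OF assms(4-6)]])
qed

lemma frac_add:
  assumes "a \<in> carrier R" "b \<in> carrier R" "b \<noteq> \<zero>" "c \<in> carrier R" "d \<in> carrier R" "d \<noteq> \<zero>"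
  shows "fraction R a b \<oplus>\<^bsub>frac_field R\<^esub> fraction R c d = fraction R (a \<otimes> d \<oplus> c \<otimes> b) (b \<otimes> d)"
proof -
  have "fraction R (a' \<otimes> d' \<oplus> c' \<otimes> b') (b' \<otimes> d') = fraction R (a \<otimes> d \<oplus> c \<otimes> b) (b \<otimes> d)"
    if "(a', b') \<in> fraction R a b" "(c', d') \<in> fraction R c d" for a' b' c' d'
  proof -
    note A = frac_memD[OF that(1)] and C = frac_memD[OF that(2)]
    have "(a' \<otimes> d' \<oplus> c' \<otimes> b') \<otimes> (b \<otimes> d)
        = (a' \<otimes> b) \<otimes> (d \<otimes> d') \<oplus> (c' \<otimes> d) \<otimes> (b \<otimes> b')" using A(1-6) C(1-6) by algebra
    also have "\<dots> = (a \<otimes> b') \<otimes> (d \<otimes> d') \<oplus> (c \<otimes> d') \<otimes> (b \<otimes> b')" using A(7) C(7) by simp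
    also have "\<dots> = (a \<otimes> d \<oplus> c \<otimes> b) \<otimes> (b' \<otimes> d')" using A(1-6) C(1-6) by algebra
    finally show ?thesis using A(1-6) C(1-6) by (subst frac_eq_iff) (auto simp: integral_iff)
  qed
  then show ?thesis
    by (simp add: frac_field_def
          UN_UN_const[OF frac_self_mem[OF assms(1-3)] frac_self_mem[OF assms(4-6)]])
qed

lemma frac_closed:
  assumes "a \<in> carrier R" "b \<in> carrier R" "b \<noteq> \<zero>"
  shows "fraction R a b \<in> carrier (frac_field R)"
  using assms by (auto simp: frac_field_def)

lemma frac_cases:
  assumes "U \<in> carrier (frac_field R)"
  obtains a b where "a \<in> carrier R" "b \<in> carrier R" "b \<noteq> \<zero>" "U = fraction R a b"
  using assms by (auto simp: frac_field_def)

lemma frac_one: "\<one>\<^bsub>frac_field R\<^esub> = fraction R \<one> \<one>"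
  and frac_zero: "\<zero>\<^bsub>frac_field R\<^esub> = fraction R \<zero> \<one>"
  by (simp_all add: frac_field_def)

lemma field_frac_field: "field (frac_field R)"
proof (rule cring.cring_fieldI2)
  show "cring (frac_field R)"
  proof (rule cringI)
    show "abelian_group (frac_field R)"
    proof (rule abelian_groupI)
      fix U V W
      assume U: "U \<in> carrier (frac_field R)" and V: "V \<in> carrier (frac_field R)"
        and W: "W \<in> carrier (frac_field R)"
      from U obtain a b where ab: "a \<in> carrier R" "b \<in> carrier R" "b \<noteq> \<zero>" "U = fraction R a b"
        by (rule frac_cases)
      from V obtain c d where cd: "c \<in> carrier R" "d \<in> carrier R" "d \<noteq> \<zero>" "V = fraction R c d"
        by (rule frac_cases)
      from W obtain e f where ef: "e \<in> carrier R" "f \<in> carrier R" "f \<noteq> \<zero>" "W = fraction R e f"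
        by (rule frac_cases)
      have "((a \<otimes> d \<oplus> c \<otimes> b) \<otimes> f \<oplus> e \<otimes> (b \<otimes> d)) \<otimes> (b \<otimes> (d \<otimes> f)) =
          (a \<otimes> (d \<otimes> f) \<oplus> (c \<otimes> f \<oplus> e \<otimes> d) \<otimes> b) \<otimes> (b \<otimes> d \<otimes> f)"
        using ab(1,2) cd(1,2) ef(1,2) by algebra
      then show "U \<oplus>\<^bsub>frac_field R\<^esub> V \<oplus>\<^bsub>frac_field R\<^esub> W =
          U \<oplus>\<^bsub>frac_field R\<^esub> (V \<oplus>\<^bsub>frac_field R\<^esub> W)"
        using ab cd ef by (simp add: frac_add integral_iff frac_eq_iff)
    next
      fix U V
      assume U: "U \<in> carrier (frac_field R)" and V: "V \<in> carrier (frac_field R)"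
      from U obtain a b where ab: "a \<in> carrier R" "b \<in> carrier R" "b \<noteq> \<zero>" "U = fraction R a b"
        by (rule frac_cases)
      from V obtain c d where cd: "c \<in> carrier R" "d \<in> carrier R" "d \<noteq> \<zero>" "V = fraction R c d"
        by (rule frac_cases)
      show "U \<oplus>\<^bsub>frac_field R\<^esub> V \<in> carrier (frac_field R)"
        using ab cd by (simp add: frac_add integral_iff frac_closed)
      show "U \<oplus>\<^bsub>frac_field R\<^esub> V = V \<oplus>\<^bsub>frac_field R\<^esub> U"
        using ab cd by (simp add: frac_add a_comm m_comm)
    next
      fix U assume U: "U \<in> carrier (frac_field R)"
      from U obtain a b where ab: "a \<in> carrier R" "b \<in> carrier R" "b \<noteq> \<zero>" "U = fraction R a b"
        by (rule frac_cases)
      show "\<zero>\<^bsub>frac_field R\<^esub> \<oplus>\<^bsub>frac_field R\<^esub> U = U"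
        using ab by (simp add: frac_zero frac_add)
      have "fraction R (\<ominus> a) b \<oplus>\<^bsub>frac_field R\<^esub> U = \<zero>\<^bsub>frac_field R\<^esub>"
        using ab by (simp add: frac_zero frac_add frac_eq_iff integral_iff l_minus l_neg)
      then show "\<exists>V\<in>carrier (frac_field R). V \<oplus>\<^bsub>frac_field R\<^esub> U = \<zero>\<^bsub>frac_field R\<^esub>"
        using ab frac_closed[of "\<ominus> a" b] by blast
    qed (simp add: frac_zero frac_closed)
    show "comm_monoid (frac_field R)"
    proof (rule comm_monoidI)
      fix U V W
      assume U: "U \<in> carrier (frac_field R)" and V: "V \<in> carrier (frac_field R)"
        and W: "W \<in> carrier (frac_field R)"
      from U obtain a b where ab: "a \<in> carrier R" "b \<in> carrier R" "b \<noteq> \<zero>" "U = fraction R a b"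
        by (rule frac_cases)
      from V obtain c d where cd: "c \<in> carrier R" "d \<in> carrier R" "d \<noteq> \<zero>" "V = fraction R c d"
        by (rule frac_cases)
      from W obtain e f where ef: "e \<in> carrier R" "f \<in> carrier R" "f \<noteq> \<zero>" "W = fraction R e f"
        by (rule frac_cases)
      show "U \<otimes>\<^bsub>frac_field R\<^esub> V \<otimes>\<^bsub>frac_field R\<^esub> W =
          U \<otimes>\<^bsub>frac_field R\<^esub> (V \<otimes>\<^bsub>frac_field R\<^esub> W)"
        using ab cd ef by (simp add: frac_mult integral_iff m_assoc)
    next
      fix U V
      assume U: "U \<in> carrier (frac_field R)" and V: "V \<in> carrier (frac_field R)"
      from U obtain a b where ab: "a \<in> carrier R" "b \<in> carrier R" "b \<noteq> \<zero>" "U = fraction R a b"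
        by (rule frac_cases)
      from V obtain c d where cd: "c \<in> carrier R" "d \<in> carrier R" "d \<noteq> \<zero>" "V = fraction R c d"
        by (rule frac_cases)
      show "U \<otimes>\<^bsub>frac_field R\<^esub> V \<in> carrier (frac_field R)"
        using ab cd by (simp add: frac_mult integral_iff frac_closed)
      show "U \<otimes>\<^bsub>frac_field R\<^esub> V = V \<otimes>\<^bsub>frac_field R\<^esub> U"
        using ab cd by (simp add: frac_mult m_comm)
    next
      fix U assume U: "U \<in> carrier (frac_field R)"
      then show "\<one>\<^bsub>frac_field R\<^esub> \<otimes>\<^bsub>frac_field R\<^esub> U = U"
        by (elim frac_cases) (simp add: frac_one frac_mult)
    qed (simp add: frac_one frac_closed)
  next
    fix U V W
    assume U: "U \<in> carrier (frac_field R)" and V: "V \<in> carrier (frac_field R)"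
      and W: "W \<in> carrier (frac_field R)"
    from U obtain a b where ab: "a \<in> carrier R" "b \<in> carrier R" "b \<noteq> \<zero>" "U = fraction R a b"
      by (rule frac_cases)
    from V obtain c d where cd: "c \<in> carrier R" "d \<in> carrier R" "d \<noteq> \<zero>" "V = fraction R c d"
      by (rule frac_cases)
    from W obtain e f where ef: "e \<in> carrier R" "f \<in> carrier R" "f \<noteq> \<zero>" "W = fraction R e f"
      by (rule frac_cases)
    have "((a \<otimes> d \<oplus> c \<otimes> b) \<otimes> e) \<otimes> ((b \<otimes> f) \<otimes> (d \<otimes> f)) =
        ((a \<otimes> e) \<otimes> (d \<otimes> f) \<oplus> (c \<otimes> e) \<otimes> (b \<otimes> f)) \<otimes> (b \<otimes> d \<otimes> f)"
      using ab(1,2) cd(1,2) ef(1,2) by algebra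
    then show "(U \<oplus>\<^bsub>frac_field R\<^esub> V) \<otimes>\<^bsub>frac_field R\<^esub> W =
        U \<otimes>\<^bsub>frac_field R\<^esub> W \<oplus>\<^bsub>frac_field R\<^esub> V \<otimes>\<^bsub>frac_field R\<^esub> W"
      using ab cd ef by (simp add: frac_add frac_mult integral_iff frac_eq_iff)
  qed
  show "\<zero>\<^bsub>frac_field R\<^esub> \<noteq> \<one>\<^bsub>frac_field R\<^esub>"
    by (simp add: frac_one frac_zero frac_eq_iff)
  fix U assume U: "U \<in> carrier (frac_field R)" and nz: "U \<noteq> \<zero>\<^bsub>frac_field R\<^esub>"
  from U obtain a b where ab: "a \<in> carrier R" "b \<in> carrier R" "b \<noteq> \<zero>" "U = fraction R a b"
    by (rule frac_cases)
  have "a \<noteq> \<zero>" using nz ab by (auto simp: frac_zero frac_eq_iff)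
  then show "\<exists>V\<in>carrier (frac_field R). U \<otimes>\<^bsub>frac_field R\<^esub> V = \<one>\<^bsub>frac_field R\<^esub>"
    using ab by (intro bexI[of _ "fraction R b a"])
      (auto simp: frac_one frac_mult frac_eq_iff frac_closed integral_iff m_comm)
qed

end


section \<open>Rank and determinants\<close>

text \<open>Matrices are functions of a row and a column index, both starting from 1.\<close>

definition lin_indep_columns ::
  "('q, 'c) ring_scheme \<Rightarrow> nat \<Rightarrow> (nat \<Rightarrow> nat \<Rightarrow> 'q) \<Rightarrow> nat set \<Rightarrow> bool" where
  "lin_indep_columns Q m M S \<longleftrightarrow>
     (\<forall>c\<in>S \<rightarrow> carrier Q.
        (\<forall>i\<in>{1..m}. (\<Oplus>\<^bsub>Q\<^esub>j\<in>S. c j \<otimes>\<^bsub>Q\<^esub> M i j) = \<zero>\<^bsub>Q\<^esub>) \<longrightarrow> (\<forall>j\<in>S. c j = \<zero>\<^bsub>Q\<^esub>))"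

definition mat_rank :: "('q, 'c) ring_scheme \<Rightarrow> nat \<Rightarrow> nat \<Rightarrow> (nat \<Rightarrow> nat \<Rightarrow> 'q) \<Rightarrow> nat" where
  "mat_rank Q m n M = Max {card S | S. S \<subseteq> {1..n} \<and> lin_indep_columns Q m M S}"

definition ring_det :: "('a, 'b) ring_scheme \<Rightarrow> nat \<Rightarrow> (nat \<Rightarrow> nat \<Rightarrow> 'a) \<Rightarrow> 'a" where
  "ring_det R k M =
     (\<Oplus>\<^bsub>R\<^esub>\<pi>\<in>{\<pi>. \<pi> permutes {1..k}}. [sign \<pi>] \<cdot>\<^bsub>R\<^esub> (\<Otimes>\<^bsub>R\<^esub>u\<in>{1..k}. M u (\<pi> u)))"

definition increasing_tuples :: "nat \<Rightarrow> nat \<Rightarrow> (nat \<Rightarrow> nat) set" where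
  "increasing_tuples k n = {t \<in> {1..k} \<rightarrow> {1..n}. strict_mono_on {1..k} t}"


section \<open>Derivations into a factor ring\<close>

text \<open>\<open>derivations \<kappa> A a\<close> is the set of \<open>K\<close>-derivations from \<open>A\<close> to the \<open>A\<close>-module \<open>A/a\<close>,
  where \<open>\<kappa> : K \<rightarrow> A\<close> is the structure map of the \<open>K\<close>-algebra \<open>A\<close>.  Derivations are
  extensional functions on the carrier of \<open>A\<close>, so that equality of derivations is equality
  in HOL.\<close>

definition derivations ::
  "('k \<Rightarrow> 'a) \<Rightarrow> ('a, 'b) ring_scheme \<Rightarrow> 'a set \<Rightarrow> ('a \<Rightarrow> 'a set) set" where
  "derivations \<kappa> A a =
     {D \<in> carrier A \<rightarrow>\<^sub>E carrier (A Quot a).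
        (\<forall>x\<in>carrier A. \<forall>y\<in>carrier A.
           D (x \<oplus>\<^bsub>A\<^esub> y) = D x \<oplus>\<^bsub>A Quot a\<^esub> D y) \<and>
        (\<forall>c. \<forall>x\<in>carrier A.
           D (\<kappa> c \<otimes>\<^bsub>A\<^esub> x) = (a +>\<^bsub>A\<^esub> \<kappa> c) \<otimes>\<^bsub>A Quot a\<^esub> D x) \<and>
        (\<forall>x\<in>carrier A. \<forall>y\<in>carrier A.
           D (x \<otimes>\<^bsub>A\<^esub> y) =
             (a +>\<^bsub>A\<^esub> x) \<otimes>\<^bsub>A Quot a\<^esub> D y \<oplus>\<^bsub>A Quot a\<^esub> (a +>\<^bsub>A\<^esub> y) \<otimes>\<^bsub>A Quot a\<^esub> D x)}"

text \<open>The \<open>mult\<close> and \<open>one\<close> fields of the module record play no role.\<close>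

definition der_module ::
  "('k \<Rightarrow> 'a) \<Rightarrow> ('a, 'b) ring_scheme \<Rightarrow> 'a set \<Rightarrow> ('a set, 'a \<Rightarrow> 'a set) module" where
  "der_module \<kappa> A a =
     \<lparr>carrier = derivations \<kappa> A a, mult = undefined, one = undefined,
      zero = (\<lambda>x\<in>carrier A. \<zero>\<^bsub>A Quot a\<^esub>),
      add = (\<lambda>D E. \<lambda>x\<in>carrier A. D x \<oplus>\<^bsub>A Quot a\<^esub> E x),
      smult = (\<lambda>b D. \<lambda>x\<in>carrier A. b \<otimes>\<^bsub>A Quot a\<^esub> D x)\<rparr>"

definition gen_submodule ::
  "('r, 'b) ring_scheme \<Rightarrow> ('r, 'm, 'c) module_scheme \<Rightarrow> 'm set \<Rightarrow> 'm set" where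
  "gen_submodule R M G = \<Inter>{N. submodule N R M \<and> G \<subseteq> N}"

lemma module_der_module:
  assumes "cring A" "ideal a A" and \<kappa>: "\<And>c. \<kappa> c \<in> carrier A"
  shows "module (A Quot a) (der_module \<kappa> A a)"
proof -
  interpret A: cring A by fact
  interpret a: ideal a A by fact
  interpret B: cring "A Quot a" by (rule a.quotient_is_cring) fact
  have cos[simp]: "a +>\<^bsub>A\<^esub> x \<in> carrier (A Quot a)" if "x \<in> carrier A" for x
    using that by (auto simp: FactRing_def A_RCOSETS_def')
  have ext: "D = E" if "D \<in> derivations \<kappa> A a" "E \<in> derivations \<kappa> A a"
      "\<And>x. x \<in> carrier A \<Longrightarrow> D x = E x" for D E
    using that by (auto simp: derivations_def intro: PiE_ext)
  have clD[simp]: "D x \<in> carrier (A Quot a)" if "D \<in> derivations \<kappa> A a" "x \<in> carrier A" for D x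
    using that by (auto simp: derivations_def)
  have dadd: "D (x \<oplus>\<^bsub>A\<^esub> y) = D x \<oplus>\<^bsub>A Quot a\<^esub> D y"
    if "D \<in> derivations \<kappa> A a" "x \<in> carrier A" "y \<in> carrier A" for D x y
    using that by (auto simp: derivations_def)
  have dsc: "D (\<kappa> c \<otimes>\<^bsub>A\<^esub> x) = (a +>\<^bsub>A\<^esub> \<kappa> c) \<otimes>\<^bsub>A Quot a\<^esub> D x"
    if "D \<in> derivations \<kappa> A a" "x \<in> carrier A" for D x c
    using that by (auto simp: derivations_def)
  have dmul: "D (x \<otimes>\<^bsub>A\<^esub> y) =
       (a +>\<^bsub>A\<^esub> x) \<otimes>\<^bsub>A Quot a\<^esub> D y \<oplus>\<^bsub>A Quot a\<^esub> (a +>\<^bsub>A\<^esub> y) \<otimes>\<^bsub>A Quot a\<^esub> D x"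
    if "D \<in> derivations \<kappa> A a" "x \<in> carrier A" "y \<in> carrier A" for D x y
    using that by (auto simp: derivations_def)
  have dI: "(\<lambda>x\<in>carrier A. F x) \<in> derivations \<kappa> A a"
    if "\<And>x. x \<in> carrier A \<Longrightarrow> F x \<in> carrier (A Quot a)"
      "\<And>x y. x \<in> carrier A \<Longrightarrow> y \<in> carrier A \<Longrightarrow> F (x \<oplus>\<^bsub>A\<^esub> y) = F x \<oplus>\<^bsub>A Quot a\<^esub> F y"
      "\<And>c x. x \<in> carrier A \<Longrightarrow> F (\<kappa> c \<otimes>\<^bsub>A\<^esub> x) = (a +>\<^bsub>A\<^esub> \<kappa> c) \<otimes>\<^bsub>A Quot a\<^esub> F x"
      "\<And>x y. x \<in> carrier A \<Longrightarrow> y \<in> carrier A \<Longrightarrow> F (x \<otimes>\<^bsub>A\<^esub> y) =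
         (a +>\<^bsub>A\<^esub> x) \<otimes>\<^bsub>A Quot a\<^esub> F y \<oplus>\<^bsub>A Quot a\<^esub> (a +>\<^bsub>A\<^esub> y) \<otimes>\<^bsub>A Quot a\<^esub> F x" for F
    unfolding derivations_def mem_Collect_eq
    by (intro conjI ballI allI)
      (simp add: that(1), simp add: that(2), simp add: that(3) \<kappa>, simp add: that(4))
  have c0: "(\<lambda>x\<in>carrier A. \<zero>\<^bsub>A Quot a\<^esub>) \<in> derivations \<kappa> A a"
    using \<kappa> by (intro dI) auto
  have cadd: "(\<lambda>x\<in>carrier A. D x \<oplus>\<^bsub>A Quot a\<^esub> E x) \<in> derivations \<kappa> A a"
    if DE: "D \<in> derivations \<kappa> A a" "E \<in> derivations \<kappa> A a" for D E
  proof (rule dI)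
    fix x y assume "x \<in> carrier A" "y \<in> carrier A"
    then show "D (x \<otimes>\<^bsub>A\<^esub> y) \<oplus>\<^bsub>A Quot a\<^esub> E (x \<otimes>\<^bsub>A\<^esub> y) =
      (a +>\<^bsub>A\<^esub> x) \<otimes>\<^bsub>A Quot a\<^esub> (D y \<oplus>\<^bsub>A Quot a\<^esub> E y) \<oplus>\<^bsub>A Quot a\<^esub>
      (a +>\<^bsub>A\<^esub> y) \<otimes>\<^bsub>A Quot a\<^esub> (D x \<oplus>\<^bsub>A Quot a\<^esub> E x)"
      using DE by (simp add: dmul B.r_distr B.a_ac)
  qed (use DE \<kappa> in \<open>simp_all add: dadd dsc B.r_distr B.a_ac\<close>)
  have csm: "(\<lambda>x\<in>carrier A. b \<otimes>\<^bsub>A Quot a\<^esub> D x) \<in> derivations \<kappa> A a"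
    if D: "D \<in> derivations \<kappa> A a" and b: "b \<in> carrier (A Quot a)" for D b
  proof (rule dI)
    fix x y assume "x \<in> carrier A" "y \<in> carrier A"
    then show "b \<otimes>\<^bsub>A Quot a\<^esub> D (x \<otimes>\<^bsub>A\<^esub> y) =
      (a +>\<^bsub>A\<^esub> x) \<otimes>\<^bsub>A Quot a\<^esub> (b \<otimes>\<^bsub>A Quot a\<^esub> D y) \<oplus>\<^bsub>A Quot a\<^esub>
      (a +>\<^bsub>A\<^esub> y) \<otimes>\<^bsub>A Quot a\<^esub> (b \<otimes>\<^bsub>A Quot a\<^esub> D x)"
      using D b by (simp add: dmul B.r_distr B.m_lcomm)
  qed (use D b \<kappa> in \<open>simp_all add: dadd dsc B.r_distr B.m_lcomm\<close>)
  define M where "M = der_module \<kappa> A a"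
  have M: "carrier M = derivations \<kappa> A a" "\<zero>\<^bsub>M\<^esub> = (\<lambda>x\<in>carrier A. \<zero>\<^bsub>A Quot a\<^esub>)"
    "\<And>D E. D \<oplus>\<^bsub>M\<^esub> E = (\<lambda>x\<in>carrier A. D x \<oplus>\<^bsub>A Quot a\<^esub> E x)"
    "\<And>b D. b \<odot>\<^bsub>M\<^esub> D = (\<lambda>x\<in>carrier A. b \<otimes>\<^bsub>A Quot a\<^esub> D x)"
    by (simp_all add: M_def der_module_def)
  have "abelian_group M"
  proof (rule abelian_groupI, unfold M)
    fix D E F assume DEF: "D \<in> derivations \<kappa> A a" "E \<in> derivations \<kappa> A a" "F \<in> derivations \<kappa> A a"
    show "(\<lambda>x\<in>carrier A. (\<lambda>x\<in>carrier A. D x \<oplus>\<^bsub>A Quot a\<^esub> E x) x \<oplus>\<^bsub>A Quot a\<^esub> F x) =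
        (\<lambda>x\<in>carrier A. D x \<oplus>\<^bsub>A Quot a\<^esub> (\<lambda>x\<in>carrier A. E x \<oplus>\<^bsub>A Quot a\<^esub> F x) x)"
      by (rule restrict_ext) (simp add: B.a_assoc DEF)
  next
    fix D E assume DE: "D \<in> derivations \<kappa> A a" "E \<in> derivations \<kappa> A a"
    show "(\<lambda>x\<in>carrier A. D x \<oplus>\<^bsub>A Quot a\<^esub> E x) = (\<lambda>x\<in>carrier A. E x \<oplus>\<^bsub>A Quot a\<^esub> D x)"
      by (rule restrict_ext) (simp add: B.a_comm DE)
  next
    fix D assume D: "D \<in> derivations \<kappa> A a"
    show "(\<lambda>x\<in>carrier A. (\<lambda>x\<in>carrier A. \<zero>\<^bsub>A Quot a\<^esub>) x \<oplus>\<^bsub>A Quot a\<^esub> D x) = D"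
      by (rule ext[OF cadd[OF c0 D] D]) (simp add: D)
    let ?m = "\<ominus>\<^bsub>A Quot a\<^esub> \<one>\<^bsub>A Quot a\<^esub>"
    have "(\<lambda>x\<in>carrier A. (\<lambda>x\<in>carrier A. ?m \<otimes>\<^bsub>A Quot a\<^esub> D x) x \<oplus>\<^bsub>A Quot a\<^esub> D x) =
        (\<lambda>x\<in>carrier A. \<zero>\<^bsub>A Quot a\<^esub>)"
      by (rule restrict_ext) (simp add: D B.l_minus B.l_neg)
    then show "\<exists>E\<in>derivations \<kappa> A a.
        (\<lambda>x\<in>carrier A. E x \<oplus>\<^bsub>A Quot a\<^esub> D x) = (\<lambda>x\<in>carrier A. \<zero>\<^bsub>A Quot a\<^esub>)"
      using csm[OF D, of ?m] by (intro bexI) auto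
  qed (rule cadd c0; assumption?)+
  then have "module (A Quot a) M"
  proof (rule moduleI[OF B.is_cring], unfold M)
    fix b c D assume b: "b \<in> carrier (A Quot a)" "c \<in> carrier (A Quot a)"
      and D: "D \<in> derivations \<kappa> A a"
    show "(\<lambda>x\<in>carrier A. (b \<oplus>\<^bsub>A Quot a\<^esub> c) \<otimes>\<^bsub>A Quot a\<^esub> D x) =
        (\<lambda>x\<in>carrier A. (\<lambda>x\<in>carrier A. b \<otimes>\<^bsub>A Quot a\<^esub> D x) x \<oplus>\<^bsub>A Quot a\<^esub>
                       (\<lambda>x\<in>carrier A. c \<otimes>\<^bsub>A Quot a\<^esub> D x) x)"
      by (rule restrict_ext) (simp add: B.l_distr b D)
    show "(\<lambda>x\<in>carrier A. (b \<otimes>\<^bsub>A Quot a\<^esub> c) \<otimes>\<^bsub>A Quot a\<^esub> D x) =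
        (\<lambda>x\<in>carrier A. b \<otimes>\<^bsub>A Quot a\<^esub> (\<lambda>x\<in>carrier A. c \<otimes>\<^bsub>A Quot a\<^esub> D x) x)"
      by (rule restrict_ext) (simp add: B.m_assoc b D)
  next
    fix b D E assume b: "b \<in> carrier (A Quot a)"
      and DE: "D \<in> derivations \<kappa> A a" "E \<in> derivations \<kappa> A a"
    show "(\<lambda>x\<in>carrier A. b \<otimes>\<^bsub>A Quot a\<^esub> (\<lambda>x\<in>carrier A. D x \<oplus>\<^bsub>A Quot a\<^esub> E x) x) =
        (\<lambda>x\<in>carrier A. (\<lambda>x\<in>carrier A. b \<otimes>\<^bsub>A Quot a\<^esub> D x) x \<oplus>\<^bsub>A Quot a\<^esub>
                       (\<lambda>x\<in>carrier A. b \<otimes>\<^bsub>A Quot a\<^esub> E x) x)"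
      by (rule restrict_ext) (simp add: B.r_distr b DE)
  next
    fix D assume D: "D \<in> derivations \<kappa> A a"
    show "(\<lambda>x\<in>carrier A. \<one>\<^bsub>A Quot a\<^esub> \<otimes>\<^bsub>A Quot a\<^esub> D x) = D"
      by (rule ext[OF csm[OF D B.one_closed] D]) (simp add: D)
  qed (rule csm; assumption)
  then show ?thesis by (simp only: M_def)
qed


section \<open>Jacobian data of a presentation\<close>

definition generates :: "nat \<Rightarrow> 'k::field mpoly set \<Rightarrow> nat \<Rightarrow> (nat \<Rightarrow> 'k mpoly) \<Rightarrow> bool" where
  "generates n I m f \<longleftrightarrow>
     f ` {1..m} \<subseteq> carrier (mpoly_ring n) \<and> I = Idl\<^bsub>mpoly_ring n\<^esub> (f ` {1..m})"

definition coord_ring :: "nat \<Rightarrow> 'k::field mpoly set \<Rightarrow> 'k mpoly set ring" where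
  "coord_ring n I = mpoly_ring n Quot I"

definition res_class :: "nat \<Rightarrow> 'k::field mpoly set \<Rightarrow> 'k mpoly \<Rightarrow> 'k mpoly set" where
  "res_class n I p = I +>\<^bsub>mpoly_ring n\<^esub> p"

definition scalar :: "nat \<Rightarrow> 'k::field mpoly set \<Rightarrow> 'k \<Rightarrow> 'k mpoly set" where
  "scalar n I c = res_class n I (mp_const c)"

definition jacobi_matrix ::
  "nat \<Rightarrow> 'k::field mpoly set \<Rightarrow> (nat \<Rightarrow> 'k mpoly) \<Rightarrow> nat \<Rightarrow> nat \<Rightarrow> 'k mpoly set" where
  "jacobi_matrix n I f i j = res_class n I (mp_pderiv j (f i))"

definition jacobi_rank ::
  "nat \<Rightarrow> 'k::field mpoly set \<Rightarrow> nat \<Rightarrow> (nat \<Rightarrow> 'k mpoly) \<Rightarrow> nat" where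
  "jacobi_rank n I m f =
     mat_rank (frac_field (coord_ring n I)) m n
       (\<lambda>i j. fraction (coord_ring n I) (jacobi_matrix n I f i j) \<one>\<^bsub>coord_ring n I\<^esub>)"

definition jacobi_minor ::
  "nat \<Rightarrow> 'k::field mpoly set \<Rightarrow> (nat \<Rightarrow> 'k mpoly) \<Rightarrow> nat \<Rightarrow> (nat \<Rightarrow> nat) \<Rightarrow> (nat \<Rightarrow> nat)
     \<Rightarrow> 'k mpoly set" where
  "jacobi_minor n I f k i j =
     ring_det (coord_ring n I) k (\<lambda>u v. jacobi_matrix n I f (i u) (j v))"

definition jacobian_ideal ::
  "nat \<Rightarrow> 'k::field mpoly set \<Rightarrow> nat \<Rightarrow> (nat \<Rightarrow> 'k mpoly) \<Rightarrow> nat \<Rightarrow> 'k mpoly set set" where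
  "jacobian_ideal n I m f k =
     (if k \<le> jacobi_rank n I m f
      then Idl\<^bsub>coord_ring n I\<^esub>
             {jacobi_minor n I f k i j | i j. i \<in> increasing_tuples k m \<and> j \<in> increasing_tuples k n}
      else {\<zero>\<^bsub>coord_ring n I\<^esub>})"

text \<open>The derivation given by the formal determinant with rows \<open>i\<^sub>1,\<dots>,i\<^sub>s\<close> of the Jacobi matrix
  and last row the partial derivatives, all in the columns \<open>j\<^sub>1,\<dots>,j\<^sub>s\<^sub>+\<^sub>1\<close>, expanded along
  its last row and reduced modulo the next Jacobian ideal.  It is evaluated on a residue
  class by means of an arbitrary representative \<open>p\<close>.  The column selection
  \<open>\<lambda>v. j (if v < k then v else v + 1)\<close> omits \<open>j\<^sub>k\<close>.\<close>

definition minor_derivation ::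
  "nat \<Rightarrow> 'k::field mpoly set \<Rightarrow> nat \<Rightarrow> (nat \<Rightarrow> 'k mpoly) \<Rightarrow> nat \<Rightarrow> (nat \<Rightarrow> nat) \<Rightarrow> (nat \<Rightarrow> nat)
     \<Rightarrow> 'k mpoly set \<Rightarrow> 'k mpoly set set" where
  "minor_derivation n I m f s i j =
     (\<lambda>U\<in>carrier (coord_ring n I).
        let p = (SOME p. p \<in> U) in
          jacobian_ideal n I m f (s + 1) +>\<^bsub>coord_ring n I\<^esub>
            (\<Oplus>\<^bsub>coord_ring n I\<^esub>k\<in>{1..s + 1}.
               [((- 1) ^ (s + 1 + k) :: int)] \<cdot>\<^bsub>coord_ring n I\<^esub>
                 (jacobi_minor n I f s i (\<lambda>v. j (if v < k then v else v + 1))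
                  \<otimes>\<^bsub>coord_ring n I\<^esub> res_class n I (mp_pderiv (j k) p))))"

definition der_s ::
  "nat \<Rightarrow> 'k::field mpoly set \<Rightarrow> nat \<Rightarrow> (nat \<Rightarrow> 'k mpoly) \<Rightarrow> nat
     \<Rightarrow> ('k mpoly set \<Rightarrow> 'k mpoly set set) set" where
  "der_s n I m f s =
     gen_submodule
       (coord_ring n I Quot jacobian_ideal n I m f (s + 1))
       (der_module (scalar n I) (coord_ring n I) (jacobian_ideal n I m f (s + 1)))
       {minor_derivation n I m f s i j | i j.
          i \<in> increasing_tuples s m \<and> j \<in> increasing_tuples (s + 1) n}"

definition alg_iso ::
  "nat \<Rightarrow> 'k::field mpoly set \<Rightarrow> nat \<Rightarrow> 'k mpoly set \<Rightarrow> ('k mpoly set \<Rightarrow> 'k mpoly set) set" where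
  "alg_iso n I n' I' =
     {\<sigma> \<in> ring_iso (coord_ring n I) (coord_ring n' I'). \<forall>c. \<sigma> (scalar n I c) = scalar n' I' c}"

end

(*
  Let R be the submodule of the free module on dx_1,...,dx_n over A spanned by the differentials of
  the elements of I; it is also spanned by the rows of the Jacobi matrix of any generating set.  By
  multilinearity and Laplace expansion, a_k is the ideal of the k-minors of arbitrary vectors of R,
  and der_K(A)_s is spanned by the functionals v |-> det(r_1,...,r_s,v; columns j) with all r_i in R,
  so neither involves generators of I.  Adjoining to x_1,...,x_n one further generator of A adds one
  column and one relation; a Laplace expansion along the new column shows that this shifts k and s
  by one and changes neither the ideals nor the functionals.  Two presentations are compared by
  passing from each to the union of the two systems of generators, where the chain rule
  identifies the relations.  Since a_k is non-zero exactly for k at most the rank, n - r = n' - r',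
  which is why s' = s + r' - r.
*)
theory Submission
  imports Defs "Jordan_Normal_Form.Determinant"
begin

section \<open>Determinants of matrices given as functions\<close>

text \<open>The definitions use rings given by carriers, and \<open>coord_ring n I\<close> varies
  with the presentation. The linear algebra is therefore done on polynomial representatives, in a
  type that is a commutative ring, and the relation module is replaced by its preimage, which
  contains every vector that vanishes modulo \<open>I\<close> in the coordinates
  \<open>{1..n}\<close>.

  Ideals and derivations are treated by one argument, with \<open>k\<close> rows from the relation
  module and \<open>l\<close> free rows: \<open>l = 0\<close> gives the ideals and
  \<open>l = 1\<close> the derivations.

  The obstacle is that functionals for the old and for the new generators have no common arguments.
  Each agrees with a functional for the union only on vectors supported on the old, respectively the
  new, columns. For \<open>l = 0\<close> there is nothing to compare. For \<open>l = 1\<close> the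
  gradients of one element in the old and in the new variables differ by a relation of the union,
  and a functional applied to a relation is a combination of minors of the next size. This is why
  values are taken modulo the next Jacobian ideal. The same remark makes the derivations independent
  of polynomial representatives.\<close>

definition fun_det :: "nat \<Rightarrow> (nat \<Rightarrow> nat \<Rightarrow> 'a::comm_ring_1) \<Rightarrow> 'a" where
  "fun_det k M = det (mat k k (\<lambda>(u, v). M u v))"

lemma fun_det_cong:
  assumes "\<And>u v. u < k \<Longrightarrow> v < k \<Longrightarrow> M u v = N u v"
  shows "fun_det k M = fun_det k N"
  unfolding fun_det_def by (intro arg_cong[of _ _ det] cong_mat) (use assms in auto)

lemma fun_det_0 [simp]: "fun_det 0 M = 1"
  by (simp add: fun_det_def)

lemma fun_det_Leibniz:
  "fun_det k M = (\<Sum>p | p permutes {0..<k}. of_int (sign p) * (\<Prod>u=0..<k. M u (p u)))"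
proof -
  have "(\<Prod>u=0..<k. mat k k (\<lambda>(u, v). M u v) $$ (u, p u)) = (\<Prod>u=0..<k. M u (p u))"
    if "p permutes {0..<k}" for p
    using permutes_in_image[OF that] by (intro prod.cong) auto
  then show ?thesis
    unfolding fun_det_def det_def'[OF mat_carrier] by (intro sum.cong) auto
qed

lemma fun_det_laplace_row:
  assumes "u < Suc k"
  shows "fun_det (Suc k) M =
    (\<Sum>v<Suc k. M u v * ((-1) ^ (u + v) *
        fun_det k (\<lambda>a b. M (insert_index u a) (insert_index v b))))"
proof -
  have "mat_delete (mat (Suc k) (Suc k) (\<lambda>(u, v). M u v)) u v =
      mat k k (\<lambda>(a, b). M (insert_index u a) (insert_index v b))" if "v < Suc k" for v
    unfolding mat_delete_def insert_index_def by (intro eq_matI) (use assms that in auto)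
  then show ?thesis
    unfolding fun_det_def
    by (subst laplace_expansion_row[OF mat_carrier assms]) (use assms in \<open>auto simp: cofactor_def\<close>)
qed

lemma fun_det_laplace_col:
  assumes "v < Suc k"
  shows "fun_det (Suc k) M =
    (\<Sum>u<Suc k. M u v * ((-1) ^ (u + v) *
        fun_det k (\<lambda>a b. M (insert_index u a) (insert_index v b))))"
proof -
  have "mat_delete (mat (Suc k) (Suc k) (\<lambda>(u, v). M u v)) u v =
      mat k k (\<lambda>(a, b). M (insert_index u a) (insert_index v b))" if "u < Suc k" for u
    unfolding mat_delete_def insert_index_def by (intro eq_matI) (use assms that in auto)
  then show ?thesis
    unfolding fun_det_def
    by (subst laplace_expansion_column[OF mat_carrier assms]) (use assms in \<open>auto simp: cofactor_def\<close>)
qed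

lemma fun_det_zero_col:
  assumes "v < k" "\<And>u. u < k \<Longrightarrow> M u v = 0"
  shows "fun_det k M = 0"
proof (cases k)
  case (Suc k')
  then show ?thesis using assms by (simp add: fun_det_laplace_col[of v k'] del: sum.lessThan_Suc)
qed (use assms in simp)

lemma fun_det_identical_rows:
  assumes "u \<noteq> u'" "u < k" "u' < k" "\<And>v. v < k \<Longrightarrow> M u v = M u' v"
  shows "fun_det k M = 0"
  unfolding fun_det_def
  by (rule det_identical_rows[OF mat_carrier assms(1-3)]) (use assms in \<open>auto intro: eq_vecI\<close>)

lemma fun_det_identical_cols:
  assumes "v \<noteq> v'" "v < k" "v' < k" "\<And>u. u < k \<Longrightarrow> M u v = M u v'"
  shows "fun_det k M = 0"
  unfolding fun_det_def
  by (rule det_identical_columns[OF mat_carrier assms(1-3)]) (use assms in \<open>auto intro: eq_vecI\<close>)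

lemma fun_det_transpose: "fun_det k (\<lambda>u v. M v u) = fun_det k M"
proof -
  have "mat k k (\<lambda>(u, v). M v u) = (mat k k (\<lambda>(u, v). M u v))\<^sup>T" by (intro eq_matI) auto
  then show ?thesis unfolding fun_det_def using det_transpose[OF mat_carrier] by metis
qed

lemma fun_det_permute_cols:
  assumes "p permutes {0..<k}"
  shows "fun_det k (\<lambda>u v. M u (p v)) = of_int (sign p) * fun_det k M"
proof -
  have "fun_det k (\<lambda>u v. M u (p v)) = fun_det k (\<lambda>u v. M v (p u))" by (rule fun_det_transpose[symmetric])
  also have "\<dots> = det (mat k k (\<lambda>(i, j). mat k k (\<lambda>(u, v). M v u) $$ (p i, j)))"
    unfolding fun_det_def
    by (intro arg_cong[of _ _ det] eq_matI) (use permutes_in_image[OF assms] in auto)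
  also have "\<dots> = of_int (sign p) * fun_det k (\<lambda>u v. M v u)"
    unfolding fun_det_def by (rule det_permute_rows[OF mat_carrier assms])
  also have "fun_det k (\<lambda>u v. M v u) = fun_det k M" by (rule fun_det_transpose)
  finally show ?thesis .
qed

lemma fun_det_row_linear:
  assumes "u < k"
  shows "fun_det k (M(u := \<lambda>v. c * x v + y v)) = c * fun_det k (M(u := x)) + fun_det k (M(u := y))"
proof -
  obtain k' where k: "k = Suc k'" using assms by (cases k) auto
  have eq: "fun_det k' (\<lambda>a b. (M(u := z)) (insert_index u a) (insert_index v b)) =
      fun_det k' (\<lambda>a b. M (insert_index u a) (insert_index v b))" for z v
    by (intro fun_det_cong) simp
  show ?thesis
    unfolding k using assms[unfolded k]
    by (simp add: fun_det_laplace_row[of u] eq sum_distrib_left algebra_simps sum.distrib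
        del: sum.lessThan_Suc fun_upd_apply) (simp add: sum.distrib sum_distrib_left algebra_simps)
qed

text \<open>Cramer's rule: multiply the vector \<open>M x\<close> by the adjugate. If all entries of
  \<open>M x\<close> vanish under a homomorphism, then so does \<open>det M\<close> times each
  coordinate of \<open>x\<close>, which in a domain kills the determinant as soon as one coordinate
  survives.\<close>

lemma fun_det_kernel:
  assumes "v < k"
  shows "fun_det k M * x v = (\<Sum>u<k. (\<Sum>w<k. M u w * x w) * adj_mat (mat k k (\<lambda>(u, v). M u v)) $$ (v, u))"
proof -
  define A where "A = mat k k (\<lambda>(u, v). M u v)"
  have A: "A \<in> carrier_mat k k" by (simp add: A_def)
  have adj: "adj_mat A \<in> carrier_mat k k" by (rule adj_mat(1)[OF A])
  have "(\<Sum>u<k. adj_mat A $$ (v, u) * M u w) = (if v = w then det A else 0)" if "w < k" for w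
  proof -
    have "(\<Sum>u<k. adj_mat A $$ (v, u) * M u w) = (adj_mat A * A) $$ (v, w)"
      using A adj assms that
      by (auto simp: scalar_prod_def A_def lessThan_atLeast0 intro!: sum.cong)
    then show ?thesis using adj_mat(3)[OF A] A assms that by simp
  qed
  then have "(\<Sum>w<k. (\<Sum>u<k. adj_mat A $$ (v, u) * M u w) * x w) =
      (\<Sum>w<k. (if v = w then det A else 0) * x w)"
    by (intro sum.cong) auto
  also have "\<dots> = det A * x v" using assms by (simp add: if_distrib[of "\<lambda>t. t * _"] sum.delta cong: if_cong)
  finally show ?thesis
    by (simp add: sum_distrib_right sum_distrib_left mult_ac fun_det_def flip: A_def)
      (subst sum.swap, simp add: mult_ac)
qed

section \<open>Determinantal functionals\<close>

text \<open>Submodules of a module of functions. The notion serves both for sets of vectors and for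
  sets of functionals: a property of all elements of a span is proved by collecting the functions
  that have it into a set \<open>Q\<close> and checking \<open>vclosed Q\<close>.\<close>

definition vclosed :: "('c \<Rightarrow> 'a::comm_ring_1) set \<Rightarrow> bool" where
  "vclosed R \<longleftrightarrow> (\<lambda>_. 0) \<in> R \<and> (\<forall>x\<in>R. \<forall>y\<in>R. \<forall>c. (\<lambda>i. c * x i + y i) \<in> R)"

lemma vclosed_0: "vclosed R \<Longrightarrow> (\<lambda>_. 0) \<in> R"
  by (simp add: vclosed_def)

lemma vclosed_lin: "vclosed R \<Longrightarrow> x \<in> R \<Longrightarrow> y \<in> R \<Longrightarrow> (\<lambda>i. c * x i + y i) \<in> R"
  by (simp add: vclosed_def)

lemma vclosed_add: "vclosed R \<Longrightarrow> x \<in> R \<Longrightarrow> y \<in> R \<Longrightarrow> (\<lambda>i. x i + y i) \<in> R"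
  using vclosed_lin[of R x y 1] by simp

lemma vclosed_smult: "vclosed R \<Longrightarrow> x \<in> R \<Longrightarrow> (\<lambda>i. c * x i) \<in> R"
  using vclosed_lin[of R x "\<lambda>_. 0" c] vclosed_0[of R] by simp

lemma vclosed_sum:
  "vclosed R \<Longrightarrow> (\<And>e. e \<in> E \<Longrightarrow> x e \<in> R) \<Longrightarrow> (\<lambda>i. \<Sum>e\<in>E. c e * x e i) \<in> R"
  by (induction E rule: infinite_finite_induct) (simp_all add: vclosed_0 vclosed_lin)

inductive_set vspan :: "('c \<Rightarrow> 'a::comm_ring_1) set \<Rightarrow> ('c \<Rightarrow> 'a) set" for G where
  zero: "(\<lambda>_. 0) \<in> vspan G"
| lin: "x \<in> G \<Longrightarrow> y \<in> vspan G \<Longrightarrow> (\<lambda>i. c * x i + y i) \<in> vspan G"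

lemma vspan_base: "x \<in> G \<Longrightarrow> x \<in> vspan G"
  using vspan.lin[OF _ vspan.zero, of x G 1] by simp

lemma vclosed_vspan: "vclosed (vspan G)"
proof -
  have "(\<lambda>i. c * x i + y i) \<in> vspan G" if "x \<in> vspan G" "y \<in> vspan G" for x y c
    using that
  proof induction
    case (lin x z d)
    have "(\<lambda>i. (c * d) * x i + (c * z i + y i)) \<in> vspan G"
      by (intro vspan.lin lin.IH lin.hyps lin.prems)
    then show ?case by (simp add: algebra_simps)
  qed simp
  then show ?thesis by (auto simp: vclosed_def vspan.zero)
qed

lemma vspan_subset: "vclosed R \<Longrightarrow> G \<subseteq> R \<Longrightarrow> vspan G \<subseteq> R"
proof
  fix x assume "vclosed R" "G \<subseteq> R" "x \<in> vspan G"
  from this(3,1,2) show "x \<in> R" by induction (auto intro: vclosed_0 vclosed_lin)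
qed

text \<open>The rows \<open>r\<close> and the columns \<open>j\<close> are fixed and the last
  \<open>l\<close> rows are the argument. In the case \<open>l = 1\<close> the argument is always
  written as a constant family \<open>\<lambda>_. x\<close>.\<close>

definition det_functional ::
  "nat \<Rightarrow> nat \<Rightarrow> (nat \<Rightarrow> 'c \<Rightarrow> 'a::comm_ring_1) \<Rightarrow> (nat \<Rightarrow> 'c) \<Rightarrow> (nat \<Rightarrow> 'c \<Rightarrow> 'a) \<Rightarrow> 'a" where
  "det_functional k l r j vs = fun_det (k + l) (\<lambda>u v. (if u < k then r u else vs (u - k)) (j v))"

text \<open>For \<open>l = 0\<close> the elements are constant functions, and their values form the ideal
  generated by the \<open>k\<close>-minors of \<open>R\<close>; for \<open>l = 1\<close> they are the functionals on the free module
  that induce the elements of \<open>der\<^sub>K(A)\<^sub>k\<close>.\<close>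

definition det_span ::
  "nat \<Rightarrow> nat \<Rightarrow> 'c set \<Rightarrow> ('c \<Rightarrow> 'a::comm_ring_1) set \<Rightarrow> ((nat \<Rightarrow> 'c \<Rightarrow> 'a) \<Rightarrow> 'a) set" where
  "det_span k l C R =
     vspan {det_functional k l r j | r j. (\<forall>u<k. r u \<in> R) \<and> (\<forall>v<k + l. j v \<in> C)}"

lemma det_functional_in_span:
  assumes "\<And>u. u < k \<Longrightarrow> r u \<in> R" "\<And>v. v < k + l \<Longrightarrow> j v \<in> C"
  shows "det_functional k l r j \<in> det_span k l C R"
  unfolding det_span_def by (rule vspan_base) (use assms in blast)

lemma vclosed_det_span: "vclosed (det_span k l C R)"
  unfolding det_span_def by (rule vclosed_vspan)

lemma det_functional_cong:
  assumes "\<And>u v. u < k \<Longrightarrow> v < k + l \<Longrightarrow> r u (j v) = r' u (j' v)"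
    "\<And>u v. u < l \<Longrightarrow> v < k + l \<Longrightarrow> vs u (j v) = vs' u (j' v)"
  shows "det_functional k l r j vs = det_functional k l r' j' vs'"
  unfolding det_functional_def by (intro fun_det_cong) (use assms in auto)

lemma det_functional_row_linear:
  assumes "t < k"
  shows "det_functional k l (r(t := \<lambda>i. c * x i + y i)) j vs =
    c * det_functional k l (r(t := x)) j vs + det_functional k l (r(t := y)) j vs"
proof -
  let ?M = "\<lambda>u v. (if u < k then r u else vs (u - k)) (j v)"
  have eq: "det_functional k l (r(t := z)) j vs = fun_det (k + l) (?M(t := \<lambda>v. z (j v)))" for z
    unfolding det_functional_def using assms by (intro fun_det_cong) auto
  show ?thesis unfolding eq using assms by (intro fun_det_row_linear) simp
qed

text \<open>Multilinearity in the fixed rows, for a target \<open>Q\<close> that is only known to be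
  a submodule.\<close>

lemma det_functional_vspan_rows:
  assumes Q: "vclosed Q"
    and gen: "\<And>r j. (\<And>u. u < k \<Longrightarrow> r u \<in> G) \<Longrightarrow> (\<And>v. v < k + l \<Longrightarrow> j v \<in> C)
        \<Longrightarrow> det_functional k l r j \<in> Q"
    and r: "\<And>u. u < k \<Longrightarrow> r u \<in> vspan G" and j: "\<And>v. v < k + l \<Longrightarrow> j v \<in> C"
  shows "det_functional k l r j \<in> Q"
proof -
  \<comment> \<open>The first \<open>t\<close> rows are arbitrary in the span and the remaining ones
    are still generators. Induction on \<open>t\<close> frees one row at a time, with an inner
    induction over the span for the row that is freed.\<close>
  have "det_functional k l r j \<in> Q"
    if "t \<le> k" "\<And>u. u < t \<Longrightarrow> r u \<in> vspan G" "\<And>u. t \<le> u \<Longrightarrow> u < k \<Longrightarrow> r u \<in> G" for t r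
    using that
  proof (induction t arbitrary: r)
    case 0
    then show ?case using gen j by auto
  next
    case (Suc t)
    have *: "det_functional k l (r(t := x)) j \<in> Q" if "x \<in> vspan G" for x
      using that
    proof induction
      case zero
      have "det_functional k l (r(t := \<lambda>_. 0)) j = (\<lambda>_. 0)"
      proof
        fix vs
        show "det_functional k l (r(t := \<lambda>_. 0)) j vs = 0"
          using det_functional_row_linear[of t k l r 1 "\<lambda>_. 0" "\<lambda>_. 0" j vs] Suc.prems(1) by simp
      qed
      then show ?case using Q by (simp add: vclosed_0 del: fun_upd_apply)
    next
      case (lin x y c)
      have "det_functional k l (r(t := x)) j \<in> Q"
        by (rule Suc.IH) (use Suc.prems lin.hyps in auto)
      then have "(\<lambda>vs. c * det_functional k l (r(t := x)) j vs + det_functional k l (r(t := y)) j vs) \<in> Q"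
        by (intro vclosed_lin[OF Q] lin.IH)
      then show ?case
        using Suc.prems(1) by (simp add: det_functional_row_linear del: fun_upd_apply)
    qed
    show ?case using *[of "r t"] Suc.prems by simp
  qed
  from this[of k r] show ?thesis using r by simp
qed

text \<open>Serves two purposes. With \<open>G\<close> a generating set it reduces statements about
  all relations to generating ones; with \<open>G = R\<close> it is plain induction over the span of
  functionals.\<close>

lemma det_span_subset:
  assumes Q: "vclosed Q" and R: "R \<subseteq> vspan G"
    and gen: "\<And>r j. (\<And>u. u < k \<Longrightarrow> r u \<in> G) \<Longrightarrow> (\<And>v. v < k + l \<Longrightarrow> j v \<in> C)
        \<Longrightarrow> det_functional k l r j \<in> Q"
  shows "det_span k l C R \<subseteq> Q"
  unfolding det_span_def
  by (rule vspan_subset[OF Q]) (use R in \<open>auto intro!: det_functional_vspan_rows[OF Q gen]\<close>)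

lemma det_functional_laplace:
  assumes "t < Suc k"
  shows "det_functional (Suc k) l r j vs =
    (\<Sum>v<Suc (k + l). (r t (j v) * (-1) ^ (t + v)) *
       det_functional k l (\<lambda>u. r (insert_index t u)) (\<lambda>u. j (insert_index v u)) vs)"
proof -
  have "fun_det (k + l) (\<lambda>a b. (if insert_index t a < Suc k then r (insert_index t a)
            else vs (insert_index t a - Suc k)) (j (insert_index v b))) =
      det_functional k l (\<lambda>u. r (insert_index t u)) (\<lambda>u. j (insert_index v u)) vs" for v
    unfolding det_functional_def
    by (intro fun_det_cong) (use assms in \<open>auto simp: insert_index_def\<close>)
  moreover have "t < Suc (k + l)" using assms by simp
  ultimately show ?thesis
    using assms unfolding det_functional_def[of "Suc k"] add_Suc
    by (subst fun_det_laplace_row[of t]) (auto simp: mult.assoc simp del: sum.lessThan_Suc)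
qed

section \<open>Adjoining generators to a system of generators\<close>

text \<open>If the \<open>w c\<close> are the differentials of a system of elements and
  \<open>R\<close> is the relation module of the Kaehler differentials, this is the relation module
  of the system itself.\<close>

definition vrel :: "('c \<Rightarrow> 'd \<Rightarrow> 'a::comm_ring_1) \<Rightarrow> ('d \<Rightarrow> 'a) set \<Rightarrow> 'c set \<Rightarrow> ('c \<Rightarrow> 'a) set" where
  "vrel w R C = {a. (\<lambda>i. \<Sum>c\<in>C. a c * w c i) \<in> R}"

text \<open>The relation \<open>q\<close> has entry 1 in the new column, so every relation is a
  multiple of \<open>q\<close> plus one that vanishes there. A determinant with two rows
  \<open>q\<close> is zero. Otherwise expand along the only row that may be \<open>q\<close>: a
  minor that still contains the column \<open>c\<^sub>0\<close> has a zero column there, as long as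
  the arguments vanish at \<open>c\<^sub>0\<close>, and every other minor involves old columns
  only.\<close>

lemma det_span_extend1:
  fixes w :: "'c \<Rightarrow> 'd \<Rightarrow> 'a::comm_ring_1"
  assumes C: "finite C" "c\<^sub>0 \<notin> C" and R: "vclosed R"
    and h: "(\<lambda>i. w c\<^sub>0 i - (\<Sum>c\<in>C. h c * w c i)) \<in> R"
    and \<phi>: "\<phi> \<in> det_span (Suc k) l (insert c\<^sub>0 C) (vrel w R (insert c\<^sub>0 C))"
  shows "\<exists>\<psi>\<in>det_span k l C (vrel w R C). \<forall>vs. (\<forall>u. vs u c\<^sub>0 = 0) \<longrightarrow> \<phi> vs = \<psi> vs"
proof -
  define q where "q = (\<lambda>c. if c = c\<^sub>0 then 1 else - h c)"
  define G where "G = insert q {r \<in> vrel w R C. r c\<^sub>0 = 0}"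
  define Q where "Q = {\<phi>. \<exists>\<psi>\<in>det_span k l C (vrel w R C). \<forall>vs. (\<forall>u. vs u c\<^sub>0 = 0) \<longrightarrow> \<phi> vs = \<psi> vs}"
  have Q: "vclosed Q"
    unfolding vclosed_def
  proof (intro conjI ballI allI)
    show "(\<lambda>_. 0) \<in> Q"
      unfolding Q_def by (intro CollectI bexI[OF _ vclosed_0[OF vclosed_det_span]]) simp
    fix \<phi>1 \<phi>2 c assume "\<phi>1 \<in> Q" "\<phi>2 \<in> Q"
    then obtain \<psi>1 \<psi>2 where "\<psi>1\<in>det_span k l C (vrel w R C)" "\<psi>2\<in>det_span k l C (vrel w R C)"
      "\<And>vs. (\<forall>u. vs u c\<^sub>0 = 0) \<Longrightarrow> \<phi>1 vs = \<psi>1 vs" "\<And>vs. (\<forall>u. vs u c\<^sub>0 = 0) \<Longrightarrow> \<phi>2 vs = \<psi>2 vs"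
      unfolding Q_def by blast
    then show "(\<lambda>i. c * \<phi>1 i + \<phi>2 i) \<in> Q"
      unfolding Q_def mem_Collect_eq
      by (intro bexI[of _ "\<lambda>i. c * \<psi>1 i + \<psi>2 i"]) (auto intro: vclosed_lin vclosed_det_span)
  qed
  have span: "vrel w R (insert c\<^sub>0 C) \<subseteq> vspan G"
  proof
    fix r assume r: "r \<in> vrel w R (insert c\<^sub>0 C)"
    \<comment> \<open>Eliminating the entry at \<open>c\<^sub>0\<close> by means of \<open>q\<close>
      leaves a relation of the old system.\<close>
    define r0 where "r0 = (\<lambda>c. r c - r c\<^sub>0 * q c)"
    have "(\<lambda>i. (- r c\<^sub>0) * (w c\<^sub>0 i - (\<Sum>c\<in>C. h c * w c i)) + (\<Sum>c\<in>insert c\<^sub>0 C. r c * w c i)) \<in> R"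
      by (rule vclosed_lin[OF R h]) (use r in \<open>simp only: vrel_def mem_Collect_eq\<close>)
    also have "(\<lambda>i. (- r c\<^sub>0) * (w c\<^sub>0 i - (\<Sum>c\<in>C. h c * w c i)) + (\<Sum>c\<in>insert c\<^sub>0 C. r c * w c i)) =
        (\<lambda>i. \<Sum>c\<in>C. r0 c * w c i)"
    proof
      fix i
      have "(\<Sum>c\<in>C. r0 c * w c i) = (\<Sum>c\<in>C. r c * w c i + r c\<^sub>0 * (h c * w c i))"
        using C by (intro sum.cong) (auto simp: r0_def q_def algebra_simps)
      then show "(- r c\<^sub>0) * (w c\<^sub>0 i - (\<Sum>c\<in>C. h c * w c i)) + (\<Sum>c\<in>insert c\<^sub>0 C. r c * w c i) =
          (\<Sum>c\<in>C. r0 c * w c i)"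
        using C by (simp add: sum.distrib sum_negf sum_distrib_left algebra_simps)
    qed
    finally have "r0 \<in> G" by (simp add: G_def vrel_def r0_def q_def)
    then have "(\<lambda>c. r c\<^sub>0 * q c + r0 c) \<in> vspan G"
      by (intro vspan.lin vspan_base) (auto simp: G_def)
    then show "r \<in> vspan G" by (simp add: r0_def)
  qed
  have "det_functional (Suc k) l r j \<in> Q"
    if r: "\<And>u. u < Suc k \<Longrightarrow> r u \<in> G" and j: "\<And>v. v < Suc k + l \<Longrightarrow> j v \<in> insert c\<^sub>0 C" for r j
  proof (cases "\<exists>u u'. u \<noteq> u' \<and> u < Suc k \<and> u' < Suc k \<and> r u = q \<and> r u' = q")
    case True
    then obtain u u' where u: "u \<noteq> u'" "u < Suc k" "u' < Suc k" "r u = q" "r u' = q" by blast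
    have "det_functional (Suc k) l r j = (\<lambda>_. 0)"
      unfolding det_functional_def
      by (intro ext fun_det_identical_rows[of u u']) (use u in auto)
    then show ?thesis by (simp add: vclosed_0[OF Q])
  next
    case False
    \<comment> \<open>If some row is \<open>q\<close>, it is the only one and \<open>t\<close> is
      its index; if none is, any row will do. Either way all rows other than \<open>t\<close> vanish
      at \<open>c\<^sub>0\<close>.\<close>
    obtain t where t: "t < Suc k" "\<And>u. u < Suc k \<Longrightarrow> u \<noteq> t \<Longrightarrow> r u \<noteq> q"
      using False by (metis zero_less_Suc)
    have r': "r (insert_index t u) \<in> vrel w R C \<and> r (insert_index t u) c\<^sub>0 = 0" if "u < k" for u
    proof -
      have "insert_index t u < Suc k" "insert_index t u \<noteq> t" using that by (auto simp: insert_index_def)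
      then show ?thesis using r t(2) unfolding G_def by blast
    qed
    have minor: "det_functional k l (\<lambda>u. r (insert_index t u)) (\<lambda>u. j (insert_index v u)) \<in> Q"
      if "v < Suc (k + l)" for v
    proof (cases "\<exists>b<k + l. j (insert_index v b) = c\<^sub>0")
      case True
      then obtain b where b: "b < k + l" "j (insert_index v b) = c\<^sub>0" by blast
      have "det_functional k l (\<lambda>u. r (insert_index t u)) (\<lambda>u. j (insert_index v u)) vs = 0"
        if "\<forall>u. vs u c\<^sub>0 = 0" for vs
        unfolding det_functional_def by (rule fun_det_zero_col[OF b(1)]) (use b that r' in auto)
      then show ?thesis
        unfolding Q_def using vclosed_0[OF vclosed_det_span] by (intro CollectI bexI) auto
    next
      case False
      have "j (insert_index v b) \<in> C" if "b < k + l" for b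
      proof -
        have "insert_index v b < Suc k + l" using that by (auto simp: insert_index_def)
        then show ?thesis using j False that by blast
      qed
      then show ?thesis
        unfolding Q_def using r' by (intro CollectI bexI[OF _ det_functional_in_span]) auto
    qed
    have "det_functional (Suc k) l r j = (\<lambda>vs. \<Sum>v\<in>{..<Suc (k + l)}. (r t (j v) * (-1) ^ (t + v)) *
       det_functional k l (\<lambda>u. r (insert_index t u)) (\<lambda>u. j (insert_index v u)) vs)"
      by (rule ext) (rule det_functional_laplace[OF t(1)])
    also have "\<dots> \<in> Q" by (intro vclosed_sum[OF Q] minor) simp
    finally show ?thesis .
  qed
  then have "det_span (Suc k) l (insert c\<^sub>0 C) (vrel w R (insert c\<^sub>0 C)) \<subseteq> Q"
    by (intro det_span_subset[OF Q span]) auto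
  then show ?thesis using \<phi> unfolding Q_def by blast
qed

text \<open>Conversely, put \<open>q\<close> on top as a new row and \<open>c\<^sub>0\<close> in
  front as a new column. On arguments vanishing at \<open>c\<^sub>0\<close> the new column is the
  first unit vector, so the determinant does not change, not even by a sign.\<close>

lemma det_span_extend2:
  fixes w :: "'c \<Rightarrow> 'd \<Rightarrow> 'a::comm_ring_1"
  assumes C: "finite C" "c\<^sub>0 \<notin> C"
    and h: "(\<lambda>i. w c\<^sub>0 i - (\<Sum>c\<in>C. h c * w c i)) \<in> R"
    and \<psi>: "\<psi> \<in> det_span k l C (vrel w R C)"
  shows "\<exists>\<phi>\<in>det_span (Suc k) l (insert c\<^sub>0 C) (vrel w R (insert c\<^sub>0 C)).
    \<forall>vs. (\<forall>u. vs u c\<^sub>0 = 0) \<longrightarrow> \<phi> vs = \<psi> vs"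
proof -
  define q where "q = (\<lambda>c. if c = c\<^sub>0 then 1 else - h c)"
  have "(\<Sum>c\<in>insert c\<^sub>0 C. q c * w c i) = w c\<^sub>0 i - (\<Sum>c\<in>C. h c * w c i)" for i
  proof -
    have "(\<Sum>c\<in>C. q c * w c i) = (\<Sum>c\<in>C. - (h c * w c i))"
      using C by (intro sum.cong) (auto simp: q_def)
    then show ?thesis using C by (simp add: q_def sum_negf)
  qed
  then have q: "q \<in> vrel w R (insert c\<^sub>0 C)" using h by (simp add: vrel_def)
  \<comment> \<open>Membership in \<open>vrel w R C\<close> says nothing about the entry at
    \<open>c\<^sub>0\<close>. It must be set to zero before the vector counts as a relation of the
    larger system.\<close>
  have upd: "r(c\<^sub>0 := 0) \<in> vrel w R (insert c\<^sub>0 C)" if "r \<in> vrel w R C" for r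
  proof -
    have "(\<Sum>c\<in>insert c\<^sub>0 C. (r(c\<^sub>0 := 0)) c * w c i) = (\<Sum>c\<in>C. r c * w c i)" for i
      using C by (simp, intro sum.cong) auto
    then show ?thesis using that by (simp only: vrel_def mem_Collect_eq)
  qed
  define Q where "Q = {\<psi>. \<exists>\<phi>\<in>det_span (Suc k) l (insert c\<^sub>0 C) (vrel w R (insert c\<^sub>0 C)).
    \<forall>vs. (\<forall>u. vs u c\<^sub>0 = 0) \<longrightarrow> \<phi> vs = \<psi> vs}"
  have Q: "vclosed Q"
    unfolding vclosed_def
  proof (intro conjI ballI allI)
    show "(\<lambda>_. 0) \<in> Q"
      unfolding Q_def by (intro CollectI bexI[OF _ vclosed_0[OF vclosed_det_span]]) simp
    fix \<phi>1 \<phi>2 c assume "\<phi>1 \<in> Q" "\<phi>2 \<in> Q"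
    then obtain \<psi>1 \<psi>2 where "\<psi>1\<in>det_span (Suc k) l (insert c\<^sub>0 C) (vrel w R (insert c\<^sub>0 C))"
      "\<psi>2\<in>det_span (Suc k) l (insert c\<^sub>0 C) (vrel w R (insert c\<^sub>0 C))"
      "\<And>vs. (\<forall>u. vs u c\<^sub>0 = 0) \<Longrightarrow> \<psi>1 vs = \<phi>1 vs" "\<And>vs. (\<forall>u. vs u c\<^sub>0 = 0) \<Longrightarrow> \<psi>2 vs = \<phi>2 vs"
      unfolding Q_def by blast
    then show "(\<lambda>i. c * \<phi>1 i + \<phi>2 i) \<in> Q"
      unfolding Q_def mem_Collect_eq
      by (intro bexI[of _ "\<lambda>i. c * \<psi>1 i + \<psi>2 i"]) (auto intro: vclosed_lin vclosed_det_span)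
  qed
  have "det_functional k l r j \<in> Q"
    if r: "\<And>u. u < k \<Longrightarrow> r u \<in> vrel w R C" and j: "\<And>v. v < k + l \<Longrightarrow> j v \<in> C" for r j
  proof -
    define r' where "r' = (\<lambda>u. case u of 0 \<Rightarrow> q | Suc u \<Rightarrow> (r u)(c\<^sub>0 := 0))"
    define j' where "j' = (\<lambda>v. case v of 0 \<Rightarrow> c\<^sub>0 | Suc v \<Rightarrow> j v)"
    have "det_functional (Suc k) l r' j' vs = det_functional k l r j vs"
      if vs: "\<forall>u. vs u c\<^sub>0 = 0" for vs
    proof -
      let ?M = "\<lambda>u v. (if u < Suc k then r' u else vs (u - Suc k)) (j' v)"
      have M0: "?M u 0 = (if u = 0 then 1 else 0)" for u
        using vs by (auto simp: r'_def j'_def q_def split: nat.split)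
      have "det_functional (Suc k) l r' j' vs =
          (\<Sum>u<Suc (k + l). (if u = 0 then 1 else 0) * ((-1) ^ (u + 0) *
            fun_det (k + l) (\<lambda>a b. ?M (insert_index u a) (insert_index 0 b))))"
        unfolding det_functional_def add_Suc
        by (subst fun_det_laplace_col[of 0]) (simp_all only: M0 zero_less_Suc)
      also have "\<dots> = fun_det (k + l) (\<lambda>a b. ?M (insert_index 0 a) (insert_index 0 b))"
        by (subst sum.lessThan_Suc_shift) simp
      also have "\<dots> = det_functional k l r j vs"
        unfolding det_functional_def using C j
        by (intro fun_det_cong) (auto simp: insert_index_def r'_def j'_def)
      finally show ?thesis .
    qed
    moreover have "det_functional (Suc k) l r' j' \<in>
        det_span (Suc k) l (insert c\<^sub>0 C) (vrel w R (insert c\<^sub>0 C))"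
      by (intro det_functional_in_span)
        (use r j q upd in \<open>auto simp: r'_def j'_def split: nat.split\<close>)
    ultimately show ?thesis unfolding Q_def by blast
  qed
  then have "det_span k l C (vrel w R C) \<subseteq> Q"
    by (intro det_span_subset[OF Q]) (auto intro: vspan_base)
  then show ?thesis using \<psi> unfolding Q_def by blast
qed

text \<open>One column at a time. Each step demands arguments vanishing in the column just added, so
  in the end they must vanish on all of \<open>E\<close>.\<close>

lemma det_span_extend:
  fixes w :: "'c \<Rightarrow> 'd \<Rightarrow> 'a::comm_ring_1"
  assumes "finite C" "finite E" "C \<inter> E = {}" and R: "vclosed R"
    and h: "\<And>e. e \<in> E \<Longrightarrow> \<exists>h. (\<lambda>i. w e i - (\<Sum>c\<in>C. h c * w c i)) \<in> R"
  shows "\<phi> \<in> det_span (k + card E) l (C \<union> E) (vrel w R (C \<union> E)) \<Longrightarrow>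
      \<exists>\<psi>\<in>det_span k l C (vrel w R C). \<forall>vs. (\<forall>u. \<forall>e\<in>E. vs u e = 0) \<longrightarrow> \<phi> vs = \<psi> vs" (is "_ \<Longrightarrow> ?A \<phi> E")
    and "\<psi> \<in> det_span k l C (vrel w R C) \<Longrightarrow>
      \<exists>\<phi>\<in>det_span (k + card E) l (C \<union> E) (vrel w R (C \<union> E)).
        \<forall>vs. (\<forall>u. \<forall>e\<in>E. vs u e = 0) \<longrightarrow> \<phi> vs = \<psi> vs" (is "_ \<Longrightarrow> ?B \<psi> E")
proof -
  have "(\<forall>\<phi>\<in>det_span (k + card E) l (C \<union> E) (vrel w R (C \<union> E)). ?A \<phi> E) \<and>
      (\<forall>\<psi>\<in>det_span k l C (vrel w R C). ?B \<psi> E)"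
    using assms(2,3) h
  proof (induction E)
    case empty
    then show ?case by auto
  next
    case (insert e E)
    have IH: "\<forall>\<phi>\<in>det_span (k + card E) l (C \<union> E) (vrel w R (C \<union> E)). ?A \<phi> E"
      "\<forall>\<psi>\<in>det_span k l C (vrel w R C). ?B \<psi> E"
      using insert.IH insert.prems by auto
    obtain h where h: "(\<lambda>i. w e i - (\<Sum>c\<in>C. h c * w c i)) \<in> R" using insert.prems by blast
    \<comment> \<open>\<open>w e\<close> is a combination of the vectors indexed by
      \<open>C\<close>, while the step needs one over \<open>C \<union> E\<close>; pad the
      coefficients by zero.\<close>
    define h' where "h' = (\<lambda>c. if c \<in> C then h c else 0)"
    have "(\<Sum>c\<in>C \<union> E. h' c * w c i) = (\<Sum>c\<in>C. h c * w c i)" for i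
      using insert.hyps(1) assms(1) by (intro sum.mono_neutral_cong_right) (auto simp: h'_def)
    with h have h': "(\<lambda>i. w e i - (\<Sum>c\<in>C \<union> E. h' c * w c i)) \<in> R" by simp
    have e: "finite (C \<union> E)" "e \<notin> C \<union> E" using insert.prems insert.hyps assms(1) by auto
    have eq: "C \<union> insert e E = insert e (C \<union> E)" "k + card (insert e E) = Suc (k + card E)"
      using insert.hyps by auto
    show ?case
      unfolding eq
    proof (intro conjI ballI)
      fix \<phi> assume "\<phi> \<in> det_span (Suc (k + card E)) l (insert e (C \<union> E)) (vrel w R (insert e (C \<union> E)))"
      from det_span_extend1[OF e R h' this] obtain \<psi> where
        "\<psi> \<in> det_span (k + card E) l (C \<union> E) (vrel w R (C \<union> E))"
        "\<And>vs. (\<forall>u. vs u e = 0) \<Longrightarrow> \<phi> vs = \<psi> vs" by blast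
      with IH(1) show "?A \<phi> (insert e E)" by (metis insert_iff)
    next
      fix \<psi> assume "\<psi> \<in> det_span k l C (vrel w R C)"
      with IH(2) obtain \<phi> where \<phi>: "\<phi> \<in> det_span (k + card E) l (C \<union> E) (vrel w R (C \<union> E))"
        "\<And>vs. (\<forall>u. \<forall>e\<in>E. vs u e = 0) \<Longrightarrow> \<phi> vs = \<psi> vs" by blast
      from det_span_extend2[OF e h' \<phi>(1)] \<phi>(2)
      show "\<exists>\<phi>\<in>det_span (Suc (k + card E)) l (insert e (C \<union> E)) (vrel w R (insert e (C \<union> E))).
          \<forall>vs. (\<forall>u. \<forall>e\<in>insert e E. vs u e = 0) \<longrightarrow> \<phi> vs = \<psi> vs" by (metis insert_iff)
    qed
  qed
  then show "\<phi> \<in> det_span (k + card E) l (C \<union> E) (vrel w R (C \<union> E)) \<Longrightarrow> ?A \<phi> E"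
    "\<psi> \<in> det_span k l C (vrel w R C) \<Longrightarrow> ?B \<psi> E" by blast+
qed

lemma det_functional_apply:
  "det_functional k 1 r j (\<lambda>_. x) = det_functional (Suc k) 0 (r(k := x)) j vs"
  unfolding det_functional_def by (simp, intro fun_det_cong) auto

text \<open>Substituting a vector of \<open>R\<close> for the free row turns it into one more row
  from \<open>R\<close>. Hence functionals of size \<open>k\<close> map \<open>R\<close> into the
  ideal of minors of size \<open>k + 1\<close>, which is the source of the ideal in the target of
  the derivations.\<close>

lemma det_span_apply:
  assumes "\<phi> \<in> det_span k 1 C R" "x \<in> R"
  shows "(\<lambda>_. \<phi> (\<lambda>_. x)) \<in> det_span (Suc k) 0 C R"
proof -
  have "det_span k 1 C R \<subseteq> {\<phi>. (\<lambda>_. \<phi> (\<lambda>_. x)) \<in> det_span (Suc k) 0 C R}" (is "_ \<subseteq> ?Q")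
  proof (rule det_span_subset[where G = R])
    show "vclosed ?Q"
      unfolding vclosed_def by (auto intro: vclosed_0 vclosed_lin vclosed_det_span)
    show "R \<subseteq> vspan R" by (auto intro: vspan_base)
    fix r j assume r: "\<And>u. u < k \<Longrightarrow> r u \<in> R" and j: "\<And>v. v < k + 1 \<Longrightarrow> j v \<in> C"
    have "(\<lambda>_. det_functional k 1 r j (\<lambda>_. x)) = det_functional (Suc k) 0 (r(k := x)) j"
      using det_functional_apply by blast
    then show "det_functional k 1 r j \<in> ?Q"
      using r j assms(2) by (simp, intro det_functional_in_span) auto
  qed
  then show ?thesis using assms(1) by blast
qed

lemma det_span_add:
  assumes "\<phi> \<in> det_span k 1 C R"
  shows "\<phi> (\<lambda>_ i. c * x i + y i) = c * \<phi> (\<lambda>_. x) + \<phi> (\<lambda>_. y)"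
proof -
  have "det_span k 1 C R \<subseteq> {\<phi>. \<phi> (\<lambda>_ i. c * x i + y i) = c * \<phi> (\<lambda>_. x) + \<phi> (\<lambda>_. y)}" (is "_ \<subseteq> ?Q")
  proof (rule det_span_subset[where G = R])
    show "vclosed ?Q" unfolding vclosed_def by (auto simp: algebra_simps)
    show "R \<subseteq> vspan R" by (auto intro: vspan_base)
    fix r :: "nat \<Rightarrow> 'a \<Rightarrow> 'b" and j
    show "det_functional k 1 r j \<in> ?Q"
      \<comment> \<open>Once the argument has become a fixed row, no free row is left and the
        remaining argument is never read; any value can stand for it.\<close>
      unfolding mem_Collect_eq det_functional_apply[of _ _ _ _ undefined]
      by (intro det_functional_row_linear) simp
  qed
  then show ?thesis using assms by blast
qed

text \<open>For \<open>l = 0\<close> the functionals are constant. They are evaluated at zero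
  because zero vanishes in every column, so the comparison of systems of generators applies to it
  without conditions.\<close>

definition det_values :: "nat \<Rightarrow> 'c set \<Rightarrow> ('c \<Rightarrow> 'a::comm_ring_1) set \<Rightarrow> 'a set" where
  "det_values k C R = (\<lambda>\<phi>. \<phi> (\<lambda>_ _. 0)) ` det_span k 0 C R"

lemma det_values_0: "0 \<in> det_values k C R"
  unfolding det_values_def using vclosed_0[OF vclosed_det_span] by (rule image_eqI[rotated]) simp

lemma det_values_lin:
  assumes "x \<in> det_values k C R" "y \<in> det_values k C R"
  shows "c * x + y \<in> det_values k C R"
proof -
  obtain \<phi> \<psi> where "\<phi> \<in> det_span k 0 C R" "\<psi> \<in> det_span k 0 C R" "x = \<phi> (\<lambda>_ _. 0)" "y = \<psi> (\<lambda>_ _. 0)"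
    using assms by (auto simp: det_values_def)
  then show ?thesis
    unfolding det_values_def
    by (intro image_eqI[where x = "\<lambda>vs. c * \<phi> vs + \<psi> vs"]) (auto intro: vclosed_lin vclosed_det_span)
qed

lemma det_values_apply:
  assumes "\<phi> \<in> det_span k 1 C R" "x \<in> R"
  shows "\<phi> (\<lambda>_. x) \<in> det_values (Suc k) C R"
  unfolding det_values_def using det_span_apply[OF assms] by (rule image_eqI[rotated]) simp

section \<open>Reduction to increasing row and column indices\<close>

lemma permutes_atLeast0_extend: "p permutes {0..<k::nat} \<Longrightarrow> p permutes {0..<k + l}"
  by (rule permutes_subset) auto

lemma det_functional_permute_cols:
  assumes "p permutes {0..<k + l}"
  shows "det_functional k l r (\<lambda>v. j (p v)) vs = of_int (sign p) * det_functional k l r j vs"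
  unfolding det_functional_def
  by (rule fun_det_permute_cols[OF assms, of "\<lambda>u v. (if u < k then r u else vs (u - k)) (j v)"])

lemma det_functional_permute_rows:
  assumes p: "p permutes {0..<k}"
  shows "det_functional k l (\<lambda>u. r (p u)) j vs = of_int (sign p) * det_functional k l r j vs"
proof -
  let ?M = "\<lambda>u v. (if u < k then r u else vs (u - k)) (j v)"
  have pu: "p u < k \<longleftrightarrow> u < k" for u using permutes_in_image[OF p, of u] by simp
  have "det_functional k l (\<lambda>u. r (p u)) j vs = fun_det (k + l) (\<lambda>u v. ?M (p u) v)"
    unfolding det_functional_def
    by (intro fun_det_cong) (use pu permutes_not_in[OF p] in \<open>auto simp: not_less\<close>)
  also have "\<dots> = fun_det (k + l) (\<lambda>u v. ?M (p v) u)" by (rule fun_det_transpose[symmetric])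
  also have "\<dots> = of_int (sign p) * fun_det (k + l) (\<lambda>u v. ?M v u)"
    by (rule fun_det_permute_cols[OF permutes_atLeast0_extend[OF p], where M = "\<lambda>u v. ?M v u"])
  also have "fun_det (k + l) (\<lambda>u v. ?M v u) = det_functional k l r j vs"
    unfolding det_functional_def by (rule fun_det_transpose)
  finally show ?thesis .
qed

text \<open>\<open>p u\<close> is the position of \<open>t u\<close> in the sorted list of values.
  Positions count from 0, while increasing tuples are indexed from 1, hence the
  \<open>Suc\<close>.\<close>

lemma sort_tuple:
  assumes t: "\<And>u. u < k \<Longrightarrow> t u \<in> {1..n}" and inj: "inj_on t {0..<k}"
  obtains t' p where "t' \<in> increasing_tuples k n" "p permutes {0..<k}"
    "\<And>u. u < k \<Longrightarrow> t u = t' (Suc (p u))"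
proof -
  define S where "S = t ` {0..<k}"
  define xs where "xs = sorted_list_of_set S"
  have fin: "finite S" and card: "card S = k" using inj by (simp_all add: S_def card_image)
  have len: "length xs = k" and set: "set xs = S"
    using fin card by (simp_all add: xs_def)
  have sorted: "sorted_wrt (<) xs" by (simp add: xs_def)
  have bij: "bij_betw (\<lambda>u. xs ! u) {0..<k} S"
    using fin len set by (intro bij_betw_nth) (auto simp: xs_def)
  define q where "q = inv_into {0..<k} (\<lambda>u. xs ! u) \<circ> t"
  define p where "p = (\<lambda>u. if u < k then q u else u)"
  have "bij_betw q {0..<k} {0..<k}"
    unfolding q_def
    by (rule bij_betw_trans[OF _ bij_betw_inv_into[OF bij]]) (use inj in \<open>simp add: S_def bij_betw_def\<close>)
  then have "bij_betw p {0..<k} {0..<k}" by (rule bij_betw_cong[THEN iffD1, rotated]) (simp add: p_def)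
  then have perm: "p permutes {0..<k}" by (intro bij_imp_permutes) (auto simp: p_def)
  have "xs ! p u = t u" if "u < k" for u
    using that bij_betw_inv_into_right[OF bij, of "t u"] by (simp add: p_def q_def S_def)
  moreover have "(\<lambda>u. xs ! (u - 1)) \<in> increasing_tuples k n"
  proof -
    have "xs ! (u - 1) \<in> {1..n}" if "u \<in> {1..k}" for u
    proof -
      have "xs ! (u - 1) \<in> S" using that len set by (metis atLeastAtMost_iff diff_less le_trans less_le_trans nth_mem zero_less_one linorder_not_le not_one_le_zero order_less_le_trans)
      then show ?thesis using t by (auto simp: S_def)
    qed
    moreover have "strict_mono_on {1..k} (\<lambda>u. xs ! (u - 1))"
      by (rule strict_mono_onI) (use sorted len in \<open>auto simp: sorted_wrt_iff_nth_less\<close>)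
    ultimately show ?thesis by (auto simp: increasing_tuples_def)
  qed
  ultimately show ?thesis using perm by (intro that[of "\<lambda>u. xs ! (u - 1)" p]) auto
qed

text \<open>A repeated row or column index makes the determinant zero; otherwise sorting both tuples
  costs only a sign. This connects arbitrary selections with the increasing ones that occur in the
  definitions of the minors and of the derivations.\<close>

lemma det_functional_increasing:
  assumes Q: "vclosed Q"
    and inc: "\<And>i j. i \<in> increasing_tuples k m \<Longrightarrow> j \<in> increasing_tuples (k + l) n \<Longrightarrow>
        det_functional k l (\<lambda>u. F (i (Suc u))) (\<lambda>v. j (Suc v)) \<in> Q"
    and i: "\<And>u. u < k \<Longrightarrow> i u \<in> {1..m}" and j: "\<And>v. v < k + l \<Longrightarrow> j v \<in> {1..n}"
  shows "det_functional k l (\<lambda>u. F (i u)) j \<in> Q"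
proof (cases "inj_on i {0..<k} \<and> inj_on j {0..<k + l}")
  case True
  obtain i' p where i': "i' \<in> increasing_tuples k m" "p permutes {0..<k}"
    "\<And>u. u < k \<Longrightarrow> i u = i' (Suc (p u))"
    using sort_tuple[of k i m] i True by metis
  obtain j' q where j': "j' \<in> increasing_tuples (k + l) n" "q permutes {0..<k + l}"
    "\<And>u. u < k + l \<Longrightarrow> j u = j' (Suc (q u))"
    using sort_tuple[of "k + l" j n] j True by metis
  have "det_functional k l (\<lambda>u. F (i u)) j vs =
      of_int (sign p * sign q) * det_functional k l (\<lambda>u. F (i' (Suc u))) (\<lambda>v. j' (Suc v)) vs" for vs
  proof -
    have "det_functional k l (\<lambda>u. F (i u)) j vs =
        det_functional k l (\<lambda>u. F (i' (Suc (p u)))) (\<lambda>v. j' (Suc (q v))) vs"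
      by (intro det_functional_cong) (simp_all add: i' j')
    also have "\<dots> = of_int (sign p) * (of_int (sign q) *
        det_functional k l (\<lambda>u. F (i' (Suc u))) (\<lambda>v. j' (Suc v)) vs)"
      by (simp only: det_functional_permute_rows[OF i'(2), of _ "\<lambda>u. F (i' (Suc u))"]
        det_functional_permute_cols[OF j'(2), of _ "\<lambda>v. j' (Suc v)"])
    finally show ?thesis by (simp add: mult.assoc)
  qed
  then have "det_functional k l (\<lambda>u. F (i u)) j =
      (\<lambda>vs. of_int (sign p * sign q) * det_functional k l (\<lambda>u. F (i' (Suc u))) (\<lambda>v. j' (Suc v)) vs)"
    by blast
  then show ?thesis using vclosed_smult[OF Q inc[OF i'(1) j'(1)]] by simp
next
  case False
  have "det_functional k l (\<lambda>u. F (i u)) j vs = 0" for vs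
  proof (cases "inj_on i {0..<k}")
    case True
    with False obtain v v' where "v \<noteq> v'" "v < k + l" "v' < k + l" "j v = j v'"
      by (auto simp: inj_on_def)
    then show ?thesis unfolding det_functional_def by (intro fun_det_identical_cols[of v v']) auto
  next
    case False
    then obtain u u' where "u \<noteq> u'" "u < k" "u' < k" "i u = i u'" by (auto simp: inj_on_def)
    then show ?thesis unfolding det_functional_def by (intro fun_det_identical_rows[of u u']) auto
  qed
  then have "det_functional k l (\<lambda>u. F (i u)) j = (\<lambda>_. 0)" by blast
  then show ?thesis using vclosed_0[OF Q] by simp
qed

section \<open>Homomorphisms from a ring type onto a carrier ring\<close>

lemma bij_betw_map_permutation:
  assumes f: "bij_betw f A B"
  shows "bij_betw (map_permutation A f) {p. p permutes A} {p. p permutes B}"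
proof (rule bij_betw_byWitness[where f' = "map_permutation B (inv_into A f)"])
  have g: "bij_betw (inv_into A f) B A" by (rule bij_betw_inv_into[OF f])
  show "\<forall>p\<in>{p. p permutes A}. map_permutation B (inv_into A f) (map_permutation A f p) = p"
    using f by (auto intro!: map_permutation_compose_inv simp: bij_betw_inv_into_left)
  show "\<forall>p\<in>{p. p permutes B}. map_permutation A f (map_permutation B (inv_into A f) p) = p"
    using f g by (auto intro!: map_permutation_compose_inv simp: bij_betw_inv_into_right)
  show "map_permutation A f ` {p. p permutes A} \<subseteq> {p. p permutes B}"
    using map_permutation_permutes[OF f] by auto
  show "map_permutation B (inv_into A f) ` {p. p permutes B} \<subseteq> {p. p permutes A}"
    using map_permutation_permutes[OF g] by auto
qed

text \<open>Transfers computations from a ring type to a ring with a carrier. Since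
  \<open>\<pi>\<close> is total, no membership conditions arise on the side of the type.\<close>

locale type_hom = cring A for A :: "('b, 'c) ring_scheme" (structure) +
  fixes \<pi> :: "'a::comm_ring_1 \<Rightarrow> 'b"
  assumes hom_closed [simp]: "\<pi> x \<in> carrier A"
    and hom_plus: "\<pi> (x + y) = \<pi> x \<oplus> \<pi> y"
    and hom_times: "\<pi> (x * y) = \<pi> x \<otimes> \<pi> y"
    and hom_1: "\<pi> 1 = \<one>"
begin

lemma hom_0: "\<pi> 0 = \<zero>"
proof -
  have "\<pi> 0 \<oplus> \<pi> 0 = \<pi> 0" using hom_plus[of 0 0] by simp
  then show ?thesis by simp
qed

lemma hom_neg: "\<pi> (- x) = \<ominus> \<pi> x"
proof -
  have "\<pi> (- x) \<oplus> \<pi> x = \<zero>" using hom_plus[of "- x" x] by (simp add: hom_0)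
  then show ?thesis by (simp add: minus_equality)
qed

lemma hom_diff: "\<pi> (x - y) = \<pi> x \<ominus> \<pi> y"
  using hom_plus[of x "- y"] by (simp add: hom_neg minus_eq)

lemma hom_eq_iff: "\<pi> x = \<pi> y \<longleftrightarrow> \<pi> (x - y) = \<zero>"
proof
  assume "\<pi> (x - y) = \<zero>"
  then show "\<pi> x = \<pi> y" using hom_plus[of "x - y" y] by simp
qed (simp add: hom_diff minus_eq r_neg)

lemma hom_sum_0: "(\<And>x. x \<in> S \<Longrightarrow> \<pi> (g x) = \<zero>) \<Longrightarrow> \<pi> (\<Sum>x\<in>S. g x) = \<zero>"
  by (induction S rule: infinite_finite_induct) (simp_all add: hom_0 hom_plus)

lemma hom_sum: "finite S \<Longrightarrow> \<pi> (\<Sum>x\<in>S. g x) = (\<Oplus>x\<in>S. \<pi> (g x))"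
  by (induction S rule: finite_induct) (simp_all add: hom_0 hom_plus)

lemma hom_prod: "finite S \<Longrightarrow> \<pi> (\<Prod>x\<in>S. g x) = (\<Otimes>x\<in>S. \<pi> (g x))"
  by (induction S rule: finite_induct) (simp_all add: hom_1 hom_times)

lemma hom_of_int: "\<pi> (of_int z * x) = [z] \<cdot> \<pi> x"
proof -
  have nat: "\<pi> (of_nat m * x) = [m] \<cdot> \<pi> x" for m
    by (induction m) (simp_all add: hom_0 hom_plus algebra_simps a_comm)
  show ?thesis
  proof (cases "z \<ge> 0")
    case True
    then show ?thesis using nat[of "nat z"] by (simp add: add_pow_int_ge)
  next
    case False
    then have "of_int z * x = - (of_nat (nat (- z)) * x)" by simp
    then have "\<pi> (of_int z * x) = \<ominus> ([nat (- z)] \<cdot> \<pi> x)" by (simp only: hom_neg nat)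
    then show ?thesis using False by (simp add: add_pow_int_lt)
  qed
qed

text \<open>Both sides are Leibniz sums. The only work is the index shift along \<open>Suc\<close>,
  which carries permutations of \<open>{0..<k}\<close> to permutations of \<open>{1..k}\<close> with
  the same sign.\<close>

lemma hom_det:
  assumes "\<And>u v. u \<in> {1..k} \<Longrightarrow> v \<in> {1..k} \<Longrightarrow> M u v = \<pi> (N u v)"
  shows "ring_det A k M = \<pi> (fun_det k (\<lambda>u v. N (Suc u) (Suc v)))"
proof -
  have bij: "bij_betw Suc {0..<k} {1..k}"
    by (simp add: bij_betw_def image_Suc_atLeastLessThan atLeastLessThanSuc_atLeastAtMost)
  have bijp: "bij_betw (map_permutation {0..<k} Suc) {p. p permutes {0..<k}} {p. p permutes {1..k}}"
    by (rule bij_betw_map_permutation[OF bij])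
  have "(\<Otimes>u\<in>{1..k}. M u (p u)) = \<pi> (\<Prod>u=1..k. N u (p u))" if p: "p permutes {1..k}" for p
  proof -
    have "(\<Otimes>u\<in>{1..k}. M u (p u)) = (\<Otimes>u\<in>{1..k}. \<pi> (N u (p u)))"
      using assms permutes_in_image[OF p] by (intro finprod_cong') auto
    then show ?thesis by (simp add: hom_prod)
  qed
  then have "ring_det A k M =
      (\<Oplus>p\<in>{p. p permutes {1..k}}. \<pi> (of_int (sign p) * (\<Prod>u=1..k. N u (p u))))"
    unfolding ring_det_def by (intro finsum_cong') (auto simp: hom_of_int)
  also have "\<dots> = \<pi> (\<Sum>p | p permutes {1..k}. of_int (sign p) * (\<Prod>u=1..k. N u (p u)))"
    by (simp add: hom_sum finite_permutations)
  also have "(\<Sum>p | p permutes {1..k}. of_int (sign p) * (\<Prod>u=1..k. N u (p u))) =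
      (\<Sum>p | p permutes {0..<k}. of_int (sign p) * (\<Prod>u=0..<k. N (Suc u) (Suc (p u))))"
  proof (subst sum.reindex_bij_betw[OF bijp, symmetric], intro sum.cong refl)
    fix p assume "p \<in> {p. p permutes {0..<k}}"
    then have p: "p permutes {0..<k}" by simp
    have "(\<Prod>u=1..k. N u (map_permutation {0..<k} Suc p u)) =
        (\<Prod>u=0..<k. N (Suc u) (map_permutation {0..<k} Suc p (Suc u)))"
      by (rule prod.reindex_bij_betw[OF bij, symmetric])
    also have "\<dots> = (\<Prod>u=0..<k. N (Suc u) (Suc (p u)))"
      by (intro prod.cong) (auto simp: map_permutation_apply)
    finally show "of_int (sign (map_permutation {0..<k} Suc p)) *
        (\<Prod>u=1..k. N u (map_permutation {0..<k} Suc p u)) =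
        of_int (sign p) * (\<Prod>u=0..<k. N (Suc u) (Suc (p u)))"
      using p by (simp add: sign_map_permutation)
  qed
  also have "\<dots> = fun_det k (\<lambda>u v. N (Suc u) (Suc v))"
    by (simp add: fun_det_Leibniz)
  finally show ?thesis .
qed

end

section \<open>Rank over the field of fractions and vanishing of minors\<close>

locale domain_hom = domain A + type_hom A \<pi>
  for A :: "('b, 'c) ring_scheme" (structure) and \<pi> :: "'a::comm_ring_1 \<Rightarrow> 'b" +
  assumes hom_surj: "x \<in> carrier A \<Longrightarrow> \<exists>y. \<pi> y = x"
begin

abbreviation frac_hom :: "'a \<Rightarrow> ('b \<times> 'b) set" where
  "frac_hom x \<equiv> fraction A (\<pi> x) \<one>"

lemma type_hom_frac: "type_hom (frac_field A) frac_hom"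
proof -
  interpret Q: field "frac_field A" by (rule field_frac_field)
  show ?thesis
    by (intro type_hom.intro type_hom_axioms.intro Q.is_cring)
      (auto simp: frac_closed frac_add frac_mult hom_plus hom_times hom_1 frac_one)
qed

lemma frac_hom_eq_0: "frac_hom x = \<zero>\<^bsub>frac_field A\<^esub> \<longleftrightarrow> \<pi> x = \<zero>"
  by (simp add: frac_zero frac_eq_iff)

lemma common_denominator:
  assumes "finite S" "\<And>j. j \<in> S \<Longrightarrow> c j \<in> carrier (frac_field A)"
  shows "\<exists>b a. \<pi> b \<noteq> \<zero> \<and> (\<forall>j\<in>S. frac_hom b \<otimes>\<^bsub>frac_field A\<^esub> c j = frac_hom (a j))"
  using assms
proof (induction S rule: finite_induct)
  case empty
  have "\<pi> 1 \<noteq> \<zero>" by (simp add: hom_1)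
  then show ?case by blast
next
  case (insert e S)
  interpret Q: field "frac_field A" by (rule field_frac_field)
  interpret F: type_hom "frac_field A" frac_hom by (rule type_hom_frac)
  have "\<exists>b a. \<pi> b \<noteq> \<zero> \<and> (\<forall>j\<in>S. frac_hom b \<otimes>\<^bsub>frac_field A\<^esub> c j = frac_hom (a j))"
    by (rule insert.IH) (rule insert.prems, rule insertI2)
  then obtain b a where ba: "\<pi> b \<noteq> \<zero>" "\<And>j. j \<in> S \<Longrightarrow> frac_hom b \<otimes>\<^bsub>frac_field A\<^esub> c j = frac_hom (a j)"
    by blast
  obtain x y where xy: "x \<in> carrier A" "y \<in> carrier A" "y \<noteq> \<zero>" "c e = fraction A x y"
    by (rule frac_cases[OF insert.prems[OF insertI1]])
  obtain x' y' where xy': "\<pi> x' = x" "\<pi> y' = y" using hom_surj xy by metis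
  have e: "frac_hom y' \<otimes>\<^bsub>frac_field A\<^esub> c e = frac_hom x'"
    using xy xy' by (simp add: frac_mult frac_eq_iff m_comm)
  define a' where "a' = (\<lambda>j. if j = e then b * x' else y' * a j)"
  have "frac_hom (b * y') \<otimes>\<^bsub>frac_field A\<^esub> c j = frac_hom (a' j)" if "j \<in> insert e S" for j
  proof (cases "j = e")
    case True
    then show ?thesis
      using e insert.prems[of e] by (simp add: F.hom_times a'_def Q.m_assoc F.hom_closed del: hom_closed)
  next
    case False
    then have "j \<in> S" using that by simp
    then have "frac_hom y' \<otimes>\<^bsub>frac_field A\<^esub> (frac_hom b \<otimes>\<^bsub>frac_field A\<^esub> c j) = frac_hom (y' * a j)"
      by (simp add: ba(2) F.hom_times)
    then show ?thesis
      using False that insert.prems[of j] F.hom_closed[of b] F.hom_closed[of y']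
      by (simp add: F.hom_times a'_def Q.m_assoc Q.m_lcomm)
  qed
  moreover have "\<pi> (b * y') \<noteq> \<zero>" using ba(1) xy xy' by (simp add: hom_times integral_iff)
  ultimately show ?case by blast
qed

text \<open>Clearing denominators turns a dependency over the field of fractions into one with
  coefficients in the domain, and the non-vanishing of a coefficient is preserved. The coefficients
  are then represented in the ring type, where the determinant lemmas apply.\<close>

lemma lin_indep_columns_iff:
  assumes "finite S"
  shows "lin_indep_columns (frac_field A) m (\<lambda>i j. frac_hom (N i j)) S \<longleftrightarrow>
    (\<forall>a. (\<forall>i\<in>{1..m}. \<pi> (\<Sum>j\<in>S. a j * N i j) = \<zero>) \<longrightarrow> (\<forall>j\<in>S. \<pi> (a j) = \<zero>))"
    (is "?L \<longleftrightarrow> ?R")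
proof -
  interpret Q: field "frac_field A" by (rule field_frac_field)
  interpret F: type_hom "frac_field A" frac_hom by (rule type_hom_frac)
  show ?thesis
  proof
    assume L: ?L
    show ?R
    proof (intro allI impI)
      fix a assume a: "\<forall>i\<in>{1..m}. \<pi> (\<Sum>j\<in>S. a j * N i j) = \<zero>"
      have cl: "(\<lambda>j. frac_hom (a j)) \<in> S \<rightarrow> carrier (frac_field A)"
        using F.hom_closed by blast
      have *: "(\<Oplus>\<^bsub>frac_field A\<^esub>j\<in>S. frac_hom (a j) \<otimes>\<^bsub>frac_field A\<^esub> frac_hom (N i j)) = \<zero>\<^bsub>frac_field A\<^esub>"
        if "i \<in> {1..m}" for i
        using a that F.hom_sum[OF assms, of "\<lambda>j. a j * N i j"] by (simp add: frac_zero F.hom_times)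
      have "\<forall>j\<in>S. frac_hom (a j) = \<zero>\<^bsub>frac_field A\<^esub>"
        by (rule L[unfolded lin_indep_columns_def, THEN bspec, OF cl, THEN mp]) (rule ballI, rule *)
      then show "\<forall>j\<in>S. \<pi> (a j) = \<zero>" by (simp add: frac_hom_eq_0)
    qed
  next
    assume R: ?R
    show ?L
      unfolding lin_indep_columns_def
    proof (intro ballI impI)
      fix c j
      assume c: "c \<in> S \<rightarrow> carrier (frac_field A)" and j: "j \<in> S"
        and z: "\<forall>i\<in>{1..m}. (\<Oplus>\<^bsub>frac_field A\<^esub>j\<in>S. c j \<otimes>\<^bsub>frac_field A\<^esub> frac_hom (N i j)) = \<zero>\<^bsub>frac_field A\<^esub>"
      obtain b a where ba: "\<pi> b \<noteq> \<zero>" "\<And>j. j \<in> S \<Longrightarrow> frac_hom b \<otimes>\<^bsub>frac_field A\<^esub> c j = frac_hom (a j)"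
        using common_denominator[of S c, OF assms funcset_mem[OF c]] by blast
      have "\<pi> (\<Sum>j\<in>S. a j * N i j) = \<zero>" if "i \<in> {1..m}" for i
      proof -
        have "frac_hom (\<Sum>j\<in>S. a j * N i j) =
            (\<Oplus>\<^bsub>frac_field A\<^esub>j\<in>S. frac_hom b \<otimes>\<^bsub>frac_field A\<^esub> (c j \<otimes>\<^bsub>frac_field A\<^esub> frac_hom (N i j)))"
          unfolding F.hom_sum[OF assms] F.hom_times
          using c F.hom_closed by (intro Q.finsum_cong') (auto simp: ba(2)[symmetric] Q.m_assoc Pi_iff)
        also have "\<dots> = frac_hom b \<otimes>\<^bsub>frac_field A\<^esub> (\<Oplus>\<^bsub>frac_field A\<^esub>j\<in>S. c j \<otimes>\<^bsub>frac_field A\<^esub> frac_hom (N i j))"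
          using c F.hom_closed by (intro Q.finsum_rdistr[symmetric] assms) auto
        also have "\<dots> = \<zero>\<^bsub>frac_field A\<^esub>" using z that F.hom_closed by simp
        finally show ?thesis by (simp add: frac_hom_eq_0)
      qed
      then have "\<pi> (a j) = \<zero>" using R j by blast
      then have "frac_hom b \<otimes>\<^bsub>frac_field A\<^esub> c j = \<zero>\<^bsub>frac_field A\<^esub>"
        using ba(2)[OF j] by (simp add: frac_zero)
      then show "c j = \<zero>\<^bsub>frac_field A\<^esub>"
        using Q.integral_iff[OF F.hom_closed funcset_mem[OF c j], of b] ba(1) frac_hom_eq_0[of b]
        by blast
    qed
  qed
qed

lemma finite_rank_set: "finite {card S | S. S \<subseteq> {1..n} \<and> lin_indep_columns Q m M S}"
proof (rule finite_subset)
  show "{card S | S. S \<subseteq> {1..n} \<and> lin_indep_columns Q m M S} \<subseteq> card ` Pow {1..n}" by auto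
qed simp

text \<open>The chosen columns are dependent, even when the dependency is tested against all
  \<open>m\<close> rows. By Cramer's rule the minor times a non-zero coefficient vanishes, and the
  ring is a domain.\<close>

lemma minor_above_rank:
  assumes "mat_rank (frac_field A) m n (\<lambda>i j. frac_hom (N i j)) < k"
    and i: "\<And>u. u < k \<Longrightarrow> i u \<in> {1..m}" and j: "\<And>v. v < k \<Longrightarrow> j v \<in> {1..n}"
  shows "\<pi> (fun_det k (\<lambda>u v. N (i u) (j v))) = \<zero>"
proof (cases "inj_on j {..<k}")
  case False
  then obtain v v' where "v \<noteq> v'" "v < k" "v' < k" "j v = j v'" by (auto simp: inj_on_def)
  then have "fun_det k (\<lambda>u v. N (i u) (j v)) = 0" by (intro fun_det_identical_cols[of v v']) auto
  then show ?thesis by (simp add: hom_0)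
next
  case inj: True
  let ?S = "j ` {..<k}"
  have "\<not> lin_indep_columns (frac_field A) m (\<lambda>i j. frac_hom (N i j)) ?S"
  proof
    assume "lin_indep_columns (frac_field A) m (\<lambda>i j. frac_hom (N i j)) ?S"
    then have "card ?S \<le> mat_rank (frac_field A) m n (\<lambda>i j. frac_hom (N i j))"
      unfolding mat_rank_def using j by (intro Max_ge finite_rank_set) auto
    then show False using assms(1) inj by (simp add: card_image)
  qed
  then obtain a v where a: "\<And>i. i \<in> {1..m} \<Longrightarrow> \<pi> (\<Sum>j\<in>?S. a j * N i j) = \<zero>"
    and v: "v < k" "\<pi> (a (j v)) \<noteq> \<zero>"
    unfolding lin_indep_columns_iff[OF finite_imageI[OF finite_lessThan]] by blast
  have z: "\<pi> (\<Sum>w<k. N (i u) (j w) * a (j w)) = \<zero>" if "u < k" for u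
    using a[OF i[OF that]] by (simp add: sum.reindex[OF inj] mult.commute)
  have "\<pi> (fun_det k (\<lambda>u v. N (i u) (j v)) * a (j v)) = \<zero>"
    unfolding fun_det_kernel[OF v(1), of _ "\<lambda>v. a (j v)"]
    by (rule hom_sum_0) (simp add: hom_times z)
  then show ?thesis using v(2) by (simp add: hom_times integral_iff)
qed

lemma nonzero_minor_rank:
  assumes "r = mat_rank (frac_field A) m n (\<lambda>i j. frac_hom (N i j))"
  shows "\<exists>i j. (\<forall>u<r. i u \<in> {1..m}) \<and> (\<forall>v<r. j v \<in> {1..n}) \<and>
    \<pi> (fun_det r (\<lambda>u v. N (i u) (j v))) \<noteq> \<zero>"
proof -
  have "r \<in> {card S | S. S \<subseteq> {1..n} \<and> lin_indep_columns (frac_field A) m (\<lambda>i j. frac_hom (N i j)) S}"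
    unfolding assms mat_rank_def
  proof (intro Max_in finite_rank_set)
    have "lin_indep_columns (frac_field A) m (\<lambda>i j. frac_hom (N i j)) {}"
      by (simp add: lin_indep_columns_def)
    then show "{card S | S. S \<subseteq> {1..n} \<and> lin_indep_columns (frac_field A) m (\<lambda>i j. frac_hom (N i j)) S} \<noteq> {}"
      by blast
  qed
  then obtain S where S: "S \<subseteq> {1..n}" "card S = r"
    and ind: "lin_indep_columns (frac_field A) m (\<lambda>i j. frac_hom (N i j)) S" by blast
  have fin: "finite S" using S(1) finite_subset by blast
  have "\<exists>i j. (\<forall>u<l. i u \<in> {1..m}) \<and> (\<forall>v<l. j v \<in> S) \<and> \<pi> (fun_det l (\<lambda>u v. N (i u) (j v))) \<noteq> \<zero>"
    if "l \<le> r" for l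
    using that
  proof (induction l)
    case 0
    then show ?case by (simp add: hom_1)
  next
    case (Suc l)
    then obtain i j where ij: "\<And>u. u < l \<Longrightarrow> i u \<in> {1..m}" "\<And>v. v < l \<Longrightarrow> j v \<in> S"
      and nz: "\<pi> (fun_det l (\<lambda>u v. N (i u) (j v))) \<noteq> \<zero>" by auto
    have "card (j ` {..<l}) < card S" using Suc.prems S(2) card_image_le[of "{..<l}" j] by simp
    then obtain c where c: "c \<in> S" "c \<notin> j ` {..<l}"
      by (metis card_mono finite_imageI finite_lessThan linorder_not_le subsetI)
    define j' where "j' = j(l := c)"
    have j': "j' v \<in> S" if "v < Suc l" for v using that ij(2) c(1) by (auto simp: j'_def less_Suc_eq)
    \<comment> \<open>Cofactors of the last row; they do not depend on the row index that is going
      to be placed there.\<close>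
    define cof where "cof = (\<lambda>v. (-1) ^ (l + v) * fun_det l (\<lambda>a b. N (i a) (j' (insert_index v b))))"
    have det: "fun_det (Suc l) (\<lambda>u v. N ((i(l := i\<^sub>0)) u) (j' v)) = (\<Sum>v<Suc l. N i\<^sub>0 (j' v) * cof v)" for i\<^sub>0
    proof -
      have "fun_det l (\<lambda>a b. N ((i(l := i\<^sub>0)) (insert_index l a)) (j' (insert_index v b))) =
          fun_det l (\<lambda>a b. N (i a) (j' (insert_index v b)))" for v
        by (intro fun_det_cong) (auto simp: insert_index_def)
      then show ?thesis
        by (subst fun_det_laplace_row[of l]) (simp_all add: cof_def del: sum.lessThan_Suc)
    qed
    \<comment> \<open>The cofactors are indexed by positions and the coefficients by columns. As the
      induction does not record that \<open>j'\<close> is injective, all positions with the same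
      column are added up.\<close>
    define a where "a = (\<lambda>s. \<Sum>v<Suc l. if j' v = s then cof v else 0)"
    have sums: "(\<Sum>s\<in>S. a s * N i\<^sub>0 s) = fun_det (Suc l) (\<lambda>u v. N ((i(l := i\<^sub>0)) u) (j' v))" for i\<^sub>0
    proof -
      have "(\<Sum>s\<in>S. a s * N i\<^sub>0 s) = (\<Sum>v<Suc l. \<Sum>s\<in>S. if j' v = s then cof v * N i\<^sub>0 s else 0)"
        unfolding a_def sum_distrib_right by (subst sum.swap) (intro sum.cong refl, auto)
      also have "\<dots> = (\<Sum>v<Suc l. N i\<^sub>0 (j' v) * cof v)"
        using fin j' by (intro sum.cong refl) (simp add: sum.delta' mult.commute)
      finally show ?thesis by (simp only: det)
    qed
    have "a c = cof l"
    proof -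
      have "a c = (\<Sum>v<Suc l. if v = l then cof v else 0)"
        unfolding a_def by (intro sum.cong) (use c(2) in \<open>auto simp: j'_def\<close>)
      then show ?thesis by simp
    qed
    also have "cof l = fun_det l (\<lambda>u v. N (i u) (j v))"
      unfolding cof_def by (simp, intro fun_det_cong) (auto simp: j'_def insert_index_def)
    finally have "\<pi> (a c) \<noteq> \<zero>" using nz by simp
    then obtain i\<^sub>0 where i\<^sub>0: "i\<^sub>0 \<in> {1..m}" "\<pi> (\<Sum>s\<in>S. a s * N i\<^sub>0 s) \<noteq> \<zero>"
      using ind c(1) unfolding lin_indep_columns_iff[OF fin] by blast
    then have "\<pi> (fun_det (Suc l) (\<lambda>u v. N ((i(l := i\<^sub>0)) u) (j' v))) \<noteq> \<zero>" by (simp only: sums not_False_eq_True)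
    moreover have "\<forall>u<Suc l. (i(l := i\<^sub>0)) u \<in> {1..m}" using ij(1) i\<^sub>0(1) by (auto simp: less_Suc_eq)
    ultimately show ?case using j' by blast
  qed
  then obtain i j where "\<forall>u<r. i u \<in> {1..m}" "\<forall>v<r. j v \<in> S"
    "\<pi> (fun_det r (\<lambda>u v. N (i u) (j v))) \<noteq> \<zero>"
    by (metis order_refl)
  then show ?thesis using S(1) by (intro exI[of _ i] exI[of _ j]) auto
qed

end

section \<open>Polynomials\<close>

lemma mpoly_sum_single: "p = (\<Sum>e\<in>Poly_Mapping.keys p. Poly_Mapping.single e (Poly_Mapping.lookup p e))"
  by (rule poly_mapping_eqI)
    (auto simp: lookup_sum lookup_single when_def in_keys_iff sum.delta' split: if_splits)

lemma mpoly_induct [case_names single add]: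
  assumes "\<And>e a. P (Poly_Mapping.single e a)" "\<And>p q. P p \<Longrightarrow> P q \<Longrightarrow> P (p + q)"
  shows "P (p :: 'a \<Rightarrow>\<^sub>0 'b::comm_monoid_add)"
proof -
  have "P (\<Sum>e\<in>S. Poly_Mapping.single e (g e))" if "finite S" for S and g :: "'a \<Rightarrow> 'b"
    using that assms(1)[of undefined 0] by (induction S rule: finite_induct) (auto intro: assms)
  then show ?thesis by (subst mpoly_sum_single) simp
qed

section \<open>Partial derivatives and polynomials in the first variables\<close>

lemma mp_pderiv_superset:
  assumes "finite S" "Poly_Mapping.keys p \<subseteq> S"
  shows "mp_pderiv j p = (\<Sum>e\<in>S. Poly_Mapping.single (e - Poly_Mapping.single j 1)
    (of_nat (Poly_Mapping.lookup e j) * Poly_Mapping.lookup p e))"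
  unfolding mp_pderiv_def using assms
  by (intro sum.mono_neutral_left) (auto simp: in_keys_iff)

lemma mp_pderiv_add: "mp_pderiv j (p + q) = mp_pderiv j p + mp_pderiv j q"
proof -
  let ?S = "Poly_Mapping.keys p \<union> Poly_Mapping.keys q"
  have "Poly_Mapping.keys (p + q) \<subseteq> ?S" by (rule Poly_Mapping.keys_add)
  then show ?thesis
    by (simp add: mp_pderiv_superset[of ?S] lookup_add algebra_simps single_add sum.distrib)
qed

lemma mp_pderiv_single:
  "mp_pderiv j (Poly_Mapping.single e a) =
    Poly_Mapping.single (e - Poly_Mapping.single j 1) (of_nat (Poly_Mapping.lookup e j) * a)"
  by (subst mp_pderiv_superset[of "{e}"]) auto

lemma mp_pderiv_0 [simp]: "mp_pderiv j 0 = 0"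
  by (simp add: mp_pderiv_def)

lemma mp_pderiv_minus: "mp_pderiv j (- p) = - mp_pderiv j p"
  using mp_pderiv_add[of j p "- p"] by (simp add: eq_neg_iff_add_eq_0 add.commute)

lemma mp_pderiv_diff: "mp_pderiv j (p - q) = mp_pderiv j p - mp_pderiv j q"
  using mp_pderiv_add[of j p "- q"] by (simp add: mp_pderiv_minus)

lemma mp_pderiv_const [simp]: "mp_pderiv j (mp_const c) = 0"
  by (simp add: mp_const_def mp_pderiv_single)

lemma mp_pderiv_mult: "mp_pderiv j (p * q) = p * mp_pderiv j q + q * mp_pderiv j p"
proof (induction p rule: mpoly_induct)
  case (single e a)
  show ?case
  proof (induction q rule: mpoly_induct)
    case (single f b)
    \<comment> \<open>Subtraction of exponents is truncated, so the two exponents may differ when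
      the variable \<open>j\<close> does not occur in \<open>y\<close>; in that case both
      coefficients are zero.\<close>
    have shift: "Poly_Mapping.single (x + (y - Poly_Mapping.single j 1)) (c * (of_nat (Poly_Mapping.lookup y j) * d)) =
        Poly_Mapping.single (x + y - Poly_Mapping.single j 1) (of_nat (Poly_Mapping.lookup y j) * (c * d))"
      for x y :: "nat \<Rightarrow>\<^sub>0 nat" and c d :: 'a
    proof (cases "Poly_Mapping.lookup y j = 0")
      case False
      then have "x + (y - Poly_Mapping.single j 1) = x + y - Poly_Mapping.single j 1"
        by (intro poly_mapping_eqI) (auto simp: lookup_add lookup_minus lookup_single when_def)
      then show ?thesis by (simp add: mult_ac)
    qed simp
    show ?case
      using shift[of e f a b] shift[of f e b a]
      by (simp add: mult_single mp_pderiv_single lookup_add algebra_simps flip: single_add)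
  qed (simp add: mp_pderiv_add algebra_simps)
qed (simp add: mp_pderiv_add algebra_simps)

definition mp_var :: "nat \<Rightarrow> 'k::comm_ring_1 mpoly" where
  "mp_var j = Poly_Mapping.single (Poly_Mapping.single j 1) 1"

lemma mp_pderiv_var: "mp_pderiv i (mp_var j) = (if i = j then 1 else 0)"
  by (auto simp: mp_var_def mp_pderiv_single lookup_single)

abbreviation mpolys :: "nat \<Rightarrow> 'k::comm_ring_1 mpoly set" where
  "mpolys n \<equiv> carrier (mpoly_ring n)"

lemma mpoly_ring_simps [simp]:
  "p \<oplus>\<^bsub>mpoly_ring n\<^esub> q = p + q" "p \<otimes>\<^bsub>mpoly_ring n\<^esub> q = p * q"
  "\<zero>\<^bsub>mpoly_ring n\<^esub> = 0" "\<one>\<^bsub>mpoly_ring n\<^esub> = 1"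
  by (simp_all add: mpoly_ring_def)

lemma mpolys_iff: "p \<in> mpolys n \<longleftrightarrow> (\<forall>e\<in>Poly_Mapping.keys p. Poly_Mapping.keys e \<subseteq> {1..n})"
  by (simp add: mpoly_ring_def)

lemma mpolys_0 [simp]: "0 \<in> mpolys n" and mpolys_1 [simp]: "1 \<in> mpolys n"
  by (simp_all add: mpolys_iff)

lemma mpolys_add: "p \<in> mpolys n \<Longrightarrow> q \<in> mpolys n \<Longrightarrow> p + q \<in> mpolys n"
  and mpolys_mult: "p \<in> mpolys n \<Longrightarrow> q \<in> mpolys n \<Longrightarrow> p * q \<in> mpolys n"
  using cring.cring_simprules(1,5)[OF cring_mpoly_ring, of p n q] by simp_all

lemma mpolys_minus: "p \<in> mpolys n \<Longrightarrow> - p \<in> mpolys n"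
  by (simp add: mpolys_iff in_keys_iff)

lemma mpolys_diff: "p \<in> mpolys n \<Longrightarrow> q \<in> mpolys n \<Longrightarrow> p - q \<in> mpolys n"
  using mpolys_add[of p n "- q"] mpolys_minus[of q n] by simp

lemma mpoly_ring_uminus: "p \<in> mpolys n \<Longrightarrow> \<ominus>\<^bsub>mpoly_ring n\<^esub> p = - p"
proof -
  interpret cring "mpoly_ring n" by (rule cring_mpoly_ring)
  assume "p \<in> mpolys n"
  then show ?thesis using mpolys_minus[of p n] by (intro minus_equality) simp_all
qed

lemma mpolys_sum: "(\<And>x. x \<in> S \<Longrightarrow> g x \<in> mpolys n) \<Longrightarrow> (\<Sum>x\<in>S. g x) \<in> mpolys n"
  by (induction S rule: infinite_finite_induct) (auto intro: mpolys_add)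

lemma mpolys_single: "Poly_Mapping.keys e \<subseteq> {1..n} \<Longrightarrow> Poly_Mapping.single e a \<in> mpolys n"
  by (simp add: mpolys_iff)

lemma mpolys_const [simp]: "mp_const c \<in> mpolys n"
  by (simp add: mp_const_def mpolys_single)

lemma mpolys_var: "j \<in> {1..n} \<Longrightarrow> mp_var j \<in> mpolys n"
  by (simp add: mp_var_def mpolys_single)

lemma mpolys_pderiv: "p \<in> mpolys n \<Longrightarrow> mp_pderiv j p \<in> mpolys n"
proof -
  assume "p \<in> mpolys n"
  moreover have "Poly_Mapping.keys (e - Poly_Mapping.single j 1) \<subseteq> Poly_Mapping.keys e" for e :: "nat \<Rightarrow>\<^sub>0 nat"
    by (auto simp: in_keys_iff lookup_minus)
  ultimately show ?thesis
    unfolding mp_pderiv_def by (intro mpolys_sum mpolys_single) (fastforce simp: mpolys_iff)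
qed

lemma mp_pderiv_outside:
  assumes "p \<in> mpolys n" "j \<notin> {1..n}"
  shows "mp_pderiv j p = 0"
  unfolding mp_pderiv_def
proof (rule sum.neutral, rule ballI)
  fix e assume "e \<in> Poly_Mapping.keys p"
  then have "Poly_Mapping.lookup e j = 0" using assms unfolding mpolys_iff by (meson in_keys_iff subsetD)
  then show "Poly_Mapping.single (e - Poly_Mapping.single j 1)
      (of_nat (Poly_Mapping.lookup e j) * Poly_Mapping.lookup p e) = 0" by simp
qed

text \<open>Monomials are built by induction on the total degree, splitting off one variable each
  time. This form of induction allows the chain rule to be proved without a substitution
  homomorphism.\<close>

lemma mpolys_induct [consumes 1, case_names const var add mult]:
  assumes p: "p \<in> mpolys n"
    and const: "\<And>c. P (mp_const c)"
    and var: "\<And>j. j \<in> {1..n} \<Longrightarrow> P (mp_var j)"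
    and add: "\<And>p q. p \<in> mpolys n \<Longrightarrow> q \<in> mpolys n \<Longrightarrow> P p \<Longrightarrow> P q \<Longrightarrow> P (p + q)"
    and mult: "\<And>p q. p \<in> mpolys n \<Longrightarrow> q \<in> mpolys n \<Longrightarrow> P p \<Longrightarrow> P q \<Longrightarrow> P (p * q)"
  shows "P (p :: 'k::comm_ring_1 mpoly)"
proof -
  have mono: "P (Poly_Mapping.single e a)" if "Poly_Mapping.keys e \<subseteq> {1..n}" for e a
    using that
  proof (induction "\<Sum>j=1..n. Poly_Mapping.lookup e j" arbitrary: e rule: less_induct)
    case less
    show ?case
    proof (cases "e = 0")
      case True
      then show ?thesis using const[of a] by (simp add: mp_const_def)
    next
      case False
      then obtain j where j: "Poly_Mapping.lookup e j \<noteq> 0" by (metis poly_mapping_eqI lookup_zero)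
      then have jn: "j \<in> {1..n}" using less.prems by (meson in_keys_iff subsetD)
      let ?e = "e - Poly_Mapping.single j 1"
      have e: "e = Poly_Mapping.single j 1 + ?e"
        using j by (intro poly_mapping_eqI) (auto simp: lookup_add lookup_minus lookup_single when_def)
      have le: "Poly_Mapping.lookup ?e i \<le> Poly_Mapping.lookup e i" for i by (simp add: lookup_minus)
      have "Poly_Mapping.lookup ?e j < Poly_Mapping.lookup e j" using j by (simp add: lookup_minus)
      then have "(\<Sum>j=1..n. Poly_Mapping.lookup ?e j) < (\<Sum>j=1..n. Poly_Mapping.lookup e j)"
        using le jn by (intro sum_strict_mono_ex1) auto
      moreover have k: "Poly_Mapping.keys ?e \<subseteq> {1..n}"
        using less.prems by (auto simp: in_keys_iff lookup_minus)
      ultimately have "P (Poly_Mapping.single ?e a)" by (rule less.hyps)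
      then have "P (mp_var j * Poly_Mapping.single ?e a)"
        using jn k by (intro mult var mpolys_var mpolys_single)
      also have "mp_var j * Poly_Mapping.single ?e a = Poly_Mapping.single e a"
        by (subst (2) e) (simp add: mp_var_def mult_single)
      finally show ?thesis .
    qed
  qed
  have "P (\<Sum>e\<in>S. Poly_Mapping.single e (g e)) \<and> (\<Sum>e\<in>S. Poly_Mapping.single e (g e)) \<in> mpolys n"
    if "finite S" "\<And>e. e \<in> S \<Longrightarrow> Poly_Mapping.keys e \<subseteq> {1..n}" for S and g :: "_ \<Rightarrow> 'k"
    using that
  proof (induction S rule: finite_induct)
    case empty
    then show ?case using const[of 0] by (simp add: mp_const_def)
  next
    case (insert x F)
    have IH: "P (\<Sum>e\<in>F. Poly_Mapping.single e (g e))" "(\<Sum>e\<in>F. Poly_Mapping.single e (g e)) \<in> mpolys n"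
      using insert.IH insert.prems by blast+
    have x: "Poly_Mapping.single x (g x) \<in> mpolys n" "P (Poly_Mapping.single x (g x))"
      using insert.prems by (blast intro: mpolys_single mono)+
    show ?case
      unfolding sum.insert[OF insert.hyps] using add[OF x(1) IH(2) x(2) IH(1)] mpolys_add[OF x(1) IH(2)] by blast
  qed
  then have "P (\<Sum>e\<in>Poly_Mapping.keys p. Poly_Mapping.single e (Poly_Mapping.lookup p e))"
    using p by (simp add: mpolys_iff)
  then show ?thesis by (simp flip: mpoly_sum_single)
qed

text \<open>Setting the variables outside \<open>{1..n}\<close> to zero makes the projection onto a coordinate ring
  a total function on the ring type, so that linear algebra over the coordinate ring can be
  done in the type class of commutative rings.\<close>

definition mp_trunc :: "nat \<Rightarrow> 'k::comm_ring_1 mpoly \<Rightarrow> 'k mpoly" where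
  "mp_trunc n p = (\<Sum>e\<in>Poly_Mapping.keys p.
     if Poly_Mapping.keys e \<subseteq> {1..n} then Poly_Mapping.single e (Poly_Mapping.lookup p e) else 0)"

lemma mp_trunc_superset:
  assumes "finite S" "Poly_Mapping.keys p \<subseteq> S"
  shows "mp_trunc n p = (\<Sum>e\<in>S.
     if Poly_Mapping.keys e \<subseteq> {1..n} then Poly_Mapping.single e (Poly_Mapping.lookup p e) else 0)"
  unfolding mp_trunc_def using assms
  by (intro sum.mono_neutral_left) (auto simp: in_keys_iff)

lemma mp_trunc_add: "mp_trunc n (p + q) = mp_trunc n p + mp_trunc n q"
proof -
  let ?S = "Poly_Mapping.keys p \<union> Poly_Mapping.keys q"
  have "Poly_Mapping.keys (p + q) \<subseteq> ?S" by (rule Poly_Mapping.keys_add)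
  then show ?thesis
    by (simp add: mp_trunc_superset[of ?S] lookup_add single_add if_distrib flip: sum.distrib cong: if_cong)
qed

lemma mp_trunc_single:
  "mp_trunc n (Poly_Mapping.single e a) =
    (if Poly_Mapping.keys e \<subseteq> {1..n} then Poly_Mapping.single e a else 0)"
  by (subst mp_trunc_superset[of "{e}"]) auto

lemma mp_trunc_mult: "mp_trunc n (p * q) = mp_trunc n p * mp_trunc n q"
proof (induction p rule: mpoly_induct)
  case (single e a)
  show ?case
  proof (induction q rule: mpoly_induct)
    case (single f b)
    have "Poly_Mapping.keys (e + f) = Poly_Mapping.keys e \<union> Poly_Mapping.keys f"
      by (auto simp: in_keys_iff lookup_add)
    then show ?case by (simp add: mult_single mp_trunc_single)
  qed (simp add: mp_trunc_add algebra_simps)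
qed (simp add: mp_trunc_add algebra_simps)

lemma mp_trunc_mpolys [simp]: "mp_trunc n p \<in> mpolys n"
  unfolding mp_trunc_def by (rule mpolys_sum) (metis mpolys_single mpolys_0)

lemma mp_trunc_id: "p \<in> mpolys n \<Longrightarrow> mp_trunc n p = p"
proof -
  assume "p \<in> mpolys n"
  then have "mp_trunc n p = (\<Sum>e\<in>Poly_Mapping.keys p. Poly_Mapping.single e (Poly_Mapping.lookup p e))"
    unfolding mp_trunc_def by (intro sum.cong) (auto simp: mpolys_iff)
  then show ?thesis by (simp flip: mpoly_sum_single)
qed

section \<open>Coordinate rings\<close>

lemma (in ideal) rcos_eq_iff:
  assumes "x \<in> carrier R" "y \<in> carrier R"
  shows "I +> x = I +> y \<longleftrightarrow> x \<ominus> y \<in> I"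
proof -
  have "x \<in> I +> y \<longleftrightarrow> x \<ominus> y \<in> I" using a_rcos_module[OF assms(2,1)] by (simp add: minus_eq)
  then show ?thesis
    using a_rcos_self[OF assms(1)] a_repr_independence[OF _ assms(2) a_subgroup] by auto
qed

lemma (in type_hom) type_hom_quot:
  assumes "ideal a A"
  shows "type_hom (A Quot a) (\<lambda>x. a +> \<pi> x)"
proof -
  interpret a: ideal a A by fact
  interpret Q: cring "A Quot a" by (rule a.quotient_is_cring) (rule is_cring)
  note h = a.rcos_ring_hom
  show ?thesis
    by (intro type_hom.intro type_hom_axioms.intro Q.is_cring)
      (simp_all add: hom_plus hom_times hom_1 ring_hom_closed[OF h] ring_hom_add[OF h]
        ring_hom_mult[OF h] ring_hom_one[OF h])
qed

lemma (in type_hom) hom_quot_eq_iff: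
  assumes "ideal a A"
  shows "a +> \<pi> x = a +> \<pi> y \<longleftrightarrow> \<pi> (x - y) \<in> a"
  using ideal.rcos_eq_iff[OF assms, of "\<pi> x" "\<pi> y"] by (simp add: hom_diff)

text \<open>Absorption needs surjectivity: a multiplier from the carrier has to be lifted to the
  ring type before closure of \<open>V\<close> can be used.\<close>

lemma (in domain_hom) ideal_image:
  assumes "0 \<in> V" "\<And>c x y. x \<in> V \<Longrightarrow> y \<in> V \<Longrightarrow> c * x + y \<in> V"
  shows "ideal (\<pi> ` V) A"
proof (rule idealI)
  have m: "c * x \<in> V" if "x \<in> V" for c x using assms(2)[OF that assms(1), of c] by simp
  show "subgroup (\<pi> ` V) (add_monoid A)"
  proof (rule add.subgroupI)
    show "\<ominus> x \<in> \<pi> ` V" if "x \<in> \<pi> ` V" for x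
      using that m[of _ "-1"] by (auto simp: hom_neg[symmetric])
    show "x \<oplus> y \<in> \<pi> ` V" if "x \<in> \<pi> ` V" "y \<in> \<pi> ` V" for x y
      using that assms(2)[of _ _ 1] by (auto simp: hom_plus[symmetric])
  qed (use assms(1) in auto)
  show "x \<otimes> z \<in> \<pi> ` V" "z \<otimes> x \<in> \<pi> ` V" if zx: "z \<in> \<pi> ` V" "x \<in> carrier A" for x z
  proof -
    obtain y v where y: "x = \<pi> y" "z = \<pi> v" "v \<in> V" using zx hom_surj[of x] by blast
    show "x \<otimes> z \<in> \<pi> ` V" unfolding y hom_times[symmetric] by (intro imageI m y)
    then show "z \<otimes> x \<in> \<pi> ` V" unfolding y by (simp add: m_comm)
  qed
qed (rule ring_axioms)

lemma type_hom_trunc: "type_hom (mpoly_ring n) (mp_trunc n)"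
  by (intro type_hom.intro type_hom_axioms.intro cring_mpoly_ring)
    (simp_all add: mp_trunc_add mp_trunc_mult mp_trunc_id)

definition proj :: "nat \<Rightarrow> 'k::field mpoly set \<Rightarrow> 'k mpoly \<Rightarrow> 'k mpoly set" where
  "proj n I p = res_class n I (mp_trunc n p)"

definition grad :: "'k::field mpoly \<Rightarrow> nat \<Rightarrow> 'k mpoly" where
  "grad p j = mp_pderiv j p"

text \<open>The vectors whose residues modulo \<open>I\<close> are relations between the differentials
  \<open>dx\<^sub>1,\<dots>,dx\<^sub>n\<close> in the module of Kaehler differentials of \<open>A\<close>; no generators are involved.\<close>

definition relvecs :: "nat \<Rightarrow> 'k::field mpoly set \<Rightarrow> (nat \<Rightarrow> 'k mpoly) set" where
  "relvecs n I = vspan (grad ` I \<union> {v. \<forall>j\<in>{1..n}. proj n I (v j) = \<zero>\<^bsub>coord_ring n I\<^esub>})"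

locale prime_presentation =
  fixes n :: nat and I :: "'k::field mpoly set"
  assumes prime: "primeideal I (mpoly_ring n)"
begin

abbreviation "A \<equiv> coord_ring n I"
abbreviation "\<pi> \<equiv> proj n I"
abbreviation "R \<equiv> relvecs n I"

sublocale P: cring "mpoly_ring n :: 'k mpoly ring" by (rule cring_mpoly_ring)
sublocale I: primeideal I "mpoly_ring n" by (rule prime)

sublocale domain_hom A \<pi>
proof -
  have "domain A" unfolding coord_ring_def by (rule I.quotient_is_domain)
  moreover have "type_hom A \<pi>"
    using type_hom.type_hom_quot[OF type_hom_trunc I.ideal_axioms]
    by (simp add: coord_ring_def proj_def[abs_def] res_class_def)
  moreover have "\<exists>y. \<pi> y = x" if x: "x \<in> carrier A" for x
  proof -
    obtain p where p: "p \<in> mpolys n" "x = res_class n I p"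
      using x unfolding coord_ring_def FactRing_def A_RCOSETS_def' res_class_def by auto
    then show ?thesis by (intro exI[of _ p]) (simp add: proj_def mp_trunc_id)
  qed
  ultimately show "domain_hom A \<pi>" by (simp add: domain_hom_def domain_hom_axioms_def)
qed

lemma proj_mpolys: "p \<in> mpolys n \<Longrightarrow> \<pi> p = res_class n I p"
  by (simp add: proj_def mp_trunc_id)

lemma I_mpolys: "p \<in> I \<Longrightarrow> p \<in> mpolys n"
  using I.a_subset by blast

lemma proj_eq_0_iff: "p \<in> mpolys n \<Longrightarrow> \<pi> p = \<zero>\<^bsub>A\<^esub> \<longleftrightarrow> p \<in> I"
  using I.rcos_const_imp_mem I.a_rcos_const
  by (auto simp: proj_mpolys res_class_def coord_ring_def FactRing_def)

lemma scalar_proj: "scalar n I c = \<pi> (mp_const c)"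
  by (simp add: scalar_def proj_mpolys)

lemma repr:
  assumes "U \<in> carrier A"
  shows "(SOME p. p \<in> U) \<in> mpolys n" "\<pi> (SOME p. p \<in> U) = U"
proof -
  obtain p where p: "p \<in> mpolys n" "U = I +>\<^bsub>mpoly_ring n\<^esub> p"
    using assms by (auto simp: coord_ring_def FactRing_def A_RCOSETS_def')
  have "p \<in> U" using p I.a_rcos_self by simp
  then have s: "(SOME p. p \<in> U) \<in> U" by (rule someI)
  then show m: "(SOME p. p \<in> U) \<in> mpolys n"
    using p I.a_elemrcos_carrier by blast
  then show "\<pi> (SOME p. p \<in> U) = U"
    using P.a_repr_independence[OF s[unfolded p(2)] p(1) I.a_subgroup] p(2)
    by (simp add: proj_mpolys res_class_def)
qed

lemma vclosed_relvecs: "vclosed R"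
  unfolding relvecs_def by (rule vclosed_vspan)

lemma relvecs_zero: "(\<And>j. j \<in> {1..n} \<Longrightarrow> \<pi> (v j) = \<zero>\<^bsub>A\<^esub>) \<Longrightarrow> v \<in> R"
  unfolding relvecs_def by (rule vspan_base) auto

text \<open>All vectors that vanish modulo \<open>I\<close> belong to the relation module, so only
  residue classes of the coordinates \<open>{1..n}\<close> matter, and arbitrary lifts may be used
  later on.\<close>

lemma relvecs_cong:
  assumes "v \<in> R" "\<And>j. j \<in> {1..n} \<Longrightarrow> \<pi> (v j) = \<pi> (w j)"
  shows "w \<in> R"
proof -
  have "(\<lambda>j. w j - v j) \<in> R"
    by (rule relvecs_zero) (use assms(2) hom_eq_iff in metis)
  from vclosed_add[OF vclosed_relvecs this assms(1)] show ?thesis by simp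
qed

lemma relvecs_grad: "p \<in> I \<Longrightarrow> grad p \<in> R"
  unfolding relvecs_def by (rule vspan_base) auto

lemma relvecs_grad_diff:
  assumes "p \<in> mpolys n" "q \<in> mpolys n" "\<pi> p = \<pi> q"
  shows "(\<lambda>j. grad p j - grad q j) \<in> R"
proof -
  have "p - q \<in> I" using assms proj_eq_0_iff[of "p - q"] by (simp add: hom_eq_iff mpolys_diff)
  then have "grad (p - q) \<in> R" by (rule relvecs_grad)
  then show ?thesis by (simp add: grad_def[abs_def] mp_pderiv_diff)
qed

lemma generator_mem:
  assumes "generates n I m f" "i \<in> {1..m}"
  shows "f i \<in> I"
proof -
  have f: "f ` {1..m} \<subseteq> mpolys n" and I: "I = Idl\<^bsub>mpoly_ring n\<^esub> (f ` {1..m})"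
    using assms(1) by (simp_all only: generates_def)
  show ?thesis by (subst I) (rule subsetD[OF P.genideal_self[OF f] imageI[OF assms(2)]])
qed

text \<open>The elements \<open>p\<close> of \<open>I\<close> whose gradient lies in the span form
  an ideal: in the Leibniz rule for \<open>q * p\<close> the term \<open>p * grad q\<close> vanishes
  modulo \<open>I\<close>. This ideal contains the generators, hence all of
  \<open>I\<close>.\<close>

lemma relvecs_generators:
  assumes gens: "generates n I m f"
  shows "R \<subseteq> vspan ((\<lambda>i. grad (f i)) ` {1..m} \<union> {v. \<forall>j\<in>{1..n}. \<pi> (v j) = \<zero>\<^bsub>A\<^esub>})"
    (is "R \<subseteq> vspan ?G")
proof -
  have V: "vclosed (vspan ?G)" by (rule vclosed_vspan)
  have K: "v \<in> vspan ?G" if "\<And>j. j \<in> {1..n} \<Longrightarrow> \<pi> (v j) = \<zero>\<^bsub>A\<^esub>" for v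
    using that by (intro vspan_base) auto
  let ?J = "{p \<in> I. grad p \<in> vspan ?G}"
  have mult: "q * p \<in> ?J" if "p \<in> ?J" "q \<in> mpolys n" for p q
  proof -
    have p: "p \<in> I" "grad p \<in> vspan ?G" using that by auto
    have "(\<lambda>j. q * grad p j + p * grad q j) \<in> vspan ?G"
      using proj_eq_0_iff[OF I_mpolys[OF p(1)]] p(1)
      by (intro vclosed_lin[OF V p(2)] K) (simp add: hom_times)
    moreover have "q * p \<in> I" using I.I_l_closed[of p q] that by simp
    ultimately show ?thesis by (simp add: grad_def[abs_def] mp_pderiv_mult)
  qed
  have "ideal ?J (mpoly_ring n)"
  proof (rule idealI)
    show "subgroup ?J (add_monoid (mpoly_ring n))"
    proof (rule P.add.subgroupI)
      show "?J \<subseteq> carrier (mpoly_ring n)" using I_mpolys by blast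
      have g0: "grad 0 = (\<lambda>_. 0)" by (simp add: grad_def[abs_def])
      have "grad 0 \<in> vspan ?G" unfolding g0 by (rule vclosed_0[OF V])
      moreover have "0 \<in> I" using I.zero_closed by simp
      ultimately have "0 \<in> ?J" by (intro CollectI conjI)
      then show "?J \<noteq> {}" by (metis empty_iff)
      show "\<ominus>\<^bsub>mpoly_ring n\<^esub> p \<in> ?J" if "p \<in> ?J" for p
        using mult[OF that, of "-1"] that mpolys_minus[of 1 n] by (simp add: mpoly_ring_uminus I_mpolys)
      show "p \<oplus>\<^bsub>mpoly_ring n\<^esub> q \<in> ?J" if "p \<in> ?J" "q \<in> ?J" for p q
      proof -
        have "p + q \<in> I" using that I.a_closed[of p q] by simp
        moreover have "grad (p + q) = (\<lambda>j. grad p j + grad q j)" by (simp add: grad_def[abs_def] mp_pderiv_add)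
        ultimately show ?thesis using that vclosed_add[OF V] by simp
      qed
    qed
    show "x \<otimes>\<^bsub>mpoly_ring n\<^esub> p \<in> ?J" "p \<otimes>\<^bsub>mpoly_ring n\<^esub> x \<in> ?J"
      if "p \<in> ?J" "x \<in> mpolys n" for p x
      using mult[OF that] by (simp_all add: mult.commute)
  qed (rule P.ring_axioms)
  moreover have "f ` {1..m} \<subseteq> ?J"
  proof -
    have "f ` {1..m} \<subseteq> I" using generator_mem[OF gens] by blast
    then show ?thesis by (auto intro: vspan_base)
  qed
  ultimately have "I \<subseteq> ?J" using gens P.genideal_minimal by (simp add: generates_def)
  then have "grad ` I \<subseteq> vspan ?G" by blast
  moreover have "{v. \<forall>j\<in>{1..n}. \<pi> (v j) = \<zero>\<^bsub>A\<^esub>} \<subseteq> vspan ?G"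
    by (intro subsetI vspan_base UnI2)
  ultimately show ?thesis
    unfolding relvecs_def by (intro vspan_subset[OF V] Un_least)
qed

lemma det_functional_zero_row:
  assumes t: "t < k" "\<And>c. c \<in> C \<Longrightarrow> \<pi> (r t c) = \<zero>\<^bsub>A\<^esub>" and j: "\<And>v. v < k + l \<Longrightarrow> j v \<in> C"
  shows "\<pi> (det_functional k l r j vs) = \<zero>\<^bsub>A\<^esub>"
proof (cases k)
  case (Suc k')
  show ?thesis
    unfolding Suc det_functional_laplace[OF t(1)[unfolded Suc]]
    by (rule hom_sum_0) (use t(2) j Suc in \<open>simp add: hom_times\<close>)
qed (use t in simp)

lemma ideal_det_values: "ideal (\<pi> ` det_values k C V) A"
  by (rule ideal_image) (auto intro: det_values_0 det_values_lin)

lemma jacobi_minor_eq: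
  assumes "generates n I m f" "\<And>u. u \<in> {1..k} \<Longrightarrow> i u \<in> {1..m}"
  shows "jacobi_minor n I f k i j = \<pi> (fun_det k (\<lambda>u v. grad (f (i (Suc u))) (j (Suc v))))"
  unfolding jacobi_minor_def
proof (rule hom_det)
  fix u v assume "u \<in> {1..k}"
  then have "f (i u) \<in> mpolys n" using assms by (auto simp: generates_def)
  then show "jacobi_matrix n I f (i u) (j v) = \<pi> (grad (f (i u)) (j v))"
    by (simp add: jacobi_matrix_def grad_def proj_mpolys mpolys_pderiv)
qed

lemma jacobi_rank_eq:
  assumes "generates n I m f"
  shows "jacobi_rank n I m f = mat_rank (frac_field A) m n (\<lambda>i j. frac_hom (grad (f i) j))"
proof -
  have eq: "jacobi_matrix n I f i j = \<pi> (grad (f i) j)" if "i \<in> {1..m}" for i j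
  proof -
    have "f i \<in> mpolys n" using assms that by (auto simp: generates_def)
    then show ?thesis by (simp add: jacobi_matrix_def grad_def proj_mpolys mpolys_pderiv)
  qed
  have "lin_indep_columns (frac_field A) m (\<lambda>i j. fraction A (jacobi_matrix n I f i j) \<one>\<^bsub>A\<^esub>) S =
      lin_indep_columns (frac_field A) m (\<lambda>i j. frac_hom (grad (f i) j)) S" for S
    unfolding lin_indep_columns_def by (intro ball_cong refl arg_cong2[of _ _ _ _ "(\<longrightarrow>)"]) (simp add: eq)
  then show ?thesis by (simp add: jacobi_rank_def mat_rank_def)
qed

text \<open>The right side mentions no generators, which gives independence of them. It also covers
  sizes above the rank, where the Jacobian ideal is zero by convention: there all minors vanish
  anyway, because the columns are dependent over the field of fractions.\<close>

lemma jacobian_ideal_eq: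
  assumes gens: "generates n I m f"
  shows "jacobian_ideal n I m f k = \<pi> ` det_values k {1..n} R"
proof
  let ?a = "jacobian_ideal n I m f k"
  let ?M = "{jacobi_minor n I f k i j | i j. i \<in> increasing_tuples k m \<and> j \<in> increasing_tuples k n}"
  have mem: "i u \<in> {1..m}" if "i \<in> increasing_tuples k m" "u \<in> {1..k}" for i u m k
    using that by (auto simp: increasing_tuples_def)
  have minor: "jacobi_minor n I f k i j =
      \<pi> (det_functional k 0 (\<lambda>u. grad (f (i (Suc u)))) (\<lambda>v. j (Suc v)) (\<lambda>_ _. 0))"
    if "i \<in> increasing_tuples k m" for i j
  proof -
    have "jacobi_minor n I f k i j = \<pi> (fun_det k (\<lambda>u v. grad (f (i (Suc u))) (j (Suc v))))"
      by (rule jacobi_minor_eq[OF gens]) (rule mem[OF that])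
    also have "fun_det k (\<lambda>u v. grad (f (i (Suc u))) (j (Suc v))) =
        det_functional k 0 (\<lambda>u. grad (f (i (Suc u)))) (\<lambda>v. j (Suc v)) (\<lambda>_ _. 0)"
      unfolding det_functional_def by (simp, intro fun_det_cong, simp)
    finally show ?thesis .
  qed
  note fI = generator_mem[OF gens]
  have M: "?M \<subseteq> carrier A" using minor by auto
  have "?M \<subseteq> \<pi> ` det_values k {1..n} R"
  proof
    fix x assume "x \<in> ?M"
    then obtain i j where ij: "i \<in> increasing_tuples k m" "j \<in> increasing_tuples k n"
      and x: "x = jacobi_minor n I f k i j" by blast
    have "det_functional k 0 (\<lambda>u. grad (f (i (Suc u)))) (\<lambda>v. j (Suc v)) \<in> det_span k 0 {1..n} R"
      using mem[OF ij(1)] mem[OF ij(2)] by (intro det_functional_in_span relvecs_grad fI) auto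
    then show "x \<in> \<pi> ` det_values k {1..n} R"
      unfolding x minor[OF ij(1)] det_values_def by blast
  qed
  then have "Idl\<^bsub>A\<^esub> ?M \<subseteq> \<pi> ` det_values k {1..n} R"
    by (rule genideal_minimal[OF ideal_det_values])
  moreover have "\<zero>\<^bsub>A\<^esub> \<in> \<pi> ` det_values k {1..n} R"
    using det_values_0 by (rule image_eqI[rotated]) (simp add: hom_0)
  ultimately show "?a \<subseteq> \<pi> ` det_values k {1..n} R"
    unfolding jacobian_ideal_def by (simp only: empty_subsetI insert_subset split: if_split) blast
  have a: "ideal ?a A"
    unfolding jacobian_ideal_def using genideal_ideal[OF M] zeroideal by auto
  interpret a: ideal ?a A by (rule a)
  let ?Q = "{\<phi> :: (nat \<Rightarrow> nat \<Rightarrow> 'k mpoly) \<Rightarrow> 'k mpoly. \<pi> (\<phi> (\<lambda>_ _. 0)) \<in> ?a}"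
  have Q: "vclosed ?Q"
    unfolding vclosed_def by (auto simp: hom_0 hom_plus hom_times a.I_l_closed)
  have gen: "det_functional k 0 (\<lambda>u. grad (f (i u))) j \<in> ?Q"
    if i: "\<And>u. u < k \<Longrightarrow> i u \<in> {1..m}" and j: "\<And>v. v < k + 0 \<Longrightarrow> j v \<in> {1..n}" for i j
  proof (cases "k \<le> jacobi_rank n I m f")
    case True
    show ?thesis
    proof (rule det_functional_increasing[OF Q _ i j])
      fix i j assume "i \<in> increasing_tuples k m" "j \<in> increasing_tuples (k + 0) n"
      then have "jacobi_minor n I f k i j \<in> ?M" by auto
      then have "jacobi_minor n I f k i j \<in> ?a"
        unfolding jacobian_ideal_def using True genideal_self[OF M] by auto
      then show "det_functional k 0 (\<lambda>u. grad (f (i (Suc u)))) (\<lambda>v. j (Suc v)) \<in> ?Q"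
        using minor[OF \<open>i \<in> _\<close>] by simp
    qed
  next
    case False
    have "\<pi> (fun_det k (\<lambda>u v. grad (f (i u)) (j v))) = \<zero>\<^bsub>A\<^esub>"
      by (rule minor_above_rank) (use False jacobi_rank_eq[OF gens] i j in auto)
    also have "fun_det k (\<lambda>u v. grad (f (i u)) (j v)) = det_functional k 0 (\<lambda>u. grad (f (i u))) j (\<lambda>_ _. 0)"
      unfolding det_functional_def by (simp, intro fun_det_cong, simp)
    finally show ?thesis by simp
  qed
  have "det_span k 0 {1..n} R \<subseteq> ?Q"
  proof (rule det_span_subset[OF Q relvecs_generators[OF gens]])
    fix r j
    assume r: "\<And>u. u < k \<Longrightarrow> r u \<in> (\<lambda>i. grad (f i)) ` {1..m} \<union> {v. \<forall>j\<in>{1..n}. \<pi> (v j) = \<zero>\<^bsub>A\<^esub>}"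
      and j: "\<And>v. v < k + 0 \<Longrightarrow> j v \<in> {1..n}"
    \<comment> \<open>Either some row is zero modulo \<open>I\<close>, and expanding along it gives
      zero, or every row is the gradient of a generator and the value is an honest minor.\<close>
    show "det_functional k 0 r j \<in> ?Q"
    proof (cases "\<exists>t<k. \<forall>j\<in>{1..n}. \<pi> (r t j) = \<zero>\<^bsub>A\<^esub>")
      case True
      then show ?thesis using det_functional_zero_row[of _ k "{1..n}" r 0 j] j by auto
    next
      case False
      then have "\<forall>u. \<exists>i. u < k \<longrightarrow> i \<in> {1..m} \<and> r u = grad (f i)" using r by blast
      then obtain i where i: "\<And>u. u < k \<Longrightarrow> i u \<in> {1..m} \<and> r u = grad (f (i u))" by metis
      have "det_functional k 0 r j = det_functional k 0 (\<lambda>u. grad (f (i u))) j"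
        by (intro ext det_functional_cong) (use i in auto)
      then show ?thesis using gen[of i j] i j by simp
    qed
  qed
  then show "\<pi> ` det_values k {1..n} R \<subseteq> ?a" by (auto simp: det_values_def)
qed

text \<open>Recovers the rank from the ideals of minors, as the last size with a non-zero ideal.
  Only this description of the rank is used when ranks of two presentations are compared.\<close>

lemma jacobi_rank_det_values:
  assumes gens: "generates n I m f"
  shows "jacobi_rank n I m f < k \<Longrightarrow> \<pi> ` det_values k {1..n} R = {\<zero>\<^bsub>A\<^esub>}"
    and "\<pi> ` det_values (jacobi_rank n I m f) {1..n} R \<noteq> {\<zero>\<^bsub>A\<^esub>}"
proof -
  show "\<pi> ` det_values k {1..n} R = {\<zero>\<^bsub>A\<^esub>}" if "jacobi_rank n I m f < k"
    using jacobian_ideal_eq[OF gens, of k] that by (simp add: jacobian_ideal_def)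
  define r where "r = jacobi_rank n I m f"
  obtain i j where ij: "\<forall>u<r. i u \<in> {1..m}" "\<forall>v<r. j v \<in> {1..n}"
    "\<pi> (fun_det r (\<lambda>u v. grad (f (i u)) (j v))) \<noteq> \<zero>\<^bsub>A\<^esub>"
    using nonzero_minor_rank[of r m n "\<lambda>i. grad (f i)"] jacobi_rank_eq[OF gens] r_def by blast
  note fI = generator_mem[OF gens]
  have "fun_det r (\<lambda>u v. grad (f (i u)) (j v)) = det_functional r 0 (\<lambda>u. grad (f (i u))) j (\<lambda>_ _. 0)"
    unfolding det_functional_def by (simp, intro fun_det_cong, simp)
  moreover have "det_functional r 0 (\<lambda>u. grad (f (i u))) j \<in> det_span r 0 {1..n} R"
    using ij by (intro det_functional_in_span relvecs_grad fI) auto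
  ultimately have "fun_det r (\<lambda>u v. grad (f (i u)) (j v)) \<in> det_values r {1..n} R"
    by (auto simp: det_values_def)
  then show "\<pi> ` det_values (jacobi_rank n I m f) {1..n} R \<noteq> {\<zero>\<^bsub>A\<^esub>}"
    unfolding r_def[symmetric] using ij(3) by blast
qed

end

section \<open>Derivations induced by determinantal functionals\<close>

definition fun_derivation ::
  "nat \<Rightarrow> 'k::field mpoly set \<Rightarrow> 'k mpoly set set \<Rightarrow> ((nat \<Rightarrow> nat \<Rightarrow> 'k mpoly) \<Rightarrow> 'k mpoly)
     \<Rightarrow> 'k mpoly set \<Rightarrow> 'k mpoly set set" where
  "fun_derivation n I a \<phi> =
     (\<lambda>U\<in>carrier (coord_ring n I). a +>\<^bsub>coord_ring n I\<^esub> proj n I (\<phi> (\<lambda>_. grad (SOME p. p \<in> U))))"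

context prime_presentation
begin

definition jac_ideal :: "nat \<Rightarrow> 'k mpoly set set" where
  "jac_ideal k = \<pi> ` det_values k {1..n} R"

lemma ideal_jac_ideal: "ideal (jac_ideal k) A"
  unfolding jac_ideal_def by (rule ideal_det_values)

lemma jacobian_ideal_jac_ideal: "generates n I m f \<Longrightarrow> jacobian_ideal n I m f k = jac_ideal k"
  unfolding jac_ideal_def by (rule jacobian_ideal_eq)

text \<open>Two representatives of a class differ by an element of \<open>I\<close>, so their
  gradients differ by a relation, and \<open>\<phi>\<close> sends relations into the ideal of minors
  of size \<open>Suc s\<close>. Hence any representative may replace the one chosen by
  \<open>SOME\<close>.\<close>

lemma fun_derivation_proj:
  assumes \<phi>: "\<phi> \<in> det_span s 1 {1..n} R" and p: "p \<in> mpolys n"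
  shows "fun_derivation n I (jac_ideal (Suc s)) \<phi> (\<pi> p) = jac_ideal (Suc s) +>\<^bsub>A\<^esub> \<pi> (\<phi> (\<lambda>_. grad p))"
proof -
  define q where "q = (SOME q. q \<in> \<pi> p)"
  have q: "q \<in> mpolys n" "\<pi> q = \<pi> p" using repr[of "\<pi> p"] by (simp_all add: q_def)
  have "\<phi> (\<lambda>_ j. grad q j - grad p j) \<in> det_values (Suc s) {1..n} R"
    by (rule det_values_apply[OF \<phi> relvecs_grad_diff[OF q(1) p q(2)]])
  also have "(\<lambda>_ j. grad q j - grad p j) = (\<lambda>_::nat. \<lambda>j. (-1) * grad p j + grad q j)" by auto
  also have "\<phi> \<dots> = \<phi> (\<lambda>_. grad q) - \<phi> (\<lambda>_. grad p)"
    by (subst det_span_add[OF \<phi>]) simp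
  finally have "\<pi> (\<phi> (\<lambda>_. grad q) - \<phi> (\<lambda>_. grad p)) \<in> jac_ideal (Suc s)"
    unfolding jac_ideal_def by (rule imageI)
  then show ?thesis
    using hom_quot_eq_iff[OF ideal_jac_ideal] by (simp add: fun_derivation_def flip: q_def)
qed

text \<open>On polynomials the gradient obeys the Leibniz rule exactly and \<open>\<phi>\<close> is
  linear; representatives of sums and products can be taken to be sums and products of
  representatives.\<close>

lemma fun_derivation_in_derivations:
  assumes \<phi>: "\<phi> \<in> det_span s 1 {1..n} R"
  shows "fun_derivation n I (jac_ideal (Suc s)) \<phi> \<in> derivations (scalar n I) A (jac_ideal (Suc s))"
    (is "?D \<in> derivations _ _ ?a")
proof -
  interpret Q: type_hom "A Quot ?a" "\<lambda>x. ?a +>\<^bsub>A\<^esub> \<pi> x"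
    by (rule type_hom_quot[OF ideal_jac_ideal])
  note D = fun_derivation_proj[OF \<phi>]
  have lin: "\<phi> (\<lambda>_ j. c * x j + y j) = c * \<phi> (\<lambda>_. x) + \<phi> (\<lambda>_. y)" for c x y
    by (rule det_span_add[OF \<phi>])
  have zero: "\<phi> (\<lambda>_ _. 0) = 0"
    using lin[of "-1" "\<lambda>_. 0" "\<lambda>_. 0"] by simp
  have smult: "\<phi> (\<lambda>_ j. c * x j) = c * \<phi> (\<lambda>_. x)" for c x
    using lin[of c x "\<lambda>_. 0"] zero by simp
  have ex: "\<exists>p\<in>mpolys n. x = \<pi> p" if "x \<in> carrier A" for x
    using repr[OF that] by metis
  show ?thesis
    unfolding derivations_def
  proof (intro CollectI conjI ballI allI)
    show "?D \<in> carrier A \<rightarrow>\<^sub>E carrier (A Quot ?a)"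
      unfolding fun_derivation_def using Q.hom_closed by (intro restrict_PiE[THEN iffD2] Pi_I)
  next
    fix x y assume "x \<in> carrier A" "y \<in> carrier A"
    then obtain p q where x: "x = \<pi> p" "p \<in> mpolys n" and y: "y = \<pi> q" "q \<in> mpolys n"
      using ex by metis
    have "grad (p + q) = (\<lambda>j. 1 * grad p j + grad q j)"
      by (simp add: grad_def[abs_def] mp_pderiv_add)
    then have "\<phi> (\<lambda>_. grad (p + q)) = \<phi> (\<lambda>_. grad p) + \<phi> (\<lambda>_. grad q)"
      using lin[of 1 "grad p" "grad q"] by simp
    then show "?D (x \<oplus>\<^bsub>A\<^esub> y) = ?D x \<oplus>\<^bsub>A Quot ?a\<^esub> ?D y"
      using x y by (simp add: D mpolys_add Q.hom_plus flip: hom_plus)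
    have "grad (p * q) = (\<lambda>j. p * grad q j + q * grad p j)"
      by (simp add: grad_def[abs_def] mp_pderiv_mult)
    then have "\<phi> (\<lambda>_. grad (p * q)) = p * \<phi> (\<lambda>_. grad q) + q * \<phi> (\<lambda>_. grad p)"
      by (simp only: lin smult)
    then show "?D (x \<otimes>\<^bsub>A\<^esub> y) =
        (?a +>\<^bsub>A\<^esub> x) \<otimes>\<^bsub>A Quot ?a\<^esub> ?D y \<oplus>\<^bsub>A Quot ?a\<^esub> (?a +>\<^bsub>A\<^esub> y) \<otimes>\<^bsub>A Quot ?a\<^esub> ?D x"
      using x y by (simp add: D mpolys_mult Q.hom_plus Q.hom_times flip: hom_times)
  next
    fix c x assume "x \<in> carrier A"
    then obtain p where x: "x = \<pi> p" "p \<in> mpolys n" using ex by metis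
    have "grad (mp_const c * p) = (\<lambda>j. mp_const c * grad p j)"
      by (simp add: grad_def[abs_def] mp_pderiv_mult)
    then have "\<phi> (\<lambda>_. grad (mp_const c * p)) = mp_const c * \<phi> (\<lambda>_. grad p)"
      by (simp only: lin smult)
    then show "?D (scalar n I c \<otimes>\<^bsub>A\<^esub> x) = (?a +>\<^bsub>A\<^esub> scalar n I c) \<otimes>\<^bsub>A Quot ?a\<^esub> ?D x"
      using x by (simp add: D mpolys_mult Q.hom_times scalar_proj flip: hom_times)
  qed
qed

text \<open>Linearity of the passage from functionals to derivations: images of submodules are
  submodules, and the functionals whose derivation lies in a given submodule are closed in the sense
  of \<open>vclosed\<close>.\<close>

lemma fun_derivation_lin:
  "fun_derivation n I (jac_ideal k) (\<lambda>vs. c * \<phi> vs + \<psi> vs) =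
     ((jac_ideal k +>\<^bsub>A\<^esub> \<pi> c) \<odot>\<^bsub>der_module (scalar n I) A (jac_ideal k)\<^esub> fun_derivation n I (jac_ideal k) \<phi>)
     \<oplus>\<^bsub>der_module (scalar n I) A (jac_ideal k)\<^esub> fun_derivation n I (jac_ideal k) \<psi>"
proof -
  interpret Q: type_hom "A Quot jac_ideal k" "\<lambda>x. jac_ideal k +>\<^bsub>A\<^esub> \<pi> x"
    by (rule type_hom_quot[OF ideal_jac_ideal])
  show ?thesis
    unfolding fun_derivation_def der_module_def
    by (simp only: module.simps partial_object.simps ring.simps) (rule restrict_ext, simp add: Q.hom_plus Q.hom_times)
qed

lemma fun_derivation_zero:
  assumes "\<And>vs. \<pi> (\<phi> vs) = \<zero>\<^bsub>A\<^esub>"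
  shows "fun_derivation n I (jac_ideal k) \<phi> = \<zero>\<^bsub>der_module (scalar n I) A (jac_ideal k)\<^esub>"
proof -
  interpret Q: type_hom "A Quot jac_ideal k" "\<lambda>x. jac_ideal k +>\<^bsub>A\<^esub> \<pi> x"
    by (rule type_hom_quot[OF ideal_jac_ideal])
  show ?thesis
    using Q.hom_0 by (simp add: fun_derivation_def der_module_def assms hom_0)
qed

lemma module_der: "Module.module (A Quot jac_ideal k) (der_module (scalar n I) A (jac_ideal k))"
  by (rule module_der_module[OF is_cring ideal_jac_ideal]) (simp add: scalar_proj)

lemma submodule_fun_derivations:
  "submodule (fun_derivation n I (jac_ideal (Suc s)) ` det_span s 1 {1..n} R)
     (A Quot jac_ideal (Suc s)) (der_module (scalar n I) A (jac_ideal (Suc s)))"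
    (is "submodule (?d ` ?S) ?Q ?M")
proof -
  interpret M: Module.module ?Q ?M by (rule module_der)
  have V: "vclosed ?S" by (rule vclosed_det_span)
  have z: "?d (\<lambda>_. 0) = \<zero>\<^bsub>?M\<^esub>" by (rule fun_derivation_zero) (rule hom_0)
  have car: "?d \<phi> \<in> carrier ?M" if "\<phi> \<in> ?S" for \<phi>
    using fun_derivation_in_derivations[OF that] by (simp add: der_module_def)
  have sm: "b \<odot>\<^bsub>?M\<^esub> D \<in> ?d ` ?S" if bD: "b \<in> carrier ?Q" "D \<in> ?d ` ?S" for b D
  proof -
    obtain \<phi> where \<phi>: "D = ?d \<phi>" "\<phi> \<in> ?S" using bD by blast
    obtain x where "x \<in> carrier A" "b = jac_ideal (Suc s) +>\<^bsub>A\<^esub> x"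
      using bD(1) by (auto simp: FactRing_def A_RCOSETS_def')
    then obtain c where b: "b = jac_ideal (Suc s) +>\<^bsub>A\<^esub> \<pi> c" using hom_surj by metis
    \<comment> \<open>The summand 0 gives the scalar multiple the shape
      \<open>c * \<phi> + \<psi>\<close> required by linearity.\<close>
    have "?d (\<lambda>vs. c * \<phi> vs + 0) = (b \<odot>\<^bsub>?M\<^esub> D) \<oplus>\<^bsub>?M\<^esub> \<zero>\<^bsub>?M\<^esub>"
      unfolding fun_derivation_lin z b \<phi> ..
    also have "\<dots> = b \<odot>\<^bsub>?M\<^esub> D"
      by (rule M.r_zero) (intro M.smult_closed bD(1), simp only: \<phi> car)
    finally have "b \<odot>\<^bsub>?M\<^esub> D = ?d (\<lambda>vs. c * \<phi> vs)" by (simp only: add_0_right)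
    then show ?thesis by (simp only:) (rule imageI, rule vclosed_smult[OF V \<phi>(2)])
  qed
  show ?thesis
  proof (rule M.submoduleI)
    show "?d ` ?S \<subseteq> carrier ?M" using car by blast
    show "\<zero>\<^bsub>?M\<^esub> \<in> ?d ` ?S" unfolding z[symmetric] by (rule imageI, rule vclosed_0[OF V])
    show "\<ominus>\<^bsub>?M\<^esub> D \<in> ?d ` ?S" if D: "D \<in> ?d ` ?S" for D
    proof -
      have "D \<in> carrier ?M" using D car by blast
      then have "\<ominus>\<^bsub>?M\<^esub> D = (\<ominus>\<^bsub>?Q\<^esub> \<one>\<^bsub>?Q\<^esub>) \<odot>\<^bsub>?M\<^esub> D" by (simp add: M.smult_l_minus)
      then show ?thesis using sm[OF _ D] by simp
    qed
    show "D \<oplus>\<^bsub>?M\<^esub> E \<in> ?d ` ?S" if DE: "D \<in> ?d ` ?S" "E \<in> ?d ` ?S" for D E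
    proof -
      obtain \<phi> \<psi> where \<phi>: "D = ?d \<phi>" "\<phi> \<in> ?S" and \<psi>: "E = ?d \<psi>" "\<psi> \<in> ?S" using DE by blast
      have 1: "jac_ideal (Suc s) +>\<^bsub>A\<^esub> \<pi> 1 = \<one>\<^bsub>?Q\<^esub>" by (simp add: FactRing_def hom_1)
      have "?d (\<lambda>vs. 1 * \<phi> vs + \<psi> vs) = (\<one>\<^bsub>?Q\<^esub> \<odot>\<^bsub>?M\<^esub> D) \<oplus>\<^bsub>?M\<^esub> E"
        unfolding fun_derivation_lin 1 \<phi> \<psi> ..
      also have "\<dots> = D \<oplus>\<^bsub>?M\<^esub> E" using car[OF \<phi>(2)] by (simp add: \<phi>)
      finally have "D \<oplus>\<^bsub>?M\<^esub> E = ?d (\<lambda>vs. 1 * \<phi> vs + \<psi> vs)" by (rule sym)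
      then show ?thesis by (simp only:) (rule imageI, rule vclosed_lin[OF V \<phi>(2) \<psi>(2)])
    qed
  qed (rule sm)
qed

text \<open>The formal determinant is the Laplace expansion of the functional along its free row,
  which has index \<open>s\<close> when counted from 0.\<close>

lemma minor_derivation_eq:
  assumes gens: "generates n I m f" and i: "i \<in> increasing_tuples s m"
  shows "minor_derivation n I m f s i j = fun_derivation n I (jac_ideal (Suc s))
    (det_functional s 1 (\<lambda>u. grad (f (i (Suc u)))) (\<lambda>v. j (Suc v)))"
proof -
  have im: "i u \<in> {1..m}" if "u \<in> {1..s}" for u
    using that i by (auto simp: increasing_tuples_def)
  have minor: "jacobi_minor n I f s i j = \<pi> (fun_det s (\<lambda>u v. grad (f (i (Suc u))) (j (Suc v))))" for j
    by (rule jacobi_minor_eq[OF gens]) (rule im)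
  have "(\<Oplus>\<^bsub>A\<^esub>k\<in>{1..s + 1}. [((- 1) ^ (s + 1 + k) :: int)] \<cdot>\<^bsub>A\<^esub>
          (jacobi_minor n I f s i (\<lambda>v. j (if v < k then v else v + 1))
            \<otimes>\<^bsub>A\<^esub> res_class n I (mp_pderiv (j k) p))) =
      \<pi> (det_functional s 1 (\<lambda>u. grad (f (i (Suc u)))) (\<lambda>v. j (Suc v)) (\<lambda>_. grad p))"
    if p: "p \<in> mpolys n" for p
  proof -
    let ?m = "\<lambda>k. fun_det s (\<lambda>u v. grad (f (i (Suc u))) (j (if Suc v < k then Suc v else Suc v + 1)))"
    have "(\<Oplus>\<^bsub>A\<^esub>k\<in>{1..s + 1}. [((- 1) ^ (s + 1 + k) :: int)] \<cdot>\<^bsub>A\<^esub>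
          (jacobi_minor n I f s i (\<lambda>v. j (if v < k then v else v + 1))
            \<otimes>\<^bsub>A\<^esub> res_class n I (mp_pderiv (j k) p))) =
        (\<Oplus>\<^bsub>A\<^esub>k\<in>{1..s + 1}. \<pi> (of_int ((- 1) ^ (s + 1 + k)) * (?m k * grad p (j k))))"
      using p by (simp only: minor hom_of_int[symmetric] hom_times[symmetric] grad_def proj_mpolys[symmetric] mpolys_pderiv)
    also have "\<dots> = \<pi> (\<Sum>k=1..s + 1. of_int ((- 1) ^ (s + 1 + k)) * (?m k * grad p (j k)))"
      by (rule hom_sum[symmetric]) simp
    \<comment> \<open>With \<open>k = Suc v\<close> the sign exponents \<open>s + 1 + k\<close> and
      \<open>s + v\<close> differ by 2.\<close>
    also have "(\<Sum>k=1..s + 1. of_int ((- 1) ^ (s + 1 + k)) * (?m k * grad p (j k))) =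
        (\<Sum>v<Suc s. grad p (j (Suc v)) * ((- 1) ^ (s + v) * ?m (Suc v)))"
      unfolding One_nat_def sum.atLeast1_atMost_eq
      by (intro sum.cong) (simp_all add: mult_ac)
    also have "\<dots> = det_functional s 1 (\<lambda>u. grad (f (i (Suc u)))) (\<lambda>v. j (Suc v)) (\<lambda>_. grad p)"
    proof -
      have "?m (Suc v) = fun_det s (\<lambda>a b. (if insert_index s a < s then grad (f (i (Suc (insert_index s a))))
          else grad p) (j (Suc (insert_index v b))))" for v
        by (intro fun_det_cong) (auto simp: insert_index_def)
      then show ?thesis
        unfolding det_functional_def Suc_eq_plus1[symmetric]
        by (subst fun_det_laplace_row[of s]) (simp_all del: sum.lessThan_Suc)
    qed
    finally show ?thesis .
  qed
  then show ?thesis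
    unfolding minor_derivation_def fun_derivation_def Let_def
    using jacobian_ideal_jac_ideal[OF gens, of "s + 1"] by (intro restrict_ext) (simp add: repr)
qed

text \<open>One inclusion holds because the right side is a submodule containing the generating
  derivations. For the other, any submodule \<open>N\<close> with these derivations is pulled back
  to functionals, and the reduction to generators and increasing tuples is repeated as for the
  Jacobian ideals.\<close>

lemma der_s_eq:
  assumes gens: "generates n I m f"
  shows "der_s n I m f s = fun_derivation n I (jac_ideal (Suc s)) ` det_span s 1 {1..n} R"
proof -
  let ?d = "fun_derivation n I (jac_ideal (Suc s))"
  let ?Q = "A Quot jac_ideal (Suc s)" and ?M = "der_module (scalar n I) A (jac_ideal (Suc s))"
  let ?G = "{minor_derivation n I m f s i j | i j.
          i \<in> increasing_tuples s m \<and> j \<in> increasing_tuples (s + 1) n}"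
  interpret M: Module.module ?Q ?M by (rule module_der)
  have mem: "i u \<in> {1..m}" if "i \<in> increasing_tuples k m" "u \<in> {1..k}" for i u m k
    using that by (auto simp: increasing_tuples_def)
  note fI = generator_mem[OF gens]
  have der: "der_s n I m f s = \<Inter>{N. submodule N ?Q ?M \<and> ?G \<subseteq> N}"
    using jacobian_ideal_jac_ideal[OF gens, of "s + 1"] by (simp add: der_s_def gen_submodule_def)
  have "?G \<subseteq> ?d ` det_span s 1 {1..n} R"
  proof
    fix D assume "D \<in> ?G"
    then obtain i j where ij: "i \<in> increasing_tuples s m" "j \<in> increasing_tuples (s + 1) n"
      and D: "D = minor_derivation n I m f s i j" by blast
    have "det_functional s 1 (\<lambda>u. grad (f (i (Suc u)))) (\<lambda>v. j (Suc v)) \<in> det_span s 1 {1..n} R"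
      using mem[OF ij(1)] mem[OF ij(2)] by (intro det_functional_in_span relvecs_grad fI) auto
    then show "D \<in> ?d ` det_span s 1 {1..n} R"
      unfolding D minor_derivation_eq[OF gens ij(1)] by (rule imageI)
  qed
  then have "der_s n I m f s \<subseteq> ?d ` det_span s 1 {1..n} R"
    unfolding der using submodule_fun_derivations[of s] by (intro Inter_lower) simp
  moreover have "?d ` det_span s 1 {1..n} R \<subseteq> N" if N: "submodule N ?Q ?M" and G: "?G \<subseteq> N" for N
  proof -
    interpret Q: type_hom ?Q "\<lambda>x. jac_ideal (Suc s) +>\<^bsub>A\<^esub> \<pi> x"
      by (rule type_hom_quot[OF ideal_jac_ideal])
    note NE = M.submoduleE[OF N]
    have N0: "\<zero>\<^bsub>?M\<^esub> \<in> N" using subgroup.one_closed[OF submodule.axioms(1)[OF N]] by simp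
    let ?P = "{\<phi>. ?d \<phi> \<in> N}"
    have P: "vclosed ?P"
      unfolding vclosed_def
    proof (intro conjI ballI allI)
      show "(\<lambda>_. 0) \<in> ?P" using N0 fun_derivation_zero[of "\<lambda>_. 0" "Suc s"] by (simp add: hom_0)
      show "(\<lambda>vs. c * \<phi> vs + \<psi> vs) \<in> ?P" if "\<phi> \<in> ?P" "\<psi> \<in> ?P" for \<phi> \<psi> c
        using that by (simp only: mem_Collect_eq fun_derivation_lin) (intro NE(4,5) Q.hom_closed)
    qed
    have "det_span s 1 {1..n} R \<subseteq> ?P"
    proof (rule det_span_subset[OF P relvecs_generators[OF gens]])
      fix r j
      assume r: "\<And>u. u < s \<Longrightarrow> r u \<in> (\<lambda>i. grad (f i)) ` {1..m} \<union> {v. \<forall>j\<in>{1..n}. \<pi> (v j) = \<zero>\<^bsub>A\<^esub>}"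
        and j: "\<And>v. v < s + 1 \<Longrightarrow> j v \<in> {1..n}"
      show "det_functional s 1 r j \<in> ?P"
      proof (cases "\<exists>t<s. \<forall>j\<in>{1..n}. \<pi> (r t j) = \<zero>\<^bsub>A\<^esub>")
        case True
        then obtain t where t: "t < s" "\<And>j. j \<in> {1..n} \<Longrightarrow> \<pi> (r t j) = \<zero>\<^bsub>A\<^esub>" by blast
        have "?d (det_functional s 1 r j) = \<zero>\<^bsub>?M\<^esub>"
          by (intro fun_derivation_zero det_functional_zero_row[where C = "{1..n}"]) (use t j in auto)
        then show ?thesis using N0 by simp
      next
        case False
        then have "\<forall>u. \<exists>i. u < s \<longrightarrow> i \<in> {1..m} \<and> r u = grad (f i)" using r by blast
        then obtain i where i: "\<And>u. u < s \<Longrightarrow> i u \<in> {1..m} \<and> r u = grad (f (i u))" by metis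
        have "det_functional s 1 r j = det_functional s 1 (\<lambda>u. grad (f (i u))) j"
          by (intro ext det_functional_cong) (use i in auto)
        moreover have "det_functional s 1 (\<lambda>u. grad (f (i u))) j \<in> ?P"
        proof (rule det_functional_increasing[OF P])
          fix i j assume ij: "i \<in> increasing_tuples s m" "j \<in> increasing_tuples (s + 1) n"
          then have "minor_derivation n I m f s i j \<in> ?G" by blast
          then have "minor_derivation n I m f s i j \<in> N" by (rule subsetD[OF G])
          then show "det_functional s 1 (\<lambda>u. grad (f (i (Suc u)))) (\<lambda>v. j (Suc v)) \<in> ?P"
            unfolding mem_Collect_eq minor_derivation_eq[OF gens ij(1)] .
        qed (use i j in auto)
        ultimately show ?thesis by simp
      qed
    qed
    then show ?thesis by blast
  qed
  then have "?d ` det_span s 1 {1..n} R \<subseteq> der_s n I m f s"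
    unfolding der by (intro Inter_greatest) simp
  ultimately show ?thesis by (rule equalityI)
qed

end

declare One_nat_def [simp del]

section \<open>Comparison of two presentations\<close>

text \<open>An isomorphism of quotients does not lift canonically to the polynomial rings. A total
  relation compatible with the operations takes the place of a lift, and it passes to determinants
  since these are integer polynomials in the entries.\<close>

locale ring_corr =
  fixes \<rho> :: "'a::comm_ring_1 \<Rightarrow> 'b::comm_ring_1 \<Rightarrow> bool"
  assumes corr_0: "\<rho> 0 0" and corr_1: "\<rho> 1 1"
    and corr_add: "\<rho> x x' \<Longrightarrow> \<rho> y y' \<Longrightarrow> \<rho> (x + y) (x' + y')"
    and corr_mult: "\<rho> x x' \<Longrightarrow> \<rho> y y' \<Longrightarrow> \<rho> (x * y) (x' * y')"
    and corr_minus: "\<rho> x x' \<Longrightarrow> \<rho> (- x) (- x')"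
    and corr_total: "\<exists>x'. \<rho> x x'"
begin

lemma corr_sum: "(\<And>s. s \<in> S \<Longrightarrow> \<rho> (g s) (g' s)) \<Longrightarrow> \<rho> (\<Sum>s\<in>S. g s) (\<Sum>s\<in>S. g' s)"
  by (induction S rule: infinite_finite_induct) (auto intro: corr_0 corr_add)

lemma corr_prod: "(\<And>s. s \<in> S \<Longrightarrow> \<rho> (g s) (g' s)) \<Longrightarrow> \<rho> (\<Prod>s\<in>S. g s) (\<Prod>s\<in>S. g' s)"
  by (induction S rule: infinite_finite_induct) (auto intro: corr_1 corr_mult)

lemma corr_det:
  assumes "\<And>u v. u < k \<Longrightarrow> v < k \<Longrightarrow> \<rho> (M u v) (N u v)"
  shows "\<rho> (fun_det k M) (fun_det k N)"
  unfolding fun_det_Leibniz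
proof (intro corr_sum corr_mult corr_prod)
  fix p u assume p: "p \<in> {p. p permutes {0..<k}}" and "u \<in> {0..<k}"
  then show "\<rho> (M u (p u)) (N u (p u))" using permutes_in_image[of p "{0..<k}" u] by (intro assms) auto
next
  fix p :: "nat \<Rightarrow> nat"
  show "\<rho> (of_int (sign p)) (of_int (sign p))"
    using corr_1 corr_minus[OF corr_1] by (cases p rule: sign_cases) simp_all
qed

text \<open>Rows and columns are transported one by one. Totality is what supplies scalars on the
  right for the combinations occurring on the left.\<close>

lemma corr_det_span:
  assumes rows: "\<And>r. r \<in> R \<Longrightarrow> \<exists>r'\<in>R'. \<forall>c\<in>C. \<rho> (r c) (r' (g c))"
    and g: "\<And>c. c \<in> C \<Longrightarrow> g c \<in> C'"
    and \<phi>: "\<phi> \<in> det_span k l C R"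
  shows "\<exists>\<phi>'\<in>det_span k l C' R'. \<forall>vs vs'. (\<forall>u. \<forall>c\<in>C. \<rho> (vs u c) (vs' u (g c))) \<longrightarrow> \<rho> (\<phi> vs) (\<phi>' vs')"
proof -
  let ?Q = "{\<phi>. \<exists>\<phi>'\<in>det_span k l C' R'.
    \<forall>vs vs'. (\<forall>u. \<forall>c\<in>C. \<rho> (vs u c) (vs' u (g c))) \<longrightarrow> \<rho> (\<phi> vs) (\<phi>' vs')}"
  have V: "vclosed (det_span k l C' R')" by (rule vclosed_det_span)
  have "det_span k l C R \<subseteq> ?Q"
  proof (rule det_span_subset[where G = R])
    show "vclosed ?Q"
      unfolding vclosed_def
    proof (intro conjI ballI allI)
      show "(\<lambda>_. 0) \<in> ?Q" by (intro CollectI bexI[OF _ vclosed_0[OF V]]) (simp add: corr_0)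
      fix \<phi> \<psi> c assume "\<phi> \<in> ?Q" "\<psi> \<in> ?Q"
      then obtain \<phi>' \<psi>' where *: "\<phi>' \<in> det_span k l C' R'" "\<psi>' \<in> det_span k l C' R'"
        "\<And>vs vs'. \<forall>u. \<forall>c\<in>C. \<rho> (vs u c) (vs' u (g c)) \<Longrightarrow> \<rho> (\<phi> vs) (\<phi>' vs')"
        "\<And>vs vs'. \<forall>u. \<forall>c\<in>C. \<rho> (vs u c) (vs' u (g c)) \<Longrightarrow> \<rho> (\<psi> vs) (\<psi>' vs')"
        by blast
      obtain c' where c': "\<rho> c c'" using corr_total by blast
      show "(\<lambda>vs. c * \<phi> vs + \<psi> vs) \<in> ?Q"
        by (intro CollectI bexI[OF _ vclosed_lin[OF V *(1,2), of c']] allI impI corr_add corr_mult c' *(3,4))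
          blast+
    qed
    show "R \<subseteq> vspan R" by (auto intro: vspan_base)
    fix r j assume r: "\<And>u. u < k \<Longrightarrow> r u \<in> R" and j: "\<And>v. v < k + l \<Longrightarrow> j v \<in> C"
    have "\<forall>u. \<exists>r'. u < k \<longrightarrow> r' \<in> R' \<and> (\<forall>c\<in>C. \<rho> (r u c) (r' (g c)))" using rows r by blast
    then obtain r' where r': "\<And>u. u < k \<Longrightarrow> r' u \<in> R'" "\<And>u c. u < k \<Longrightarrow> c \<in> C \<Longrightarrow> \<rho> (r u c) (r' u (g c))"
      by metis
    have "\<rho> (det_functional k l r j vs) (det_functional k l r' (\<lambda>v. g (j v)) vs')"
      if "\<forall>u. \<forall>c\<in>C. \<rho> (vs u c) (vs' u (g c))" for vs vs'
      unfolding det_functional_def by (rule corr_det) (use that r' j in auto)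
    moreover have "det_functional k l r' (\<lambda>v. g (j v)) \<in> det_span k l C' R'"
      using r' g j by (intro det_functional_in_span) auto
    ultimately show "det_functional k l r j \<in> ?Q" by blast
  qed
  then show ?thesis using \<phi> by blast
qed

end

locale presentation_iso = P1: prime_presentation n I + P2: prime_presentation n' I'
  for n :: nat and I :: "'k::field mpoly set" and n' :: nat and I' :: "'k mpoly set" +
  fixes \<sigma> :: "'k mpoly set \<Rightarrow> 'k mpoly set"
  assumes iso: "\<sigma> \<in> alg_iso n I n' I'"
begin

abbreviation "A' \<equiv> coord_ring n' I'"
abbreviation "\<pi>' \<equiv> proj n' I'"
abbreviation "R' \<equiv> relvecs n' I'"
abbreviation corr :: "'k mpoly \<Rightarrow> 'k mpoly \<Rightarrow> bool" where
  "corr p p' \<equiv> \<sigma> (P1.\<pi> p) = \<pi>' p'"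

lemma ring_iso: "\<sigma> \<in> ring_iso P1.A A'"
  using iso by (simp add: alg_iso_def)

lemmas iso_closed = ring_iso_memE(1)[OF ring_iso]
  and iso_times = ring_iso_memE(2)[OF ring_iso]
  and iso_plus = ring_iso_memE(3)[OF ring_iso]
  and iso_one = ring_iso_memE(4)[OF ring_iso]
  and iso_bij = ring_iso_memE(5)[OF ring_iso]

lemma iso_proj:
  "\<sigma> (P1.\<pi> (p + q)) = \<sigma> (P1.\<pi> p) \<oplus>\<^bsub>A'\<^esub> \<sigma> (P1.\<pi> q)"
  "\<sigma> (P1.\<pi> (p * q)) = \<sigma> (P1.\<pi> p) \<otimes>\<^bsub>A'\<^esub> \<sigma> (P1.\<pi> q)"
  "\<sigma> (P1.\<pi> 1) = \<one>\<^bsub>A'\<^esub>"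
  by (simp_all add: P1.hom_plus P1.hom_times P1.hom_1 iso_plus iso_times iso_one)

sublocale C: type_hom A' "\<lambda>p. \<sigma> (P1.\<pi> p)"
  by (intro type_hom.intro type_hom_axioms.intro P2.is_cring iso_proj) (simp add: iso_closed)

sublocale ring_corr corr
proof
  show "\<exists>x'. corr x x'" for x using P2.hom_surj[OF C.hom_closed[of x]] by metis
qed (simp_all add: C.hom_0 P2.hom_0 C.hom_1 P2.hom_1 C.hom_plus P2.hom_plus C.hom_times P2.hom_times
    C.hom_neg P2.hom_neg)

lemma corr_surj: "\<exists>p\<in>mpolys n. corr p p'"
proof -
  obtain x where "x \<in> carrier P1.A" "\<sigma> x = \<pi>' p'"
    using iso_bij P2.hom_closed[of p'] by (metis bij_betw_def imageE)
  then show ?thesis using P1.repr[of x] by metis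
qed

lemma corr_inj: "corr p p' \<Longrightarrow> corr q p' \<Longrightarrow> P1.\<pi> p = P1.\<pi> q"
  using bij_betw_imp_inj_on[OF iso_bij] by (auto simp: inj_on_def)

lemma corr_zero: "corr p p' \<Longrightarrow> \<pi>' p' = \<zero>\<^bsub>A'\<^esub> \<Longrightarrow> P1.\<pi> p = \<zero>\<^bsub>P1.A\<^esub>"
  using corr_inj[of p p' 0] P1.hom_0 C.hom_0 by metis

lemma corr_const: "corr (mp_const c) (mp_const c)"
  using iso by (simp add: alg_iso_def P1.scalar_proj P2.scalar_proj)

text \<open>The situation is symmetric, so inclusions and inequalities proved in one direction can
  be reused with the inverse isomorphism.\<close>

lemma flip: "presentation_iso n' I' n I (inv_into (carrier P1.A) \<sigma>)"
proof -
  have s: "inv_into (carrier P1.A) \<sigma> (scalar n' I' c) = scalar n I c" for c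
    using bij_betw_inv_into_left[OF iso_bij, of "scalar n I c"] corr_const[of c]
    by (simp add: P1.scalar_proj P2.scalar_proj)
  have "inv_into (carrier P1.A) \<sigma> \<in> ring_iso A' P1.A"
    by (rule ring_iso_set_sym[OF P1.ring_axioms ring_iso])
  then show ?thesis
    using s by unfold_locales (simp add: alg_iso_def)
qed

lemma flip_corr: "inv_into (carrier P1.A) \<sigma> (\<pi>' p') = P1.\<pi> p \<longleftrightarrow> corr p p'"
  using bij_betw_inv_into_left[OF iso_bij, of "P1.\<pi> p"] bij_betw_inv_into_right[OF iso_bij, of "\<pi>' p'"]
  by auto

section \<open>The chain rule and the transport of relations\<close>

text \<open>The polynomial \<open>h l\<close> represents the preimage under \<open>\<sigma>\<close>
  of the \<open>l\<close>-th new variable. The lift \<open>q\<close> of \<open>p'\<close> and the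
  lifts \<open>b\<close> of its partial derivatives are built together by structural induction, the
  product case being the Leibniz rule on both sides.\<close>

lemma chain_rule_ex:
  assumes h: "\<And>l. l \<in> {1..n'} \<Longrightarrow> h l \<in> mpolys n \<and> corr (h l) (mp_var l)"
    and p': "p' \<in> mpolys n'"
  shows "\<exists>q b. q \<in> mpolys n \<and> corr q p' \<and> (\<forall>l. corr (b l) (mp_pderiv l p')) \<and>
    (\<lambda>j. grad q j - (\<Sum>l\<in>{1..n'}. b l * grad (h l) j)) \<in> P1.R"
  using p'
proof (induction rule: mpolys_induct)
  case (const c)
  have z: "(\<lambda>j. grad (mp_const c) j - (\<Sum>l\<in>{1..n'}. 0 * grad (h l) j)) \<in> P1.R"
    using vclosed_0[OF P1.vclosed_relvecs] by (simp add: grad_def)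
  show ?case
    by (rule exI[of _ "mp_const c"], rule exI[of _ "\<lambda>_. 0"]) (use z corr_const corr_0 in simp)
next
  case (var j)
  have "(\<Sum>l\<in>{1..n'}. (if l = j then 1 else 0) * grad (h l) i) = grad (h j) i" for i
    using var by (simp add: if_distrib[of "\<lambda>x. x * _"] sum.delta cong: if_cong)
  then have z: "(\<lambda>i. grad (h j) i - (\<Sum>l\<in>{1..n'}. (if l = j then 1 else 0) * grad (h l) i)) \<in> P1.R"
    using vclosed_0[OF P1.vclosed_relvecs] by simp
  have c: "corr (if l = j then 1 else 0) (mp_pderiv l (mp_var j))" for l
    using corr_0 corr_1 by (simp add: mp_pderiv_var)
  show ?case
    by (rule exI[of _ "h j"], rule exI[of _ "\<lambda>l. if l = j then 1 else 0"])
      (intro conjI allI c z h[OF var, THEN conjunct1] h[OF var, THEN conjunct2])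
next
  case (add p q)
  then obtain p1 b q1 d where *: "p1 \<in> mpolys n" "corr p1 p" "\<And>l. corr (b l) (mp_pderiv l p)"
    "(\<lambda>j. grad p1 j - (\<Sum>l\<in>{1..n'}. b l * grad (h l) j)) \<in> P1.R"
    "q1 \<in> mpolys n" "corr q1 q" "\<And>l. corr (d l) (mp_pderiv l q)"
    "(\<lambda>j. grad q1 j - (\<Sum>l\<in>{1..n'}. d l * grad (h l) j)) \<in> P1.R" by blast
  have z: "(\<lambda>j. grad (p1 + q1) j - (\<Sum>l\<in>{1..n'}. (b l + d l) * grad (h l) j)) \<in> P1.R"
    using vclosed_add[OF P1.vclosed_relvecs *(4,8)]
    by (simp add: grad_def mp_pderiv_add algebra_simps sum.distrib)
  have c: "corr (b l + d l) (mp_pderiv l (p + q))" for l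
    unfolding mp_pderiv_add by (intro corr_add *)
  show ?case
    by (rule exI[of _ "p1 + q1"], rule exI[of _ "\<lambda>l. b l + d l"])
      (intro conjI allI c z mpolys_add corr_add *)
next
  case (mult p q)
  then obtain p1 b q1 d where *: "p1 \<in> mpolys n" "corr p1 p" "\<And>l. corr (b l) (mp_pderiv l p)"
    "(\<lambda>j. grad p1 j - (\<Sum>l\<in>{1..n'}. b l * grad (h l) j)) \<in> P1.R"
    "q1 \<in> mpolys n" "corr q1 q" "\<And>l. corr (d l) (mp_pderiv l q)"
    "(\<lambda>j. grad q1 j - (\<Sum>l\<in>{1..n'}. d l * grad (h l) j)) \<in> P1.R" by blast
  have z: "(\<lambda>j. grad (p1 * q1) j - (\<Sum>l\<in>{1..n'}. (p1 * d l + q1 * b l) * grad (h l) j)) \<in> P1.R"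
    using vclosed_lin[OF P1.vclosed_relvecs *(8) vclosed_smult[OF P1.vclosed_relvecs *(4), of q1], of p1]
    by (simp add: grad_def mp_pderiv_mult algebra_simps sum.distrib sum_distrib_left)
  have c: "corr (p1 * d l + q1 * b l) (mp_pderiv l (p * q))" for l
    unfolding mp_pderiv_mult by (intro corr_add corr_mult *)
  show ?case
    by (rule exI[of _ "p1 * q1"], rule exI[of _ "\<lambda>l. p1 * d l + q1 * b l"])
      (intro conjI allI c z mpolys_mult corr_mult *)
qed

text \<open>The lifts no longer matter: another lift of \<open>p'\<close> changes the gradient by a
  relation, and other lifts of the coefficients change the sum by a vector that is zero modulo
  \<open>I\<close>.\<close>

lemma chain_rule:
  assumes h: "\<And>l. l \<in> {1..n'} \<Longrightarrow> h l \<in> mpolys n \<and> corr (h l) (mp_var l)"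
    and p: "p \<in> mpolys n" "p' \<in> mpolys n'" "corr p p'"
    and b: "\<And>l. l \<in> {1..n'} \<Longrightarrow> corr (b l) (mp_pderiv l p')"
  shows "(\<lambda>j. grad p j - (\<Sum>l\<in>{1..n'}. b l * grad (h l) j)) \<in> P1.R"
proof -
  obtain q d where q: "q \<in> mpolys n" "corr q p'" "\<And>l. corr (d l) (mp_pderiv l p')"
    "(\<lambda>j. grad q j - (\<Sum>l\<in>{1..n'}. d l * grad (h l) j)) \<in> P1.R"
    using chain_rule_ex[OF h p(2)] by blast
  have "P1.\<pi> (b l - d l) = \<zero>\<^bsub>P1.A\<^esub>" if "l \<in> {1..n'}" for l
    using corr_inj[OF b[OF that] q(3)] by (simp add: P1.hom_eq_iff)
  then have d: "P1.\<pi> (\<Sum>l\<in>{1..n'}. (b l - d l) * grad (h l) j) = \<zero>\<^bsub>P1.A\<^esub>" for j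
    by (intro P1.hom_sum_0) (simp add: P1.hom_times)
  have *: "(\<lambda>j. (grad p j - grad q j) + (grad q j - (\<Sum>l\<in>{1..n'}. d l * grad (h l) j))) \<in> P1.R"
    by (intro vclosed_add[OF P1.vclosed_relvecs] q(4) P1.relvecs_grad_diff p(1) q(1) corr_inj[OF p(3) q(2)])
  show ?thesis
  proof (rule P1.relvecs_cong[OF *])
    fix j
    show "P1.\<pi> (grad p j - grad q j + (grad q j - (\<Sum>l\<in>{1..n'}. d l * grad (h l) j))) =
        P1.\<pi> (grad p j - (\<Sum>l\<in>{1..n'}. b l * grad (h l) j))"
      using d[of j] by (subst P1.hom_eq_iff) (simp add: algebra_simps sum_subtractf)
  qed
qed

text \<open>Substituting the differential of \<open>h l\<close> for that of the \<open>l\<close>-th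
  new variable takes relations to relations. It suffices to treat the spanning vectors, namely
  gradients of elements of \<open>I'\<close>, by the chain rule, and vectors that vanish modulo
  \<open>I'\<close>.\<close>

lemma relvecs_pull:
  assumes h: "\<And>l. l \<in> {1..n'} \<Longrightarrow> h l \<in> mpolys n \<and> corr (h l) (mp_var l)"
    and "r' \<in> R'" and a: "\<And>l. l \<in> {1..n'} \<Longrightarrow> corr (a l) (r' l)"
  shows "(\<lambda>j. \<Sum>l\<in>{1..n'}. a l * grad (h l) j) \<in> P1.R"
  using assms(2) a unfolding relvecs_def[of n']
proof (induction arbitrary: a)
  case zero
  then have "P1.\<pi> (a l) = \<zero>\<^bsub>P1.A\<^esub>" if "l \<in> {1..n'}" for l
    using that by (intro corr_zero[of _ 0]) (simp_all add: P2.hom_0)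
  then show ?case by (intro P1.relvecs_zero P1.hom_sum_0) (simp add: P1.hom_times)
next
  case (lin x y c)
  have "\<exists>p. corr p p'" for p' using corr_surj by blast
  then obtain lift where lift: "\<And>p'. corr (lift p') p'" by metis
  have x: "(\<lambda>j. \<Sum>l\<in>{1..n'}. lift (x l) * grad (h l) j) \<in> P1.R"
  proof (cases "x \<in> grad ` I'")
    case True
    then obtain p' where p': "x = grad p'" "p' \<in> I'" by blast
    \<comment> \<open>As \<open>p'\<close> is zero in the second ring, the zero polynomial is a lift
      of it; the chain rule then yields the negative of the vector in question.\<close>
    have "corr 0 p'"
      using P2.proj_eq_0_iff[OF P2.I_mpolys[OF p'(2)]] p'(2) by (simp add: C.hom_0)
    then have "(\<lambda>j. grad 0 j - (\<Sum>l\<in>{1..n'}. lift (x l) * grad (h l) j)) \<in> P1.R"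
      by (intro chain_rule[OF h _ P2.I_mpolys[OF p'(2)]]) (simp_all add: p' grad_def lift)
    then show ?thesis
      using vclosed_smult[OF P1.vclosed_relvecs, of _ "-1"] by (fastforce simp: grad_def)
  next
    case False
    then have "\<pi>' (x l) = \<zero>\<^bsub>A'\<^esub>" if "l \<in> {1..n'}" for l using lin.hyps that by blast
    then have "P1.\<pi> (lift (x l)) = \<zero>\<^bsub>P1.A\<^esub>" if "l \<in> {1..n'}" for l
      using that by (intro corr_zero[OF lift])
    then show ?thesis by (intro P1.relvecs_zero P1.hom_sum_0) (simp add: P1.hom_times)
  qed
  have y: "(\<lambda>j. \<Sum>l\<in>{1..n'}. lift (y l) * grad (h l) j) \<in> P1.R"
    by (rule lin.IH) (rule lift)
  have *: "(\<lambda>j. lift c * (\<Sum>l\<in>{1..n'}. lift (x l) * grad (h l) j) +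
      (\<Sum>l\<in>{1..n'}. lift (y l) * grad (h l) j)) \<in> P1.R"
    by (rule vclosed_lin[OF P1.vclosed_relvecs x y])
  show ?case
  proof (rule P1.relvecs_cong[OF *])
    fix j
    have "P1.\<pi> (lift c * lift (x l) + lift (y l) - a l) = \<zero>\<^bsub>P1.A\<^esub>" if "l \<in> {1..n'}" for l
      using corr_inj[OF corr_add[OF corr_mult[OF lift lift] lift] lin.prems[OF that]]
      by (simp add: P1.hom_eq_iff)
    then have "P1.\<pi> (\<Sum>l\<in>{1..n'}. (lift c * lift (x l) + lift (y l) - a l) * grad (h l) j) = \<zero>\<^bsub>P1.A\<^esub>"
      by (intro P1.hom_sum_0) (simp add: P1.hom_times)
    then show "P1.\<pi> (lift c * (\<Sum>l\<in>{1..n'}. lift (x l) * grad (h l) j) +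
        (\<Sum>l\<in>{1..n'}. lift (y l) * grad (h l) j)) = P1.\<pi> (\<Sum>l\<in>{1..n'}. a l * grad (h l) j)"
      by (subst P1.hom_eq_iff) (simp add: algebra_simps sum_subtractf sum.distrib sum_distrib_left)
  qed
qed

text \<open>Pull the given relation back along the inverse isomorphism. The result is
  \<open>a'\<close> times the product of the two Jacobi matrices of the changes of variables, and by
  the chain rule for the new variables this product is the identity modulo relations.\<close>

lemma relvecs_push:
  assumes h: "\<And>l. l \<in> {1..n'} \<Longrightarrow> h l \<in> mpolys n \<and> corr (h l) (mp_var l)"
    and a: "(\<lambda>j. \<Sum>l\<in>{1..n'}. a l * grad (h l) j) \<in> P1.R"
    and a': "\<And>l. l \<in> {1..n'} \<Longrightarrow> corr (a l) (a' l)"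
  shows "a' \<in> R'"
proof -
  interpret F: presentation_iso n' I' n I "inv_into (carrier P1.A) \<sigma>" by (rule flip)
  have "\<forall>j. \<exists>q. q \<in> mpolys n' \<and> F.corr q (mp_var j)" using F.corr_surj by blast
  from choice[OF this] obtain g where "\<forall>j. g j \<in> mpolys n' \<and> F.corr (g j) (mp_var j)" by blast
  then have g: "\<And>j. j \<in> {1..n} \<Longrightarrow> g j \<in> mpolys n' \<and> F.corr (g j) (mp_var j)" by blast
  obtain d where d: "\<And>p. corr p (d p)" using corr_total by metis
  have "(\<lambda>i. \<Sum>j\<in>{1..n}. (\<Sum>l\<in>{1..n'}. a' l * d (grad (h l) j)) * grad (g j) i) \<in> R'"
    by (rule F.relvecs_pull[OF g a], assumption) (unfold flip_corr, intro corr_sum corr_mult a' d)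
  moreover have "(\<lambda>i. grad (mp_var l) i - (\<Sum>j\<in>{1..n}. d (grad (h l) j) * grad (g j) i)) \<in> R'"
    if "l \<in> {1..n'}" for l
    using h[OF that] that d
    by (intro F.chain_rule[OF g, where p' = "h l"]) (simp_all add: flip_corr mpolys_var grad_def)
  then have "(\<lambda>i. \<Sum>l\<in>{1..n'}. a' l * (grad (mp_var l) i - (\<Sum>j\<in>{1..n}. d (grad (h l) j) * grad (g j) i))) \<in> R'"
    by (intro vclosed_sum[OF P2.vclosed_relvecs])
  ultimately have *: "(\<lambda>i. (\<Sum>j\<in>{1..n}. (\<Sum>l\<in>{1..n'}. a' l * d (grad (h l) j)) * grad (g j) i) +
      (\<Sum>l\<in>{1..n'}. a' l * (grad (mp_var l) i - (\<Sum>j\<in>{1..n}. d (grad (h l) j) * grad (g j) i)))) \<in> R'"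
    by (rule vclosed_add[OF P2.vclosed_relvecs])
  show ?thesis
  proof (rule P2.relvecs_cong[OF *], rule arg_cong[of _ _ \<pi>'])
    fix i assume i: "i \<in> {1..n'}"
    have "(\<Sum>j\<in>{1..n}. (\<Sum>l\<in>{1..n'}. a' l * d (grad (h l) j)) * grad (g j) i) =
        (\<Sum>l\<in>{1..n'}. a' l * (\<Sum>j\<in>{1..n}. d (grad (h l) j) * grad (g j) i))"
      by (simp add: sum_distrib_left sum_distrib_right mult.assoc) (rule sum.swap)
    moreover have "(\<Sum>l\<in>{1..n'}. a' l * grad (mp_var l) i) = a' i"
      using i by (simp add: grad_def mp_pderiv_var if_distrib[of "\<lambda>x. _ * x"] sum.delta' cong: if_cong)
    ultimately show "(\<Sum>j\<in>{1..n}. (\<Sum>l\<in>{1..n'}. a' l * d (grad (h l) j)) * grad (g j) i) +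
      (\<Sum>l\<in>{1..n'}. a' l * (grad (mp_var l) i - (\<Sum>j\<in>{1..n}. d (grad (h l) j) * grad (g j) i))) = a' i"
      by (simp add: right_diff_distrib sum_subtractf)
  qed
qed

section \<open>Comparison through the union of both systems of generators\<close>

definition new_gens :: "nat \<Rightarrow> 'k mpoly" where
  "new_gens = (SOME h. \<forall>l. h l \<in> mpolys n \<and> corr (h l) (mp_var l))"

lemma new_gens: "new_gens l \<in> mpolys n \<and> corr (new_gens l) (mp_var l)"
proof -
  have "\<forall>l. \<exists>q. q \<in> mpolys n \<and> corr q (mp_var l)" using corr_surj by blast
  from choice[OF this] show ?thesis unfolding new_gens_def by (rule someI2_ex) blast
qed

text \<open>The differentials, in terms of \<open>dx\<^sub>1,\<dots>,dx\<^sub>n\<close>, of the joint generators of \<open>A\<close>: those of the first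
  presentation, followed by the images of those of the second one.\<close>

definition joint_grad :: "nat \<Rightarrow> nat \<Rightarrow> 'k mpoly" where
  "joint_grad c = (if c \<le> n then grad (mp_var c) else grad (new_gens (c - n)))"

abbreviation "rels C \<equiv> vrel joint_grad P1.R C"

lemma sum_joint_old: "(\<Sum>c\<in>{1..n}. a c * joint_grad c i) = (if i \<in> {1..n} then a i else 0)"
  by (simp add: joint_grad_def grad_def mp_pderiv_var if_distrib[of "\<lambda>x. _ * x"] sum.delta' cong: if_cong)

lemma sum_joint_new:
  "(\<Sum>c\<in>{n + 1..n + n'}. a c * joint_grad c i) = (\<Sum>l\<in>{1..n'}. a (n + l) * grad (new_gens l) i)"
  by (rule sum.reindex_bij_witness[where i = "\<lambda>l. n + l" and j = "\<lambda>c. c - n"]) (auto simp: joint_grad_def)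

lemma rels_old: "rels {1..n} = P1.R"
proof -
  have "(\<lambda>i. if i \<in> {1..n} then a i else 0) \<in> P1.R \<longleftrightarrow> a \<in> P1.R" for a
    by (auto elim!: P1.relvecs_cong)
  then show ?thesis by (simp add: vrel_def sum_joint_old)
qed

lemma union_cols: "{1..n} \<union> {n + 1..n + n'} = {1..n + n'}" "{n + 1..n + n'} \<union> {1..n} = {1..n + n'}"
  by auto

lemma extend_old:
  assumes "\<phi> \<in> det_span s l {1..n} P1.R"
  shows "\<exists>\<psi>\<in>det_span (s + n') l {1..n + n'} (rels {1..n + n'}).
    \<forall>vs. (\<forall>u. \<forall>c\<in>{n + 1..n + n'}. vs u c = 0) \<longrightarrow> \<psi> vs = \<phi> vs"
proof -
  \<comment> \<open>For \<open>c\<close> in \<open>{1..n}\<close> the vectors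
    \<open>joint_grad c\<close> are unit vectors, so the coordinates of a vector are its
    coefficients.\<close>
  have "\<exists>h. (\<lambda>i. joint_grad e i - (\<Sum>c\<in>{1..n}. h c * joint_grad c i)) \<in> P1.R" for e
    by (intro exI[of _ "joint_grad e"] P1.relvecs_zero) (simp add: sum_joint_old P1.hom_0)
  from det_span_extend(2)[of "{1..n}" "{n + 1..n + n'}", OF _ _ _ P1.vclosed_relvecs this]
  show ?thesis using assms by (simp add: rels_old union_cols)
qed

lemma restrict_new:
  assumes "\<psi> \<in> det_span (s' + n) l {1..n + n'} (rels {1..n + n'})"
  shows "\<exists>\<phi>'\<in>det_span s' l {1..n'} R'. \<forall>vs vs'.
    (\<forall>u. \<forall>c\<in>{1..n}. vs u c = 0) \<longrightarrow> (\<forall>u. \<forall>l\<in>{1..n'}. corr (vs u (n + l)) (vs' u l)) \<longrightarrow> corr (\<psi> vs) (\<phi>' vs')"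
proof -
  have "\<exists>h. (\<lambda>i. joint_grad e i - (\<Sum>c\<in>{n + 1..n + n'}. h c * joint_grad c i)) \<in> P1.R"
    if e: "e \<in> {1..n}" for e
  proof -
    interpret F: presentation_iso n' I' n I "inv_into (carrier P1.A) \<sigma>" by (rule flip)
    obtain g where g: "g \<in> mpolys n'" "corr (mp_var e) g" using F.corr_surj[of "mp_var e"] flip_corr by blast
    have "\<forall>l. \<exists>b. corr b (mp_pderiv l g)" using corr_surj by blast
    then obtain b where b: "\<And>l. corr (b l) (mp_pderiv l g)" by metis
    have "(\<lambda>i. grad (mp_var e) i - (\<Sum>l\<in>{1..n'}. b l * grad (new_gens l) i)) \<in> P1.R"
      by (rule chain_rule[OF new_gens mpolys_var[OF e] g b])
    then show ?thesis
      using e by (intro exI[of _ "\<lambda>c. b (c - n)"], unfold sum_joint_new) (simp add: joint_grad_def)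
  qed
  from det_span_extend(1)[of "{n + 1..n + n'}" "{1..n}", OF _ _ _ P1.vclosed_relvecs this, of \<psi> s' l]
  have "\<exists>\<phi>\<in>det_span s' l {n + 1..n + n'} (rels {n + 1..n + n'}).
      \<forall>vs. (\<forall>u. \<forall>c\<in>{1..n}. vs u c = 0) \<longrightarrow> \<psi> vs = \<phi> vs"
    using assms by (simp add: union_cols)
  then obtain \<phi> where \<phi>: "\<phi> \<in> det_span s' l {n + 1..n + n'} (rels {n + 1..n + n'})"
    "\<And>vs. \<forall>u. \<forall>c\<in>{1..n}. vs u c = 0 \<Longrightarrow> \<psi> vs = \<phi> vs"
    by blast
  have rows: "\<exists>r'\<in>R'. \<forall>c\<in>{n + 1..n + n'}. corr (r c) (r' (c - n))"
    if r: "r \<in> rels {n + 1..n + n'}" for r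
  proof -
    have "\<forall>l. \<exists>x. corr (r (n + l)) x" using corr_total by blast
    then obtain r' where r': "\<And>l. corr (r (n + l)) (r' l)" by metis
    have "r' \<in> R'"
      by (rule relvecs_push[OF new_gens, where a = "\<lambda>l. r (n + l)"]) (use r r' in \<open>simp_all add: vrel_def sum_joint_new\<close>)
    moreover have "corr (r c) (r' (c - n))" if "c \<in> {n + 1..n + n'}" for c
      using r'[of "c - n"] that by simp
    ultimately show ?thesis by blast
  qed
  have "\<exists>\<phi>'\<in>det_span s' l {1..n'} R'. \<forall>vs vs'.
      (\<forall>u. \<forall>c\<in>{n + 1..n + n'}. corr (vs u c) (vs' u (c - n))) \<longrightarrow> corr (\<phi> vs) (\<phi>' vs')"
    by (rule corr_det_span[OF rows _ \<phi>(1)]) auto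
  then obtain \<phi>' where \<phi>': "\<phi>' \<in> det_span s' l {1..n'} R'"
    "\<And>vs vs'. \<forall>u. \<forall>c\<in>{n + 1..n + n'}. corr (vs u c) (vs' u (c - n)) \<Longrightarrow> corr (\<phi> vs) (\<phi>' vs')"
    by blast
  have "corr (\<psi> vs) (\<phi>' vs')"
    if "\<forall>u. \<forall>c\<in>{1..n}. vs u c = 0" "\<forall>u. \<forall>l\<in>{1..n'}. corr (vs u (n + l)) (vs' u l)" for vs vs'
  proof -
    have "corr (vs u c) (vs' u (c - n))" if c: "c \<in> {n + 1..n + n'}" for u c
    proof -
      have "n + (c - n) = c" "c - n \<in> {1..n'}" using c by auto
      then show ?thesis using \<open>\<forall>u. \<forall>l\<in>{1..n'}. corr (vs u (n + l)) (vs' u l)\<close> by metis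
    qed
    then show ?thesis using \<phi>'(2)[of vs vs'] \<phi>(2)[OF that(1)] by simp
  qed
  then show ?thesis using \<phi>'(1) by blast
qed

text \<open>Enlarging by \<open>n'\<close> columns and then dropping \<open>n\<close> columns
  changes the size from \<open>s\<close> to \<open>s'\<close>; both \<open>s + n'\<close> and
  \<open>s' + n\<close> are the size used for the union.\<close>

lemma det_values_corr:
  assumes "s + n' = s' + n" "x \<in> det_values s {1..n} P1.R"
  shows "\<exists>x'\<in>det_values s' {1..n'} R'. corr x x'"
proof -
  obtain \<phi> where \<phi>: "\<phi> \<in> det_span s 0 {1..n} P1.R" "x = \<phi> (\<lambda>_ _. 0)"
    using assms(2) by (auto simp: det_values_def)
  obtain \<psi> where \<psi>: "\<psi> \<in> det_span (s' + n) 0 {1..n + n'} (rels {1..n + n'})" "\<psi> (\<lambda>_ _. 0) = x"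
    using extend_old[OF \<phi>(1)] \<phi>(2) assms(1) by auto
  obtain \<phi>' where \<phi>': "\<phi>' \<in> det_span s' 0 {1..n'} R'"
    "\<And>vs vs'. \<forall>u. \<forall>c\<in>{1..n}. vs u c = 0 \<Longrightarrow> \<forall>u. \<forall>l\<in>{1..n'}. corr (vs u (n + l)) (vs' u l) \<Longrightarrow>
      corr (\<psi> vs) (\<phi>' vs')"
    using restrict_new[OF \<psi>(1)] by blast
  have "corr x (\<phi>' (\<lambda>_ _. 0))"
    using \<phi>'(2)[of "\<lambda>_ _. 0" "\<lambda>_ _. 0"] \<psi>(2) corr_0 by simp
  then show ?thesis unfolding det_values_def using \<phi>'(1) by blast
qed

lemma jac_ideal_image_subset:
  assumes "s + n' = s' + n"
  shows "\<sigma> ` P1.jac_ideal s \<subseteq> P2.jac_ideal s'"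
  unfolding P1.jac_ideal_def P2.jac_ideal_def using det_values_corr[OF assms] by fastforce

text \<open>The functional \<open>\<psi>\<close> of the union agrees with \<open>\<phi>\<close> on
  vectors in the old columns and corresponds to \<open>\<phi>'\<close> on vectors in the new ones.
  Its values at the two gradients of the same element differ by its value at the relation
  \<open>w\<close>, which lies in the next Jacobian ideal.\<close>

lemma fun_derivation_corr:
  assumes s: "s + n' = s' + n" and \<phi>: "\<phi> \<in> det_span s 1 {1..n} P1.R"
  shows "\<exists>\<phi>'\<in>det_span s' 1 {1..n'} R'. \<forall>p\<in>mpolys n. \<forall>p'\<in>mpolys n'. corr p p' \<longrightarrow>
    \<sigma> (P1.\<pi> (\<phi> (\<lambda>_. grad p))) \<ominus>\<^bsub>A'\<^esub> \<pi>' (\<phi>' (\<lambda>_. grad p')) \<in> P2.jac_ideal (Suc s')"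
proof -
  obtain \<psi> where \<psi>: "\<psi> \<in> det_span (s' + n) 1 {1..n + n'} (rels {1..n + n'})"
    "\<And>vs. \<forall>u. \<forall>c\<in>{n + 1..n + n'}. vs u c = 0 \<Longrightarrow> \<psi> vs = \<phi> vs"
    using extend_old[OF \<phi>] s by auto
  obtain \<phi>' where \<phi>': "\<phi>' \<in> det_span s' 1 {1..n'} R'"
    "\<And>vs vs'. \<forall>u. \<forall>c\<in>{1..n}. vs u c = 0 \<Longrightarrow> \<forall>u. \<forall>l\<in>{1..n'}. corr (vs u (n + l)) (vs' u l) \<Longrightarrow>
      corr (\<psi> vs) (\<phi>' vs')"
    using restrict_new[OF \<psi>(1)] by blast
  have "\<sigma> (P1.\<pi> (\<phi> (\<lambda>_. grad p))) \<ominus>\<^bsub>A'\<^esub> \<pi>' (\<phi>' (\<lambda>_. grad p')) \<in> P2.jac_ideal (Suc s')"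
    if p: "p \<in> mpolys n" "p' \<in> mpolys n'" "corr p p'" for p p'
  proof -
    have "\<forall>l. \<exists>b. corr b (mp_pderiv l p')" using corr_surj by blast
    then obtain b where b: "\<And>l. corr (b l) (mp_pderiv l p')" by metis
    \<comment> \<open>The lifted gradient of \<open>p'\<close>, placed in the new columns.
      Subtracting it from \<open>grad p\<close> gives the vector \<open>w\<close>, which the chain
      rule identifies as a relation of the union.\<close>
    define v where "v = (\<lambda>c. if c \<le> n then 0 else b (c - n))"
    define w where "w = (\<lambda>c. (-1) * v c + grad p c)"
    have grad0: "grad p c = 0" if "c \<notin> {1..n}" for c
      unfolding grad_def by (rule mp_pderiv_outside[OF p(1) that])
    have "(\<Sum>c\<in>{1..n + n'}. w c * joint_grad c i) = grad p i - (\<Sum>l\<in>{1..n'}. b l * grad (new_gens l) i)" for i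
    proof -
      have "(\<Sum>c\<in>{1..n + n'}. w c * joint_grad c i) =
          (\<Sum>c\<in>{1..n}. w c * joint_grad c i) + (\<Sum>c\<in>{n + 1..n + n'}. w c * joint_grad c i)"
        by (subst union_cols(1)[symmetric], rule sum.union_disjoint) auto
      also have "(\<Sum>c\<in>{1..n}. w c * joint_grad c i) = grad p i"
        unfolding sum_joint_old using grad0 by (auto simp: w_def v_def)
      also have "(\<Sum>c\<in>{n + 1..n + n'}. w c * joint_grad c i) = - (\<Sum>l\<in>{1..n'}. b l * grad (new_gens l) i)"
        unfolding sum_joint_new sum_negf[symmetric] using grad0
        by (intro sum.cong) (auto simp: w_def v_def)
      finally show ?thesis by simp
    qed
    then have "w \<in> rels {1..n + n'}"
      using chain_rule[OF new_gens p b] by (simp add: vrel_def)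
    \<comment> \<open>Being a relation, \<open>w\<close> serves as an additional row. The size
      becomes \<open>Suc s + n' = Suc s' + n\<close>, so dropping the old columns leads to minors of
      size \<open>Suc s'\<close>.\<close>
    then have "\<psi> (\<lambda>_. w) \<in> det_values (Suc s + n') {1..n + n'} (rels {1..n + n'})"
      using det_values_apply[OF \<psi>(1)] s by simp
    then obtain \<chi> where \<chi>: "\<chi> \<in> det_span (Suc s' + n) 0 {1..n + n'} (rels {1..n + n'})" "\<psi> (\<lambda>_. w) = \<chi> (\<lambda>_ _. 0)"
      using s by (auto simp: det_values_def)
    obtain \<chi>' where \<chi>': "\<chi>' \<in> det_span (Suc s') 0 {1..n'} R'"
      "\<And>vs vs'. \<forall>u. \<forall>c\<in>{1..n}. vs u c = 0 \<Longrightarrow> \<forall>u. \<forall>l\<in>{1..n'}. corr (vs u (n + l)) (vs' u l) \<Longrightarrow>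
        corr (\<chi> vs) (\<chi>' vs')"
      using restrict_new[OF \<chi>(1)] by blast
    have "corr (\<psi> (\<lambda>_. w)) (\<chi>' (\<lambda>_ _. 0))"
      using \<chi>'(2)[of "\<lambda>_ _. 0" "\<lambda>_ _. 0"] \<chi>(2) corr_0 by simp
    then have mem: "\<sigma> (P1.\<pi> (\<psi> (\<lambda>_. w))) \<in> P2.jac_ideal (Suc s')"
      unfolding P2.jac_ideal_def det_values_def using \<chi>'(1) by auto
    have "\<psi> (\<lambda>_. w) = (-1) * \<psi> (\<lambda>_. v) + \<psi> (\<lambda>_. grad p)"
      unfolding w_def by (rule det_span_add[OF \<psi>(1)])
    also have "\<psi> (\<lambda>_. grad p) = \<phi> (\<lambda>_. grad p)"
      using grad0 by (intro \<psi>(2)) auto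
    finally have "\<psi> (\<lambda>_. w) = \<phi> (\<lambda>_. grad p) - \<psi> (\<lambda>_. v)" by simp
    moreover have "corr (\<psi> (\<lambda>_. v)) (\<phi>' (\<lambda>_. grad p'))"
      using b by (intro \<phi>'(2)) (auto simp: v_def grad_def)
    ultimately show ?thesis using mem by (simp add: C.hom_diff)
  qed
  then show ?thesis using \<phi>'(1) by blast
qed

end

context presentation_iso
begin

lemma jac_ideal_image:
  assumes "s + n' = s' + n"
  shows "\<sigma> ` P1.jac_ideal s = P2.jac_ideal s'"
proof
  interpret F: presentation_iso n' I' n I "inv_into (carrier P1.A) \<sigma>" by (rule flip)
  have sub: "P2.jac_ideal s' \<subseteq> carrier A'" by (auto simp: P2.jac_ideal_def)
  show "P2.jac_ideal s' \<subseteq> \<sigma> ` P1.jac_ideal s"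
  proof
    fix y assume y: "y \<in> P2.jac_ideal s'"
    then have "\<sigma> (inv_into (carrier P1.A) \<sigma> y) = y"
      using sub bij_betw_inv_into_right[OF iso_bij] by blast
    moreover have "inv_into (carrier P1.A) \<sigma> y \<in> P1.jac_ideal s"
      using F.jac_ideal_image_subset[OF assms[symmetric]] y by blast
    ultimately show "y \<in> \<sigma> ` P1.jac_ideal s" by (metis imageI)
  qed
qed (rule jac_ideal_image_subset[OF assms])

text \<open>If the inequality failed, the non-zero ideal at the second rank would be the image of an
  ideal of the first presentation beyond its rank, which is zero. Used in both directions, this
  makes the difference of the number of variables and the rank an invariant.\<close>

lemma jacobi_rank_le:
  assumes "generates n I m f" "generates n' I' m' f'"
  shows "jacobi_rank n' I' m' f' + n \<le> jacobi_rank n I m f + n'"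
proof (rule ccontr)
  assume less: "\<not> ?thesis"
  define r' where "r' = jacobi_rank n' I' m' f'"
  \<comment> \<open>The subtraction is not truncated: the negated inequality gives
    \<open>r' + n > n'\<close>.\<close>
  define s where "s = r' + n - n'"
  have s: "s + n' = r' + n" "jacobi_rank n I m f < s" using less by (simp_all add: s_def r'_def)
  have "\<sigma> ` P1.jac_ideal s = {\<zero>\<^bsub>A'\<^esub>}"
    using P1.jacobi_rank_det_values(1)[OF assms(1) s(2)] C.hom_0 by (simp add: P1.jac_ideal_def P1.hom_0)
  then have "P2.jac_ideal r' = {\<zero>\<^bsub>A'\<^esub>}" using jac_ideal_image[OF s(1)] by simp
  then show False
    using P2.jacobi_rank_det_values(2)[OF assms(2)] by (simp add: P2.jac_ideal_def r'_def)
qed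

section \<open>Transport of the factor ring and of the derivations\<close>

context
  fixes s s' :: nat
  assumes s: "s + n' = s' + n"
begin

abbreviation "a \<equiv> P1.jac_ideal (Suc s)"
abbreviation "a' \<equiv> P2.jac_ideal (Suc s')"

lemma image_coset:
  assumes "x \<in> carrier P1.A"
  shows "\<sigma> ` (a +>\<^bsub>P1.A\<^esub> x) = a' +>\<^bsub>A'\<^esub> \<sigma> x"
proof -
  have "Suc s + n' = Suc s' + n" using s by simp
  then have a': "a' = \<sigma> ` a" by (rule jac_ideal_image[symmetric])
  have "a \<subseteq> carrier P1.A" by (auto simp: P1.jac_ideal_def)
  then have "\<sigma> (h \<oplus>\<^bsub>P1.A\<^esub> x) = \<sigma> h \<oplus>\<^bsub>A'\<^esub> \<sigma> x" if "h \<in> a" for h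
    using that assms by (intro iso_plus) auto
  then show ?thesis unfolding a' a_r_coset_def' by auto
qed

text \<open>Elements of the factor rings are cosets, that is, sets, so the induced isomorphism is
  simply the direct image under \<open>\<sigma>\<close>.\<close>

lemma ring_iso_image: "(\<lambda>X. \<sigma> ` X) \<in> ring_iso (P1.A Quot a) (A' Quot a')"
proof -
  interpret Q1: type_hom "P1.A Quot a" "\<lambda>x. a +>\<^bsub>P1.A\<^esub> P1.\<pi> x"
    by (rule P1.type_hom_quot[OF P1.ideal_jac_ideal])
  interpret Q2: type_hom "A' Quot a'" "\<lambda>x. a' +>\<^bsub>A'\<^esub> \<sigma> (P1.\<pi> x)"
    by (rule C.type_hom_quot[OF P2.ideal_jac_ideal])
  have ex: "\<exists>x. X = a +>\<^bsub>P1.A\<^esub> P1.\<pi> x" if "X \<in> carrier (P1.A Quot a)" for X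
  proof -
    obtain y where "y \<in> carrier P1.A" "X = a +>\<^bsub>P1.A\<^esub> y"
      using \<open>X \<in> _\<close> unfolding FactRing_def A_RCOSETS_def' by auto
    then show ?thesis using P1.hom_surj by metis
  qed
  have img: "\<sigma> ` (a +>\<^bsub>P1.A\<^esub> P1.\<pi> x) = a' +>\<^bsub>A'\<^esub> \<sigma> (P1.\<pi> x)" for x
    by (rule image_coset) simp
  show ?thesis
  proof (rule ring_iso_memI)
    fix X Y assume "X \<in> carrier (P1.A Quot a)" "Y \<in> carrier (P1.A Quot a)"
    then obtain x y where X: "X = a +>\<^bsub>P1.A\<^esub> P1.\<pi> x" and Y: "Y = a +>\<^bsub>P1.A\<^esub> P1.\<pi> y" using ex by metis
    show "\<sigma> ` X \<in> carrier (A' Quot a')" unfolding X img by (rule Q2.hom_closed)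
    show "\<sigma> ` (X \<otimes>\<^bsub>P1.A Quot a\<^esub> Y) = \<sigma> ` X \<otimes>\<^bsub>A' Quot a'\<^esub> \<sigma> ` Y"
      unfolding X Y Q1.hom_times[symmetric] img by (rule Q2.hom_times)
    show "\<sigma> ` (X \<oplus>\<^bsub>P1.A Quot a\<^esub> Y) = \<sigma> ` X \<oplus>\<^bsub>A' Quot a'\<^esub> \<sigma> ` Y"
      unfolding X Y Q1.hom_plus[symmetric] img by (rule Q2.hom_plus)
  next
    show "\<sigma> ` \<one>\<^bsub>P1.A Quot a\<^esub> = \<one>\<^bsub>A' Quot a'\<^esub>"
      unfolding Q1.hom_1[symmetric] img by (rule Q2.hom_1)
    show "bij_betw ((`) \<sigma>) (carrier (P1.A Quot a)) (carrier (A' Quot a'))"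
      unfolding bij_betw_def
    proof
      have sub: "X \<subseteq> carrier P1.A" if "X \<in> carrier (P1.A Quot a)" for X
      proof -
        have "a \<subseteq> carrier P1.A" by (auto simp: P1.jac_ideal_def)
        then show ?thesis
          using ex[OF that] P1.a_r_coset_subset_G[OF _ P1.hom_closed] by blast
      qed
      show "inj_on ((`) \<sigma>) (carrier (P1.A Quot a))"
      proof (rule inj_onI)
        fix X Y assume "X \<in> carrier (P1.A Quot a)" "Y \<in> carrier (P1.A Quot a)" and eq: "\<sigma> ` X = \<sigma> ` Y"
        from inj_on_image_eq_iff[OF bij_betw_imp_inj_on[OF iso_bij] sub[OF this(1)] sub[OF this(2)]] eq
        show "X = Y" by (rule iffD1)
      qed
      show "(`) \<sigma> ` carrier (P1.A Quot a) = carrier (A' Quot a')"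
      proof
        show "(`) \<sigma> ` carrier (P1.A Quot a) \<subseteq> carrier (A' Quot a')"
          using ex img Q2.hom_closed by (metis (no_types, lifting) image_subsetI)
        show "carrier (A' Quot a') \<subseteq> (`) \<sigma> ` carrier (P1.A Quot a)"
        proof
          fix Y assume "Y \<in> carrier (A' Quot a')"
          then obtain y where "y \<in> carrier A'" and Y: "Y = a' +>\<^bsub>A'\<^esub> y"
            unfolding FactRing_def A_RCOSETS_def' by auto
          then obtain x where "\<sigma> (P1.\<pi> x) = y" using P2.hom_surj corr_surj by metis
          then have "Y = \<sigma> ` (a +>\<^bsub>P1.A\<^esub> P1.\<pi> x)" unfolding Y img by simp
          then show "Y \<in> (`) \<sigma> ` carrier (P1.A Quot a)" using Q1.hom_closed by blast
        qed
      qed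
    qed
  qed
qed

lemma conjugate_fun_derivation:
  assumes \<phi>: "\<phi> \<in> det_span s 1 {1..n} P1.R" and \<phi>': "\<phi>' \<in> det_span s' 1 {1..n'} R'"
    and eq: "\<And>p p'. p \<in> mpolys n \<Longrightarrow> p' \<in> mpolys n' \<Longrightarrow> corr p p' \<Longrightarrow>
      a' +>\<^bsub>A'\<^esub> \<sigma> (P1.\<pi> (\<phi> (\<lambda>_. grad p))) = a' +>\<^bsub>A'\<^esub> \<pi>' (\<phi>' (\<lambda>_. grad p'))"
  shows "(\<lambda>y\<in>carrier A'. \<sigma> ` fun_derivation n I a \<phi> (inv_into (carrier P1.A) \<sigma> y)) =
    fun_derivation n' I' a' \<phi>'"
proof
  fix y
  show "(\<lambda>y\<in>carrier A'. \<sigma> ` fun_derivation n I a \<phi> (inv_into (carrier P1.A) \<sigma> y)) y =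
    fun_derivation n' I' a' \<phi>' y"
  proof (cases "y \<in> carrier A'")
    case True
    then obtain p' where p': "p' \<in> mpolys n'" "\<pi>' p' = y" using P2.repr by metis
    obtain p where p: "p \<in> mpolys n" "corr p p'" using corr_surj by blast
    have inv: "inv_into (carrier P1.A) \<sigma> y = P1.\<pi> p" unfolding p'(2)[symmetric] flip_corr by (rule p(2))
    have "\<sigma> ` fun_derivation n I a \<phi> (inv_into (carrier P1.A) \<sigma> y) =
        a' +>\<^bsub>A'\<^esub> \<sigma> (P1.\<pi> (\<phi> (\<lambda>_. grad p)))"
      unfolding inv P1.fun_derivation_proj[OF \<phi> p(1)] by (rule image_coset) simp
    also have "\<dots> = fun_derivation n' I' a' \<phi>' y"
      unfolding eq[OF p(1) p'(1) p(2)] p'(2)[symmetric] P2.fun_derivation_proj[OF \<phi>' p'(1)] ..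
    finally show ?thesis using True by simp
  qed (simp add: fun_derivation_def)
qed

text \<open>For each functional on one side there is one on the other with congruent values, in
  either direction. Conjugation therefore maps one set of derivations onto the other, not merely
  into it.\<close>

lemma conjugate_fun_derivations:
  "(\<lambda>D. \<lambda>y\<in>carrier A'. \<sigma> ` D (inv_into (carrier P1.A) \<sigma> y)) `
      (fun_derivation n I a ` det_span s 1 {1..n} P1.R) =
    fun_derivation n' I' a' ` det_span s' 1 {1..n'} R'"
proof (rule equalityI; rule subsetI)
  fix D' assume "D' \<in> (\<lambda>D. \<lambda>y\<in>carrier A'. \<sigma> ` D (inv_into (carrier P1.A) \<sigma> y)) `
      (fun_derivation n I a ` det_span s 1 {1..n} P1.R)"
  then obtain \<phi> where \<phi>: "\<phi> \<in> det_span s 1 {1..n} P1.R"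
    and D': "D' = (\<lambda>y\<in>carrier A'. \<sigma> ` fun_derivation n I a \<phi> (inv_into (carrier P1.A) \<sigma> y))" by blast
  obtain \<phi>' where \<phi>': "\<phi>' \<in> det_span s' 1 {1..n'} R'" and
    mem: "\<And>p p'. p \<in> mpolys n \<Longrightarrow> p' \<in> mpolys n' \<Longrightarrow> corr p p' \<Longrightarrow>
      \<sigma> (P1.\<pi> (\<phi> (\<lambda>_. grad p))) \<ominus>\<^bsub>A'\<^esub> \<pi>' (\<phi>' (\<lambda>_. grad p')) \<in> a'"
    using fun_derivation_corr[OF s \<phi>] by blast
  have "D' = fun_derivation n' I' a' \<phi>'"
    unfolding D'
    by (rule conjugate_fun_derivation[OF \<phi> \<phi>'])
      (use ideal.rcos_eq_iff[OF P2.ideal_jac_ideal C.hom_closed P2.hom_closed] mem in blast)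
  then show "D' \<in> fun_derivation n' I' a' ` det_span s' 1 {1..n'} R'" using \<phi>' by blast
next
  interpret F: presentation_iso n' I' n I "inv_into (carrier P1.A) \<sigma>" by (rule flip)
  fix D' assume "D' \<in> fun_derivation n' I' a' ` det_span s' 1 {1..n'} R'"
  then obtain \<phi>' where \<phi>': "\<phi>' \<in> det_span s' 1 {1..n'} R'" and D': "D' = fun_derivation n' I' a' \<phi>'" by blast
  obtain \<phi> where \<phi>: "\<phi> \<in> det_span s 1 {1..n} P1.R" and
    mem: "\<And>p p'. p \<in> mpolys n \<Longrightarrow> p' \<in> mpolys n' \<Longrightarrow> F.corr p' p \<Longrightarrow>
      inv_into (carrier P1.A) \<sigma> (\<pi>' (\<phi>' (\<lambda>_. grad p'))) \<ominus>\<^bsub>P1.A\<^esub> P1.\<pi> (\<phi> (\<lambda>_. grad p)) \<in> a"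
    using F.fun_derivation_corr[OF s[symmetric] \<phi>'] by blast
  have "a' +>\<^bsub>A'\<^esub> \<sigma> (P1.\<pi> (\<phi> (\<lambda>_. grad p))) = a' +>\<^bsub>A'\<^esub> \<pi>' (\<phi>' (\<lambda>_. grad p'))"
    if p: "p \<in> mpolys n" "p' \<in> mpolys n'" "corr p p'" for p p'
  proof -
    \<comment> \<open>The comparison along the inverse isomorphism is a congruence modulo
      \<open>a\<close> in the first ring. The lift \<open>q\<close> expresses it by polynomials
      there, so that \<open>\<sigma>\<close> can carry it over to a congruence modulo
      \<open>a'\<close>.\<close>
    obtain q where q: "corr q (\<phi>' (\<lambda>_. grad p'))" using corr_surj by blast
    have "P1.\<pi> q \<ominus>\<^bsub>P1.A\<^esub> P1.\<pi> (\<phi> (\<lambda>_. grad p)) \<in> a"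
      using mem[OF p(1,2)] p(3) flip_corr q by metis
    then have "P1.\<pi> (q - \<phi> (\<lambda>_. grad p)) \<in> a" by (simp add: P1.hom_diff)
    then have "\<sigma> (P1.\<pi> (q - \<phi> (\<lambda>_. grad p))) \<in> a'"
      using jac_ideal_image_subset[of "Suc s" "Suc s'"] s by auto
    then have "\<pi>' (\<phi>' (\<lambda>_. grad p')) \<ominus>\<^bsub>A'\<^esub> \<sigma> (P1.\<pi> (\<phi> (\<lambda>_. grad p))) \<in> a'"
      by (simp add: C.hom_diff q)
    then show ?thesis
      using ideal.rcos_eq_iff[OF P2.ideal_jac_ideal P2.hom_closed C.hom_closed] by metis
  qed
  then have "(\<lambda>y\<in>carrier A'. \<sigma> ` fun_derivation n I a \<phi> (inv_into (carrier P1.A) \<sigma> y)) = D'"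
    unfolding D' by (rule conjugate_fun_derivation[OF \<phi> \<phi>'])
  then show "D' \<in> (\<lambda>D. \<lambda>y\<in>carrier A'. \<sigma> ` D (inv_into (carrier P1.A) \<sigma> y)) `
      (fun_derivation n I a ` det_span s 1 {1..n} P1.R)"
    using \<phi> by blast
qed

end

end

theorem theorem2p18:
  fixes n m s :: nat
    and I :: "'k::field_char_0 mpoly set"
    and f :: "nat \<Rightarrow> 'k mpoly"
  assumes prime: "primeideal I (mpoly_ring n)"
    and not_maximal: "\<not> maximalideal I (mpoly_ring n)"
    and gens: "generates n I m f"
    and s: "1 \<le> s" "s \<le> jacobi_rank n I m f"
  shows
    "(\<forall>m\<^sub>2 g. generates n I m\<^sub>2 g \<longrightarrow>
        jacobian_ideal n I m\<^sub>2 g (s + 1) = jacobian_ideal n I m f (s + 1) \<and>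
        der_s n I m\<^sub>2 g s = der_s n I m f s \<and>
        submodule (der_s n I m f s)
          (coord_ring n I Quot jacobian_ideal n I m f (s + 1))
          (der_module (scalar n I) (coord_ring n I) (jacobian_ideal n I m f (s + 1)))) \<and>
     (\<forall>n' I' m' f' \<sigma> s'.
        primeideal I' (mpoly_ring n') \<and>
        \<not> maximalideal I' (mpoly_ring n') \<and>
        generates n' I' m' f' \<and>
        \<sigma> \<in> alg_iso n I n' I' \<and>
        int s' = int s + int (jacobi_rank n' I' m' f') - int (jacobi_rank n I m f) \<and>
        1 \<le> s' \<and> s' \<le> jacobi_rank n' I' m' f' \<longrightarrow>
        (\<exists>\<tau> \<in> ring_iso (coord_ring n I Quot jacobian_ideal n I m f (s + 1))
                      (coord_ring n' I' Quot jacobian_ideal n' I' m' f' (s' + 1)).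
           (\<forall>x\<in>carrier (coord_ring n I).
              \<tau> (jacobian_ideal n I m f (s + 1) +>\<^bsub>coord_ring n I\<^esub> x) =
                jacobian_ideal n' I' m' f' (s' + 1) +>\<^bsub>coord_ring n' I'\<^esub> \<sigma> x) \<and>
           (\<lambda>D. \<lambda>y\<in>carrier (coord_ring n' I').
                   \<tau> (D (inv_into (carrier (coord_ring n I)) \<sigma> y))) ` der_s n I m f s
             = der_s n' I' m' f' s'))"
proof (intro conjI allI impI)
  interpret P1: prime_presentation n I by (rule prime_presentation.intro[OF prime])
  note jac = P1.jacobian_ideal_jac_ideal and der = P1.der_s_eq
  show "jacobian_ideal n I m\<^sub>2 g (s + 1) = jacobian_ideal n I m f (s + 1)"
    "der_s n I m\<^sub>2 g s = der_s n I m f s" if "generates n I m\<^sub>2 g" for m\<^sub>2 g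
    by (simp_all only: jac[OF that] jac[OF gens] der[OF that] der[OF gens])
  show "submodule (der_s n I m f s) (coord_ring n I Quot jacobian_ideal n I m f (s + 1))
      (der_module (scalar n I) (coord_ring n I) (jacobian_ideal n I m f (s + 1)))"
    using P1.submodule_fun_derivations[of s] by (simp only: jac[OF gens] der[OF gens] Suc_eq_plus1)
  fix n' I' m' f' \<sigma> s'
  assume A: "primeideal I' (mpoly_ring n') \<and> \<not> maximalideal I' (mpoly_ring n') \<and>
        generates n' I' m' f' \<and> \<sigma> \<in> alg_iso n I n' I' \<and>
        int s' = int s + int (jacobi_rank n' I' m' f') - int (jacobi_rank n I m f) \<and>
        1 \<le> s' \<and> s' \<le> jacobi_rank n' I' m' f'"
  then have prime': "primeideal I' (mpoly_ring n')" and gens': "generates n' I' m' f'"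
    and iso: "\<sigma> \<in> alg_iso n I n' I'" by blast+
  interpret presentation_iso n I n' I' \<sigma>
    by (rule presentation_iso.intro[OF prime_presentation.intro[OF prime]
          prime_presentation.intro[OF prime'] presentation_iso_axioms.intro[OF iso]])
  interpret F: presentation_iso n' I' n I "inv_into (carrier P1.A) \<sigma>" by (rule flip)
  \<comment> \<open>The two inequalities make \<open>n - r\<close> and \<open>n' - r'\<close> equal
    as integers; together with the defining equation of \<open>s'\<close> this is the only relation
    between the sizes that the comparison requires.\<close>
  have "s + n' = s' + n"
    using jacobi_rank_le[OF gens gens'] F.jacobi_rank_le[OF gens' gens] A by linarith
  then have *: "Suc s + n' = Suc s' + n" "s + n' = s' + n" by simp_all
  have eqs: "jacobian_ideal n I m f (s + 1) = P1.jac_ideal (Suc s)"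
    "jacobian_ideal n' I' m' f' (s' + 1) = P2.jac_ideal (Suc s')"
    by (simp_all only: jac[OF gens] P2.jacobian_ideal_jac_ideal[OF gens'] Suc_eq_plus1)
  show "\<exists>\<tau> \<in> ring_iso (coord_ring n I Quot jacobian_ideal n I m f (s + 1))
                      (coord_ring n' I' Quot jacobian_ideal n' I' m' f' (s' + 1)).
           (\<forall>x\<in>carrier (coord_ring n I).
              \<tau> (jacobian_ideal n I m f (s + 1) +>\<^bsub>coord_ring n I\<^esub> x) =
                jacobian_ideal n' I' m' f' (s' + 1) +>\<^bsub>coord_ring n' I'\<^esub> \<sigma> x) \<and>
           (\<lambda>D. \<lambda>y\<in>carrier (coord_ring n' I').
                   \<tau> (D (inv_into (carrier (coord_ring n I)) \<sigma> y))) ` der_s n I m f s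
             = der_s n' I' m' f' s'"
    unfolding eqs der[OF gens] P2.der_s_eq[OF gens']
    by (intro bexI[OF _ ring_iso_image[OF *(2)]] conjI ballI image_coset[OF *(2)]
        conjugate_fun_derivations[OF *(2)])
qed

end
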